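(* Fix $1\le p<\infty$ and $T>0$. Let $\{u^{\nu_k}\}_{k\in\mathbb{N}}$ be an approximate solution sequence of the incompressible Euler equations on $[0,T]\times\mathbb{T}^2$. Then $\{u^{\nu_k}\}_{k\in\mathbb{N}}$ is strongly relatively compact in $L^p(0,T;L^2(\mathbb{T}^2;\mathbb{R}^2))$ if, and only if, there exists a uniform modulus of continuity $\phi$ such that $$S_2^T(u^{\nu_k};r)\le\phi(r)\qquad\text{for all } r>0\text{ and all }k\in\mathbb{N}.$$
   Context: The spatial domain is the two-dimensional torus $D=\mathbb{T}^2$ and $L^2_x:=L^2(\mathbb{T}^2;\mathbb{R}^2)$. Approximate solution sequence: a sequence $\{u_k\}_{k\in\mathbb{N}}$, uniformly bounded in $L^\infty(0,T;L^2_x)$, such that (1) $\{u_k\}$ is uniformly bounded in $\mathrm{Lip}([0,T);H^{-L}(\mathbb{T}^2;\mathbb{R}^2))$ for some (possibly large) $L>1$; (2) for every $\Phi\in C_c^\infty([0,T)\times\mathbb{T}^2;\mathbb{R}^2)$ with $\mathrm{div}(\Phi)=0$, $$\lim_{k\to\infty}\int_0^T\!\int_{\mathbb{T}^2}\Phi_t\cdot u_k+(\nabla\Phi):(u_k\otimes u_k)\,dx\,dt+\int_{\mathbb{T}^2}\Phi(x,0)\cdot u_k(x,0)\,dx=0;$$ (3) $\mathrm{div}(u_k)=0$ in $\mathcal{D}'([0,T]\times\mathbb{T}^2)$. Structure functions: for $u\in L^2_x$ and $r>0$, $$S_2(u;r):=\Big(\int_D \frac{1}{|B_r(0)|}\int_{B_r(0)}|u(x+h)-u(x)|^2\,dh\,dx\Big)^{1/2},$$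 and for $u\in L^2(0,T;L^2_x)$, $S_2^T(u;r):=\big(\int_0^T S_2(u(t);r)^2\,dt\big)^{1/2}$. Modulus of continuity: a function $\phi:[0,\infty)\to[0,\infty)$ with $\phi(r)\to0$ as $r\to0$. *)

theory Defs
  imports "HOL-Analysis.Analysis"
begin

section \<open>The torus\<close>

text \<open>The torus is \<open>\<real>\<^sup>2/\<int>\<^sup>2\<close>: functions on it are functions on \<open>\<real>\<^sup>2\<close> of period 1 in each
  coordinate, and integrals over it are Lebesgue integrals over the unit cell.\<close>

abbreviation torus_cell :: "(real^2) set" where
  "torus_cell \<equiv> cbox 0 1"

definition periodic :: "(real^2 \<Rightarrow> 'b) \<Rightarrow> bool" where
  "periodic f \<longleftrightarrow> (\<forall>x i. f (x + axis i 1) = f x)"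

definition L2x :: "(real^2 \<Rightarrow> real^2) set" where
  "L2x = {f. f \<in> borel_measurable borel \<and> periodic f \<and>
             set_integrable lborel torus_cell (\<lambda>x. (norm (f x))\<^sup>2)}"

definition L2x_norm :: "(real^2 \<Rightarrow> real^2) \<Rightarrow> real" where
  "L2x_norm f = sqrt (LINT x:torus_cell|lborel. (norm (f x))\<^sup>2)"

section \<open>The space \<open>L\<^sup>p(0,T;L\<^sup>2)\<close>\<close>

text \<open>Elements are jointly measurable functions of \<open>(t,x)\<close>; every (class of a) Bochner measurable
  \<open>L\<^sup>2\<close>-valued function has such a representative. Functions are not identified when they agree
  almost everywhere. Hence the topology below is that of a pseudometric. Its open sets are
  saturated under almost everywhere equality, so that compactness and closure are the same as in
  the normed space of equivalence classes.\<close>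

definition LpL2 :: "real \<Rightarrow> real \<Rightarrow> (real \<Rightarrow> real^2 \<Rightarrow> real^2) set" where
  "LpL2 p T = {f. (\<lambda>(t, x). f t x) \<in> borel_measurable (restrict_space borel ({0<..<T} \<times> UNIV)) \<and>
                  (AE t in lborel. t \<in> {0<..<T} \<longrightarrow> f t \<in> L2x) \<and>
                  set_integrable lborel {0<..<T} (\<lambda>t. L2x_norm (f t) powr p)}"

definition LpL2_norm :: "real \<Rightarrow> real \<Rightarrow> (real \<Rightarrow> real^2 \<Rightarrow> real^2) \<Rightarrow> real" where
  "LpL2_norm p T f = (LINT t:{0<..<T}|lborel. L2x_norm (f t) powr p) powr (1 / p)"

definition LpL2_topology :: "real \<Rightarrow> real \<Rightarrow> (real \<Rightarrow> real^2 \<Rightarrow> real^2) topology" where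
  "LpL2_topology p T = topology (\<lambda>U. U \<subseteq> LpL2 p T \<and>
     (\<forall>f\<in>U. \<exists>\<epsilon>>0. \<forall>g\<in>LpL2 p T. LpL2_norm p T (\<lambda>t x. g t x - f t x) < \<epsilon> \<longrightarrow> g \<in> U))"

lemma openin_LpL2_topology:
  "openin (LpL2_topology p T) U \<longleftrightarrow> U \<subseteq> LpL2 p T \<and>
     (\<forall>f\<in>U. \<exists>\<epsilon>>0. \<forall>g\<in>LpL2 p T. LpL2_norm p T (\<lambda>t x. g t x - f t x) < \<epsilon> \<longrightarrow> g \<in> U)"
proof -
  let ?P = "\<lambda>U. U \<subseteq> LpL2 p T \<and>
     (\<forall>f\<in>U. \<exists>\<epsilon>>0. \<forall>g\<in>LpL2 p T. LpL2_norm p T (\<lambda>t x. g t x - f t x) < \<epsilon> \<longrightarrow> g \<in> U)"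
  have "?P (S \<inter> S')" if "?P S" "?P S'" for S S'
  proof (intro conjI ballI)
    fix f assume "f \<in> S \<inter> S'"
    then obtain d e where "d > 0" "e > 0"
      and "\<forall>g\<in>LpL2 p T. LpL2_norm p T (\<lambda>t x. g t x - f t x) < d \<longrightarrow> g \<in> S"
      and "\<forall>g\<in>LpL2 p T. LpL2_norm p T (\<lambda>t x. g t x - f t x) < e \<longrightarrow> g \<in> S'"
      using \<open>?P S\<close> \<open>?P S'\<close> by blast
    then show "\<exists>\<epsilon>>0. \<forall>g\<in>LpL2 p T. LpL2_norm p T (\<lambda>t x. g t x - f t x) < \<epsilon> \<longrightarrow> g \<in> S \<inter> S'"
      by (intro exI[of _ "min d e"]) auto
  qed (use that in blast)
  moreover have "?P (\<Union>K)" if "\<forall>S\<in>K. ?P S" for K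
  proof (intro conjI ballI)
    fix f assume "f \<in> \<Union>K"
    then obtain S where S: "S \<in> K" "f \<in> S" by blast
    have "?P S"
      using that S(1) by (rule bspec)
    then obtain e where "e > 0" "\<forall>g\<in>LpL2 p T. LpL2_norm p T (\<lambda>t x. g t x - f t x) < e \<longrightarrow> g \<in> S"
      using S(2) by blast
    then show "\<exists>\<epsilon>>0. \<forall>g\<in>LpL2 p T. LpL2_norm p T (\<lambda>t x. g t x - f t x) < \<epsilon> \<longrightarrow> g \<in> \<Union>K"
      using S by blast
  qed (use that in blast)
  ultimately have "istopology ?P"
    unfolding istopology_def by blast
  then show ?thesis
    unfolding LpL2_topology_def by simp
qed

lemma topspace_LpL2_topology [simp]: "topspace (LpL2_topology p T) = LpL2 p T"
proof
  show "topspace (LpL2_topology p T) \<subseteq> LpL2 p T"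
    using openin_LpL2_topology openin_topspace by blast
  have "openin (LpL2_topology p T) (LpL2 p T)"
    unfolding openin_LpL2_topology using zero_less_one by blast
  then show "LpL2 p T \<subseteq> topspace (LpL2_topology p T)"
    by (rule openin_subset)
qed

definition relatively_compactin :: "'a topology \<Rightarrow> 'a set \<Rightarrow> bool" where
  "relatively_compactin X S \<longleftrightarrow> S \<subseteq> topspace X \<and> compactin X (X closure_of S)"

section \<open>Negative order Sobolev spaces\<close>

definition fourier_coeff :: "(real^2 \<Rightarrow> real^2) \<Rightarrow> int^2 \<Rightarrow> complex^2" where
  "fourier_coeff f n = (\<chi> j. LINT x:torus_cell|lborel.
     cis (- 2 * pi * (\<Sum>i\<in>UNIV. of_int (n $ i) * x $ i)) * complex_of_real (f x $ j))"

definition sobolev_weight :: "real \<Rightarrow> int^2 \<Rightarrow> real" where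
  "sobolev_weight s n = (1 + (\<Sum>i\<in>UNIV. (of_int (n $ i))\<^sup>2)) powr s"

text \<open>Only those elements of \<open>H\<^sup>s\<close>, \<open>s < 0\<close>, that are \<open>L\<^sup>2\<close> functions are needed.\<close>

definition in_Hs :: "real \<Rightarrow> (real^2 \<Rightarrow> real^2) \<Rightarrow> bool" where
  "in_Hs s f \<longleftrightarrow> (\<lambda>n. sobolev_weight s n * (norm (fourier_coeff f n))\<^sup>2) summable_on UNIV"

definition Hs_norm :: "real \<Rightarrow> (real^2 \<Rightarrow> real^2) \<Rightarrow> real" where
  "Hs_norm s f = sqrt (\<Sum>\<^sub>\<infinity>n. sobolev_weight s n * (norm (fourier_coeff f n))\<^sup>2)"

section \<open>Test functions\<close>

text \<open>The derivatives are taken within \<open>S\<close>. For \<open>S = {0..<T} \<times> UNIV\<close> this means smooth up to and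
  including the initial time, with one-sided time derivatives there.\<close>

primrec C_k_on :: "nat \<Rightarrow> 'a::euclidean_space set \<Rightarrow> ('a \<Rightarrow> 'b::euclidean_space) \<Rightarrow> bool" where
  "C_k_on 0 S f \<longleftrightarrow> continuous_on S f"
| "C_k_on (Suc k) S f \<longleftrightarrow>
     (\<exists>f'. (\<forall>x\<in>S. (f has_derivative f' x) (at x within S)) \<and> (\<forall>v. C_k_on k S (\<lambda>x. f' x v)))"

definition smooth_on :: "'a::euclidean_space set \<Rightarrow> ('a \<Rightarrow> 'b::euclidean_space) \<Rightarrow> bool" where
  "smooth_on S f \<longleftrightarrow> (\<forall>k. C_k_on k S f)"

text \<open>The torus being compact, compact support in \<open>[0,T) \<times> \<real>\<^sup>2/\<int>\<^sup>2\<close> means vanishing near time \<open>T\<close>.\<close>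

definition test_field :: "real \<Rightarrow> (real \<Rightarrow> real^2 \<Rightarrow> real^2) \<Rightarrow> bool" where
  "test_field T \<Phi> \<longleftrightarrow>
     smooth_on ({0..<T} \<times> UNIV) (\<lambda>(t, x). \<Phi> t x) \<and>
     (\<forall>t\<in>{0..<T}. periodic (\<Phi> t)) \<and>
     (\<exists>T'<T. \<forall>t x. T' \<le> t \<and> t < T \<longrightarrow> \<Phi> t x = 0)"

definition test_scalar :: "real \<Rightarrow> (real \<Rightarrow> real^2 \<Rightarrow> real) \<Rightarrow> bool" where
  "test_scalar T \<psi> \<longleftrightarrow>
     smooth_on ({0..T} \<times> UNIV) (\<lambda>(t, x). \<psi> t x) \<and> (\<forall>t\<in>{0..T}. periodic (\<psi> t))"

definition divergence :: "(real^2 \<Rightarrow> real^2) \<Rightarrow> real^2 \<Rightarrow> real" where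
  "divergence F x = trace (jacobian F (at x))"

definition gradient :: "(real^2 \<Rightarrow> real) \<Rightarrow> real^2 \<Rightarrow> real^2" where
  "gradient \<psi> x = (\<chi> j. frechet_derivative \<psi> (at x) (axis j 1))"

definition tensor :: "real^2 \<Rightarrow> real^2 \<Rightarrow> real^2^2" where
  "tensor v w = (\<chi> i j. v $ i * w $ j)"

definition frobenius :: "real^2^2 \<Rightarrow> real^2^2 \<Rightarrow> real" where
  "frobenius A B = (\<Sum>i\<in>UNIV. \<Sum>j\<in>UNIV. A $ i $ j * B $ i $ j)"

section \<open>Approximate solution sequences\<close>

definition bounded_Linf_L2 :: "real \<Rightarrow> (nat \<Rightarrow> real \<Rightarrow> real^2 \<Rightarrow> real^2) \<Rightarrow> bool" where
  "bounded_Linf_L2 T u \<longleftrightarrow>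
     (\<forall>k. (\<lambda>(t, x). u k t x) \<in> borel_measurable (restrict_space borel ({0<..<T} \<times> UNIV))) \<and>
     (\<exists>M. \<forall>k. AE t in lborel. t \<in> {0<..<T} \<longrightarrow> u k t \<in> L2x \<and> L2x_norm (u k t) \<le> M)"

text \<open>\<open>u k\<close> is the representative that is Lipschitz in time with values in \<open>H\<^sup>-\<^sup>L\<close>. Being bounded
  in \<open>L\<^sup>2\<close> for almost every time, it takes values in \<open>L\<^sup>2\<close> at every time; in particular the
  initial value \<open>u k 0\<close> makes sense.\<close>

definition bounded_Lip_Hneg :: "real \<Rightarrow> real \<Rightarrow> (nat \<Rightarrow> real \<Rightarrow> real^2 \<Rightarrow> real^2) \<Rightarrow> bool" where
  "bounded_Lip_Hneg T L u \<longleftrightarrow>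
     (\<forall>k. \<forall>t\<in>{0..<T}. u k t \<in> L2x \<and> in_Hs (- L) (u k t)) \<and>
     (\<exists>C. \<forall>k. (\<forall>t\<in>{0..<T}. Hs_norm (- L) (u k t) \<le> C) \<and>
              (\<forall>s\<in>{0..<T}. \<forall>t\<in>{0..<T}. Hs_norm (- L) (\<lambda>x. u k t x - u k s x) \<le> C * \<bar>t - s\<bar>))"

definition euler_weak_form ::
    "real \<Rightarrow> (real \<Rightarrow> real^2 \<Rightarrow> real^2) \<Rightarrow> (real \<Rightarrow> real^2 \<Rightarrow> real^2) \<Rightarrow> real" where
  "euler_weak_form T \<Phi> u =
     (LINT t:{0<..<T}|lborel. LINT x:torus_cell|lborel.
        vector_derivative (\<lambda>s. \<Phi> s x) (at t) \<bullet> u t x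
        + frobenius (jacobian (\<Phi> t) (at x)) (tensor (u t x) (u t x)))
     + (LINT x:torus_cell|lborel. \<Phi> 0 x \<bullet> u 0 x)"

definition distr_div_free :: "real \<Rightarrow> (real \<Rightarrow> real^2 \<Rightarrow> real^2) \<Rightarrow> bool" where
  "distr_div_free T u \<longleftrightarrow> (\<forall>\<psi>. test_scalar T \<psi> \<longrightarrow>
     (LINT t:{0<..<T}|lborel. LINT x:torus_cell|lborel. u t x \<bullet> gradient (\<psi> t) x) = 0)"

definition approximate_solution_sequence ::
    "real \<Rightarrow> (nat \<Rightarrow> real \<Rightarrow> real^2 \<Rightarrow> real^2) \<Rightarrow> bool" where
  "approximate_solution_sequence T u \<longleftrightarrow>
     bounded_Linf_L2 T u \<and>
     (\<exists>L>1. bounded_Lip_Hneg T L u) \<and>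
     (\<forall>\<Phi>. test_field T \<Phi> \<and> (\<forall>t\<in>{0..<T}. \<forall>x. divergence (\<Phi> t) x = 0) \<longrightarrow>
        (\<lambda>k. euler_weak_form T \<Phi> (u k)) \<longlonglongrightarrow> 0) \<and>
     (\<forall>k. distr_div_free T (u k))"

section \<open>Structure functions\<close>

text \<open>\<open>h\<close> ranges over the ball of \<open>\<real>\<^sup>2\<close>, also when it is larger than the unit cell.\<close>

definition S2 :: "(real^2 \<Rightarrow> real^2) \<Rightarrow> real \<Rightarrow> real" where
  "S2 u r = sqrt (LINT x:torus_cell|lborel.
     1 / measure lborel (ball (0::real^2) r) *
       (LINT h:ball 0 r|lborel. (norm (u (x + h) - u x))\<^sup>2))"

definition S2T :: "real \<Rightarrow> (real \<Rightarrow> real^2 \<Rightarrow> real^2) \<Rightarrow> real \<Rightarrow> real" where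
  "S2T T u r = sqrt (LINT t:{0<..<T}|lborel. (S2 (u t) r)\<^sup>2)"

text \<open>As a function on \<open>[0,\<infinity>)\<close>; the values at negative arguments play no role.\<close>

definition modulus_of_continuity :: "(real \<Rightarrow> real) \<Rightarrow> bool" where
  "modulus_of_continuity \<phi> \<longleftrightarrow> (\<forall>r\<ge>0. \<phi> r \<ge> 0) \<and> (\<phi> \<longlongrightarrow> 0) (at_right 0)"

end

theory Submission
  imports Defs
begin

text \<open>Let \<open>G u h\<close> be the integral of \<open>|u(t,x+h) - u(t,x)|\<^sup>2\<close> over \<open>(0,T)\<close> and the torus. The square of the
  structure function is the average of \<open>G u\<close> over a ball, and since \<open>G u h \<le> 2 G u h' + 2 G u (h' - h)\<close>, a
  uniform modulus for the structure functions means that \<open>G u h \<rightarrow> 0\<close> as \<open>h \<rightarrow> 0\<close> uniformly in the sequence.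
  A totally bounded set has this property, because each single field has it.
  Conversely, convolution with a nonnegative trigonometric kernel that is concentrated at the lattice points
  changes the fields by a uniformly small amount, and the convolved fields are combinations of
  finitely many Fourier modes. The bound in \<open>Lip([0,T);H\<^sup>-\<^sup>L)\<close> makes the coefficients of these modes
  uniformly bounded and uniformly Lipschitz in time, so that they form a totally bounded set.
  As the fields are bounded in \<open>L\<^sup>\<infinity>(0,T;L\<^sup>2)\<close>, total boundedness in \<open>L\<^sup>2(0,T;L\<^sup>2)\<close> and in
  \<open>L\<^sup>p(0,T;L\<^sup>2)\<close> are equivalent, and \<open>L\<^sup>p(0,T;L\<^sup>2)\<close> is complete.\<close>

section \<open>Relative compactness in pseudometric spaces\<close>

text \<open>Only a norm of negative order controls the dependence on time, so compactness in time is
  available one Fourier mode at a time, with a Lipschitz constant that may grow with the frequency.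
  The kernel therefore has to be an exact trigonometric polynomial, and its finite spectrum is fixed
  before any net in time is chosen. It is a normalised power of
  \<open>(2 + cos (2 * pi * h $ 1) + cos (2 * pi * h $ 2)) / 4\<close>, a function with values in
  [0,1] that is 1 exactly on the lattice.

  The convolved fields are never collected into a set. The norm of any square integrable field is
  bounded by a kernel average of its shift differences plus finitely many coefficients, and this
  bound is applied to the difference of two members of the sequence.

  Passing between the exponents 2 and p in either direction costs an additive error: on [0,b] the
  bound \<open>a powr q \<le> \<eta> + C * a powr p\<close> holds for every positive \<eta> with a
  suitable C.

  Most estimates use extended nonnegative integrals, so that Tonelli's theorem asks for
  measurability alone.\<close>

lemma pseudometric_compact_closure_iff:
  fixes d :: "'a \<Rightarrow> 'a \<Rightarrow> real"
  assumes nonneg: "\<And>x y. 0 \<le> d x y"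
    and sym: "\<And>x y. d x y = d y x"
    and refl: "\<And>x. x \<in> M \<Longrightarrow> d x x = 0"
    and tri: "\<And>x y z. x \<in> M \<Longrightarrow> y \<in> M \<Longrightarrow> z \<in> M \<Longrightarrow> d x z \<le> d x y + d y z"
    and X: "\<And>U. openin X U \<longleftrightarrow> U \<subseteq> M \<and> (\<forall>f\<in>U. \<exists>\<epsilon>>0. \<forall>g\<in>M. d g f < \<epsilon> \<longrightarrow> g \<in> U)"
    and complete: "\<And>\<sigma>. (\<And>n::nat. \<sigma> n \<in> M) \<Longrightarrow>
        (\<And>\<epsilon>. \<epsilon> > 0 \<Longrightarrow> \<exists>N. \<forall>m\<ge>N. \<forall>n\<ge>N. d (\<sigma> m) (\<sigma> n) < \<epsilon>) \<Longrightarrow>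
        \<exists>l\<in>M. (\<lambda>n. d (\<sigma> n) l) \<longlonglongrightarrow> 0"
    and S: "S \<subseteq> M"
  shows "compactin X (X closure_of S) \<longleftrightarrow>
    (\<forall>\<epsilon>>0. \<exists>K\<subseteq>S. finite K \<and> (\<forall>x\<in>S. \<exists>y\<in>K. d x y < \<epsilon>))"
proof -
  \<comment> \<open>One point is chosen in every class of points at mutual distance zero. Two points
    of the same class have the same candidates, so \<open>SOME\<close> picks the same one and
    \<open>rep\<close> is constant on classes.\<close>
  define rep where "rep x = (SOME y. y \<in> M \<and> d x y = 0)" for x
  have rep: "rep x \<in> M \<and> d x (rep x) = 0" if "x \<in> M" for x
    unfolding rep_def by (rule someI[of _ x]) (simp add: that refl)
  have d_eq: "d x z = d y z" if "x \<in> M" "y \<in> M" "z \<in> M" "d x y = 0" for x y z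
    using tri[of x y z] tri[of y x z] that sym[of x y] by linarith
  have rep_eq: "rep x = rep y" if "x \<in> M" "y \<in> M" "d x y = 0" for x y
  proof -
    have "z \<in> M \<and> d x z = 0 \<longleftrightarrow> z \<in> M \<and> d y z = 0" for z
      using d_eq[OF that(1,2) _ that(3), of z] by metis
    then show ?thesis by (simp add: rep_def)
  qed
  have d_rep: "d (rep x) (rep y) = d x y" if "x \<in> M" "y \<in> M" for x y
  proof -
    have "d (rep x) (rep y) = d (rep y) x"
      using d_eq[of x "rep x" "rep y"] rep[OF that(1)] rep[OF that(2)] that sym[of x "rep y"] by simp
    also have "\<dots> = d y x"
      using d_eq[of y "rep y" x] rep[OF that(2)] that by simp
    finally show ?thesis by (simp only: sym[of y x])
  qed
  define M' where "M' = rep ` M"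
  have rep_M': "rep x \<in> M'" if "x \<in> M" for x
    using that by (auto simp: M'_def)
  have M'_sub: "M' \<subseteq> M"
    using rep by (auto simp: M'_def)
  have rep_id: "rep x = x" if "x \<in> M'" for x
    using that rep rep_eq unfolding M'_def by (metis imageE)
  \<comment> \<open>The representatives form a genuine metric space, where a totally bounded subset
    of a complete space has compact closure. What remains is to carry open sets and closures between
    \<open>M'\<close> and \<open>X\<close>.\<close>
  interpret m: Metric_space M' d
  proof
    show "d x y = 0 \<longleftrightarrow> x = y" if "x \<in> M'" "y \<in> M'" for x y
      using that rep_eq rep_id M'_sub refl by (metis subsetD)
    show "d x z \<le> d x y + d y z" if "x \<in> M'" "y \<in> M'" "z \<in> M'" for x y z
      using that tri M'_sub by blast
  qed (use nonneg sym in auto)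
  have top: "topspace X = M"
  proof
    show "topspace X \<subseteq> M" using X openin_topspace by blast
    have "openin X M" unfolding X using zero_less_one by blast
    then show "M \<subseteq> topspace X" by (rule openin_subset)
  qed
  have closure_M: "x \<in> M" if "x \<in> X closure_of S" for x
    using subsetD[OF closure_of_subset_topspace that] top by simp
  have meets: "\<exists>y\<in>A. y \<in> U" if "x \<in> Y closure_of A" "openin Y U" "x \<in> U"
    for x U A and Y :: "'a topology"
    using that unfolding in_closure_of by fast
  have open_vimage: "openin X {x \<in> M. rep x \<in> V}" if V: "openin m.mtopology V" for V
    unfolding X
  proof (intro conjI ballI)
    fix f assume f: "f \<in> {x \<in> M. rep x \<in> V}"
    then have "rep f \<in> V" by simp
    then obtain r where r: "r > 0" "m.mball (rep f) r \<subseteq> V"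
      using V unfolding m.openin_mtopology by auto
    have "rep g \<in> V" if "g \<in> M" "d g f < r" for g
    proof -
      have "rep g \<in> m.mball (rep f) r"
        using that f d_rep[of f g] sym[of f g] rep_M' by auto
      then show ?thesis using r by blast
    qed
    then show "\<exists>\<epsilon>>0. \<forall>g\<in>M. d g f < \<epsilon> \<longrightarrow> g \<in> {x \<in> M. rep x \<in> V}"
      using r by blast
  qed auto
  \<comment> \<open>An open set contains, with a point, everything at distance zero from it. This
    makes covers in \<open>X\<close> and covers in \<open>M'\<close> interchangeable.\<close>
  have saturated: "x \<in> U \<longleftrightarrow> rep x \<in> U" if "openin X U" "x \<in> M" for U x
    using that rep[of x] sym[of x "rep x"] unfolding X by metis
  have open_Int: "openin m.mtopology (U \<inter> M')" if U: "openin X U" for U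
    unfolding m.openin_mtopology
  proof (intro conjI allI impI)
    fix x assume x: "x \<in> U \<inter> M'"
    then obtain r where r: "r > 0" "\<forall>g\<in>M. d g x < r \<longrightarrow> g \<in> U"
      using U unfolding X by auto
    have "m.mball x r \<subseteq> U \<inter> M'"
      using M'_sub r(2) by (auto simp: sym[of x])
    then show "\<exists>r>0. m.mball x r \<subseteq> U \<inter> M'"
      using r(1) by blast
  qed auto
  have mcomplete: m.mcomplete
    unfolding m.mcomplete_def
  proof (intro allI impI)
    fix \<sigma> assume "m.MCauchy \<sigma>"
    then have \<sigma>: "range \<sigma> \<subseteq> M'" "\<And>\<epsilon>. \<epsilon> > 0 \<Longrightarrow> \<exists>N. \<forall>m n. N \<le> m \<longrightarrow> N \<le> n \<longrightarrow> d (\<sigma> m) (\<sigma> n) < \<epsilon>"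
      unfolding m.MCauchy_def by auto
    have "\<exists>l\<in>M. (\<lambda>n. d (\<sigma> n) l) \<longlonglongrightarrow> 0"
    proof (rule complete)
      show "\<sigma> n \<in> M" for n using \<sigma>(1) M'_sub by auto
      show "\<exists>N. \<forall>m\<ge>N. \<forall>n\<ge>N. d (\<sigma> m) (\<sigma> n) < \<epsilon>" if "\<epsilon> > 0" for \<epsilon>
        using \<sigma>(2)[OF that] by metis
    qed
    then obtain l where l: "l \<in> M" "(\<lambda>n. d (\<sigma> n) l) \<longlonglongrightarrow> 0" by blast
    have "d (\<sigma> n) (rep l) = d (\<sigma> n) l" for n
      using d_rep[of "\<sigma> n" l] rep_id \<sigma>(1) M'_sub l(1) by (metis rangeI subsetD)
    then have "limitin m.mtopology \<sigma> (rep l) sequentially"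
      unfolding m.limitin_metric_dist_null using l \<sigma>(1) rep_M' by (auto simp: range_subsetD)
    then show "\<exists>x. limitin m.mtopology \<sigma> x sequentially" by blast
  qed
  have S': "rep ` S \<subseteq> M'" using S by (auto simp: M'_def)
  have closure: "rep x \<in> m.mtopology closure_of (rep ` S)" if "x \<in> X closure_of S" for x
  proof -
    have x: "x \<in> M" using that by (rule closure_M)
    have "\<exists>y\<in>rep ` S. y \<in> V" if V: "openin m.mtopology V" "rep x \<in> V" for V
    proof -
      have "\<exists>y\<in>S. y \<in> {x \<in> M. rep x \<in> V}"
        by (rule meets[OF \<open>x \<in> X closure_of S\<close> open_vimage[OF V(1)]]) (simp add: x V(2))
      then show ?thesis by blast
    qed
    then show ?thesis using rep_M'[OF x] by (simp add: in_closure_of)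
  qed
  have closure': "m.mtopology closure_of (rep ` S) \<subseteq> X closure_of S"
  proof
    fix x assume x: "x \<in> m.mtopology closure_of (rep ` S)"
    then have xM: "x \<in> M'" by (metis in_closure_of m.topspace_mtopology)
    have "\<exists>y\<in>S. y \<in> U" if U: "openin X U" "x \<in> U" for U
    proof -
      obtain y where "y \<in> rep ` S" "y \<in> U \<inter> M'"
        using meets[OF x open_Int[OF U(1)]] U(2) xM by auto
      then show ?thesis using saturated[OF U(1)] S by blast
    qed
    then show "x \<in> X closure_of S" using xM M'_sub by (auto simp: in_closure_of top)
  qed
  show ?thesis
  proof
    assume compact: "compactin X (X closure_of S)"
    show "\<forall>\<epsilon>>0. \<exists>K\<subseteq>S. finite K \<and> (\<forall>x\<in>S. \<exists>y\<in>K. d x y < \<epsilon>)"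
    proof (intro allI impI)
      fix \<epsilon> :: real assume "\<epsilon> > 0"
      define B where "B s = {x \<in> M. d x s < \<epsilon>}" for s
      have B: "openin X (B s)" if "s \<in> M" for s
        unfolding X
      proof (intro conjI ballI)
        fix f assume "f \<in> B s"
        then show "\<exists>e>0. \<forall>g\<in>M. d g f < e \<longrightarrow> g \<in> B s"
          using tri[of _ f s] that by (intro exI[of _ "\<epsilon> - d f s"]) (force simp: B_def)
      qed (auto simp: B_def)
      \<comment> \<open>The centres lie in \<open>S\<close> itself: each point of the closure has a
        point of \<open>S\<close> within \<epsilon>, so a finite subcover of the closure yields a
        net contained in \<open>S\<close>.\<close>
      have "X closure_of S \<subseteq> \<Union>(B ` S)"
      proof
        fix x assume x: "x \<in> X closure_of S"
        then have xM: "x \<in> M" by (rule closure_M)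
        have "x \<in> B x" using xM refl \<open>\<epsilon> > 0\<close> by (auto simp: B_def)
        then obtain s where "s \<in> S" "s \<in> B x"
          using meets[OF x B[OF xM]] by auto
        then show "x \<in> \<Union>(B ` S)" using xM sym by (auto simp: B_def)
      qed
      then obtain \<F> where \<F>: "finite \<F>" "\<F> \<subseteq> B ` S" "X closure_of S \<subseteq> \<Union>\<F>"
        using compactinD[OF compact, of "B ` S"] B S by blast
      then obtain K where K: "K \<subseteq> S" "finite K" "\<F> = B ` K"
        by (metis finite_subset_image)
      have "S \<subseteq> \<Union>(B ` K)"
        using closure_of_subset[of S X] S top \<F>(3) K(3) by auto
      then show "\<exists>K\<subseteq>S. finite K \<and> (\<forall>x\<in>S. \<exists>y\<in>K. d x y < \<epsilon>)"
        using K by (intro exI[of _ K]) (auto simp: B_def)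
    qed
  next
    assume tb: "\<forall>\<epsilon>>0. \<exists>K\<subseteq>S. finite K \<and> (\<forall>x\<in>S. \<exists>y\<in>K. d x y < \<epsilon>)"
    have "m.mtotally_bounded (rep ` S)"
      unfolding m.mtotally_bounded_def
    proof (intro allI impI)
      fix \<epsilon> :: real assume "\<epsilon> > 0"
      then obtain K where K: "K \<subseteq> S" "finite K" "\<forall>x\<in>S. \<exists>y\<in>K. d x y < \<epsilon>"
        using tb by blast
      have "\<exists>y\<in>K. rep x \<in> m.mball (rep y) \<epsilon>" if x: "x \<in> S" for x
      proof -
        obtain y where "y \<in> K" "d x y < \<epsilon>" using K(3) x by blast
        moreover from this have "y \<in> M" "x \<in> M" using x K(1) S by auto
        ultimately show ?thesis
          using d_rep[of y x] sym[of x y]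
          by (intro bexI[of _ y]) (auto intro: rep_M')
      qed
      then show "\<exists>K. finite K \<and> K \<subseteq> rep ` S \<and> rep ` S \<subseteq> (\<Union>x\<in>K. m.mball x \<epsilon>)"
        using K by (intro exI[of _ "rep ` K"]) blast
    qed
    then have cpt: "compactin m.mtopology (m.mtopology closure_of (rep ` S))"
      using m.mtotally_bounded_eq_compact_closure_of[OF mcomplete] by blast
    show "compactin X (X closure_of S)"
      unfolding compactin_def
    proof (intro conjI allI impI)
      fix \<U> assume \<U>: "Ball \<U> (openin X) \<and> X closure_of S \<subseteq> \<Union>\<U>"
      \<comment> \<open>The cover is traced on \<open>M'\<close>, where finitely many traces
        suffice. Saturation lifts them back, since \<open>rep\<close> maps the closure of
        \<open>S\<close> into the closure formed in \<open>M'\<close>.\<close>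
      have "\<exists>\<F>. finite \<F> \<and> \<F> \<subseteq> (\<lambda>U. U \<inter> M') ` \<U> \<and> m.mtopology closure_of (rep ` S) \<subseteq> \<Union>\<F>"
        by (rule compactinD[OF cpt])
           (use \<U> open_Int closure' closure_of_subset_topspace[of m.mtopology "rep ` S"] in auto)
      then obtain \<G> where \<G>: "finite \<G>" "\<G> \<subseteq> \<U>"
          "m.mtopology closure_of (rep ` S) \<subseteq> \<Union>((\<lambda>U. U \<inter> M') ` \<G>)"
        by (metis finite_subset_image)
      have "x \<in> \<Union>\<G>" if x: "x \<in> X closure_of S" for x
      proof -
        obtain U where "U \<in> \<G>" "rep x \<in> U" using closure[OF x] \<G>(3) by blast
        moreover have "x \<in> M" using x by (rule closure_M)
        ultimately show ?thesis using saturated[of U x] \<U> \<G>(2) by blast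
      qed
      then show "\<exists>\<F>. finite \<F> \<and> \<F> \<subseteq> \<U> \<and> X closure_of S \<subseteq> \<Union>\<F>"
        using \<G> by blast
    qed (rule closure_of_subset_topspace)
  qed
qed

section \<open>Completeness of \<open>L\<^sup>2\<close> on the torus\<close>

lemma powr_convex_combination:
  fixes x y l p :: real
  assumes "1 \<le> p" "0 \<le> l" "l \<le> 1" "0 \<le> x" "0 \<le> y"
  shows "((1 - l) * x + l * y) powr p \<le> (1 - l) * x powr p + l * y powr p"
proof -
  \<comment> \<open>This settles the case of a vanishing argument, apart from convexity on positive
    numbers.\<close>
  have *: "(a * z) powr p \<le> a * z powr p" if "0 \<le> a" "a \<le> 1" for a z :: real
  proof -
    have "a powr p \<le> a powr 1" using that assms(1) by (intro powr_mono') auto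
    then show ?thesis using that by (simp add: powr_mult mult_right_mono)
  qed
  consider "x = 0" | "y = 0" | "0 < x" "0 < y" using assms by linarith
  then show ?thesis
  proof cases
    case 3
    then show ?thesis using convex_onD[OF powr_convex[OF assms(1)], of l x y] assms by simp
  qed (use *[of l y] *[of "1 - l" x] assms in auto)
qed

lemma integrable_powr_add:
  fixes f g :: "'a \<Rightarrow> real"
  assumes p: "1 \<le> p" and pos: "\<And>x. 0 \<le> f x" "\<And>x. 0 \<le> g x"
    and [measurable]: "f \<in> borel_measurable M" "g \<in> borel_measurable M"
    and int: "integrable M (\<lambda>x. f x powr p)" "integrable M (\<lambda>x. g x powr p)"
  shows "integrable M (\<lambda>x. (f x + g x) powr p)"
proof (rule Bochner_Integration.integrable_bound)
  show "integrable M (\<lambda>x. 2 powr p * (f x powr p + g x powr p))"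
    using int by simp
  have "(f x + g x) powr p \<le> 2 powr p * (f x powr p + g x powr p)" for x
  proof -
    \<comment> \<open>The sum is twice the midpoint of the two values; convexity at the midpoint
      leaves the factor \<open>2 powr p\<close>.\<close>
    have "(f x + g x) powr p = (2 * ((1 - 1/2) * f x + 1/2 * g x)) powr p" by simp
    also have "\<dots> \<le> 2 powr p * ((1 - 1/2) * f x powr p + 1/2 * g x powr p)"
      unfolding powr_mult[of 2] using p pos
      by (intro mult_left_mono powr_convex_combination) auto
    also have "\<dots> \<le> 2 powr p * (f x powr p + g x powr p)"
      by (intro mult_left_mono add_mono) auto
    finally show ?thesis .
  qed
  then show "AE x in M. norm ((f x + g x) powr p) \<le> norm (2 powr p * (f x powr p + g x powr p))"
    by (auto intro!: AE_I2 simp: abs_mult)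
qed measurable

text \<open>With A and B slightly above the two norms, f + g is A + B times the convex combination
  of f / A and g / B with weights A / (A + B) and B / (A + B). Convexity then bounds the integral of
  its power by \<open>(A + B) powr p\<close>. The slack e / 2 keeps A and B positive even if a norm
  vanishes.\<close>

theorem Minkowski:
  fixes f g :: "'a \<Rightarrow> real"
  assumes p: "1 \<le> p" and pos: "\<And>x. 0 \<le> f x" "\<And>x. 0 \<le> g x"
    and [measurable]: "f \<in> borel_measurable M" "g \<in> borel_measurable M"
    and int: "integrable M (\<lambda>x. f x powr p)" "integrable M (\<lambda>x. g x powr p)"
  shows "(LINT x|M. (f x + g x) powr p) powr (1/p) \<le>
    (LINT x|M. f x powr p) powr (1/p) + (LINT x|M. g x powr p) powr (1/p)"
proof (rule field_le_epsilon)
  fix e :: real assume "e > 0"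
  define A where "A = (LINT x|M. f x powr p) powr (1/p) + e/2"
  define B where "B = (LINT x|M. g x powr p) powr (1/p) + e/2"
  have AB: "A > 0" "B > 0" using \<open>e > 0\<close> by (auto simp: A_def B_def add_nonneg_pos)
  have le1: "(LINT x|M. h x powr p) / C powr p \<le> 1"
    if "C = (LINT x|M. h x powr p) powr (1/p) + e/2" for h C
  proof -
    have "(LINT x|M. h x powr p) = ((LINT x|M. h x powr p) powr (1/p)) powr p"
      using p by (simp add: powr_powr)
    also have "\<dots> \<le> C powr p" using p \<open>e > 0\<close> that by (intro powr_mono2) auto
    finally have "(LINT x|M. h x powr p) \<le> C powr p" .
    moreover have "C powr p \<ge> 0" by simp
    ultimately show ?thesis by (auto simp: divide_le_eq_1)
  qed
  define l where "l = B / (A + B)"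
  have l: "0 \<le> l" "l \<le> 1" "(A + B) * (1 - l) = A" "(A + B) * l = B"
    using AB by (auto simp: l_def field_simps)
  have pt: "(f x + g x) powr p \<le> (A + B) powr p *
      ((1 - l) * (f x powr p / A powr p) + l * (g x powr p / B powr p))" for x
  proof -
    have "(A + B) * ((1 - l) * (f x / A) + l * (g x / B)) =
        ((A + B) * (1 - l)) * (f x / A) + ((A + B) * l) * (g x / B)"
      by (simp only: distrib_left mult.assoc)
    then have "f x + g x = (A + B) * ((1 - l) * (f x / A) + l * (g x / B))"
      unfolding l(3,4) using AB by simp
    then have "(f x + g x) powr p = (A + B) powr p * ((1 - l) * (f x / A) + l * (g x / B)) powr p"
      by (simp only: powr_mult)
    also have "\<dots> \<le> (A + B) powr p * ((1 - l) * (f x / A) powr p + l * (g x / B) powr p)"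
      using p pos l AB by (intro mult_left_mono powr_convex_combination) auto
    finally show ?thesis by (simp add: powr_divide)
  qed
  have "(LINT x|M. (f x + g x) powr p) \<le> (LINT x|M. (A + B) powr p *
      ((1 - l) * (f x powr p / A powr p) + l * (g x powr p / B powr p)))"
    by (intro integral_mono pt integrable_powr_add assms) (use int in simp)
  also have "\<dots> = (A + B) powr p * ((1 - l) * ((LINT x|M. f x powr p) / A powr p) +
      l * ((LINT x|M. g x powr p) / B powr p))"
    using int by simp
  also have "\<dots> \<le> (A + B) powr p * ((1 - l) * 1 + l * 1)"
    using l le1[OF A_def] le1[OF B_def] by (intro mult_left_mono add_mono) auto
  finally have "(LINT x|M. (f x + g x) powr p) \<le> (A + B) powr p" by simp
  then have "(LINT x|M. (f x + g x) powr p) powr (1/p) \<le> ((A + B) powr p) powr (1/p)"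
    using p by (intro powr_mono2 integral_nonneg_AE) auto
  also have "\<dots> = A + B" using p AB by (simp add: powr_powr)
  finally show "(LINT x|M. (f x + g x) powr p) powr (1/p) \<le>
    (LINT x|M. f x powr p) powr (1/p) + (LINT x|M. g x powr p) powr (1/p) + e"
    by (simp add: A_def B_def)
qed

text \<open>The squared norm as an extended integral, meaningful without integrability and open to
  Tonelli and Fatou. On \<open>L2x\<close> it agrees with the square of
  \<open>L2x_norm\<close>.\<close>

definition sq_int :: "(real^2 \<Rightarrow> 'b::real_normed_vector) \<Rightarrow> ennreal" where
  "sq_int f = (\<integral>\<^sup>+x\<in>torus_cell. ennreal ((norm (f x))\<^sup>2) \<partial>lborel)"

lemma L2x_borel: "f \<in> L2x \<Longrightarrow> f \<in> borel_measurable borel"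
  by (simp add: L2x_def)

lemma L2x_periodic: "f \<in> L2x \<Longrightarrow> periodic f"
  by (simp add: L2x_def)

lemma L2x_norm_nonneg [simp]: "0 \<le> L2x_norm f"
  by (auto simp: L2x_norm_def set_lebesgue_integral_def intro!: integral_nonneg_AE)

lemma L2x_norm_minus_commute: "L2x_norm (\<lambda>x. f x - g x) = L2x_norm (\<lambda>x. g x - f x)"
  by (simp add: L2x_norm_def norm_minus_commute)

lemma sq_int_L2x:
  assumes "f \<in> L2x"
  shows "sq_int f = ennreal ((L2x_norm f)\<^sup>2)"
proof -
  have "sq_int f = (\<integral>\<^sup>+x. ennreal (indicator torus_cell x *\<^sub>R (norm (f x))\<^sup>2) \<partial>lborel)"
    unfolding sq_int_def by (intro nn_integral_cong) (auto simp: indicator_def)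
  also have "\<dots> = ennreal (LINT x:torus_cell|lborel. (norm (f x))\<^sup>2)"
    using assms unfolding set_lebesgue_integral_def L2x_def set_integrable_def
    by (intro nn_integral_eq_integral) auto
  also have "(LINT x:torus_cell|lborel. (norm (f x))\<^sup>2) = (L2x_norm f)\<^sup>2"
    unfolding L2x_norm_def set_lebesgue_integral_def
    by (subst real_sqrt_pow2) (auto intro!: integral_nonneg_AE)
  finally show ?thesis .
qed

lemma L2x_iff_sq_int:
  "f \<in> L2x \<longleftrightarrow> f \<in> borel_measurable borel \<and> periodic f \<and> sq_int f < \<infinity>"
proof -
  have "set_integrable lborel torus_cell (\<lambda>x. (norm (f x))\<^sup>2) \<longleftrightarrow> sq_int f < \<infinity>"
    if [measurable]: "f \<in> borel_measurable borel"
  proof -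
    have "sq_int f = (\<integral>\<^sup>+x. ennreal (norm (indicator torus_cell x *\<^sub>R (norm (f x))\<^sup>2)) \<partial>lborel)"
      unfolding sq_int_def by (intro nn_integral_cong) (auto simp: indicator_def)
    then show ?thesis
      unfolding set_integrable_def integrable_iff_bounded by simp
  qed
  then show ?thesis by (auto simp: L2x_def)
qed

lemma periodic_diff: "periodic f \<Longrightarrow> periodic g \<Longrightarrow> periodic (\<lambda>x. f x - g x)"
  by (simp add: periodic_def)

lemma periodic_shift: "periodic f \<Longrightarrow> periodic (\<lambda>x. f (x + h))"
  unfolding periodic_def by (metis add.assoc add.commute)

text \<open>Brings the norm into the shape that \<open>Minkowski\<close> expects for the exponent
  2.\<close>

lemma L2x_norm_eq_powr: "L2x_norm f = (LINT x|lborel. (indicator torus_cell x * norm (f x)) powr 2) powr (1/2)"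
proof -
  have "(LINT x:torus_cell|lborel. (norm (f x))\<^sup>2) = (LINT x|lborel. (indicator torus_cell x * norm (f x)) powr 2)"
    unfolding set_lebesgue_integral_def by (intro Bochner_Integration.integral_cong) (auto simp: indicator_def)
  then show ?thesis
    unfolding L2x_norm_def by (subst powr_half_sqrt) (auto intro!: integral_nonneg_AE)
qed

lemma L2x_integrable_powr:
  assumes "f \<in> L2x"
  shows "integrable lborel (\<lambda>x. (indicator torus_cell x * norm (f x)) powr 2)"
proof -
  have "integrable lborel (\<lambda>x. indicator torus_cell x *\<^sub>R (norm (f x))\<^sup>2)"
    using assms by (simp add: L2x_def set_integrable_def)
  also have "(\<lambda>x. indicator torus_cell x *\<^sub>R (norm (f x))\<^sup>2) = (\<lambda>x. (indicator torus_cell x * norm (f x)) powr 2)"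
    by (auto simp: indicator_def)
  finally show ?thesis .
qed

text \<open>Squared norms add up under integrals while square roots do not; hence this form of the
  triangle inequality, whose factor 2 recurs in the estimates on shifts.\<close>

lemma norm_diff_sq_le: "(norm (a - b))\<^sup>2 \<le> 2 * (norm a)\<^sup>2 + 2 * (norm b)\<^sup>2"
  for a b :: "'b::real_normed_vector"
proof -
  have "(norm (a - b))\<^sup>2 \<le> (norm a + norm b)\<^sup>2"
    by (intro power_mono norm_triangle_ineq4) auto
  also have "\<dots> \<le> 2 * (norm a)\<^sup>2 + 2 * (norm b)\<^sup>2"
    using sum_squares_bound[of "norm a" "norm b"] by (simp add: power2_sum)
  finally show ?thesis .
qed

lemma ennreal_double_add: "0 \<le> x \<Longrightarrow> 0 \<le> y \<Longrightarrow> 2 * ennreal x + 2 * ennreal y = ennreal (2 * x + 2 * y)"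
  by (simp add: ennreal_plus ennreal_mult)

lemma sq_int_diff_le:
  fixes f g :: "real^2 \<Rightarrow> 'b::{real_normed_vector,second_countable_topology}"
  assumes [measurable]: "f \<in> borel_measurable borel" "g \<in> borel_measurable borel"
  shows "sq_int (\<lambda>x. f x - g x) \<le> 2 * sq_int f + 2 * sq_int g"
proof -
  have "sq_int (\<lambda>x. f x - g x) \<le> (\<integral>\<^sup>+x. 2 * (ennreal ((norm (f x))\<^sup>2) * indicator torus_cell x)
      + 2 * (ennreal ((norm (g x))\<^sup>2) * indicator torus_cell x) \<partial>lborel)"
    unfolding sq_int_def
  proof (intro nn_integral_mono)
    fix x
    have "ennreal ((norm (f x - g x))\<^sup>2) \<le> ennreal (2 * (norm (f x))\<^sup>2 + 2 * (norm (g x))\<^sup>2)"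
      by (intro ennreal_leI norm_diff_sq_le)
    also have "\<dots> = 2 * ennreal ((norm (f x))\<^sup>2) + 2 * ennreal ((norm (g x))\<^sup>2)"
      by (simp add: ennreal_plus ennreal_mult)
    finally show "ennreal ((norm (f x - g x))\<^sup>2) * indicator torus_cell x \<le>
      2 * (ennreal ((norm (f x))\<^sup>2) * indicator torus_cell x)
      + 2 * (ennreal ((norm (g x))\<^sup>2) * indicator torus_cell x)"
      by (auto simp: indicator_def)
  qed
  also have "\<dots> = 2 * sq_int f + 2 * sq_int g"
    unfolding sq_int_def by (simp add: nn_integral_add nn_integral_cmult)
  finally show ?thesis .
qed

lemma L2x_diff:
  assumes "f \<in> L2x" "g \<in> L2x"
  shows "(\<lambda>x. f x - g x) \<in> L2x"
proof -
  have "sq_int (\<lambda>x. f x - g x) \<le> 2 * sq_int f + 2 * sq_int g"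
    using assms by (intro sq_int_diff_le L2x_borel)
  also have "\<dots> < \<infinity>" using assms by (simp add: sq_int_L2x ennreal_mult_less_top)
  finally show ?thesis using assms by (auto simp: L2x_iff_sq_int intro: periodic_diff)
qed

lemma L2x_norm_triangle:
  assumes "f \<in> L2x" "g \<in> L2x" "h \<in> L2x"
  shows "L2x_norm (\<lambda>x. f x - h x) \<le> L2x_norm (\<lambda>x. f x - g x) + L2x_norm (\<lambda>x. g x - h x)"
proof -
  note [measurable] = assms[THEN L2x_borel]
  let ?a = "\<lambda>x. indicator torus_cell x * norm (f x - g x)"
  let ?b = "\<lambda>x. indicator torus_cell x * norm (g x - h x)"
  have int: "integrable lborel (\<lambda>x. ?a x powr 2)" "integrable lborel (\<lambda>x. ?b x powr 2)"
    using L2x_integrable_powr assms by (blast intro: L2x_diff)+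
  have "L2x_norm (\<lambda>x. f x - h x) \<le> (LINT x|lborel. (?a x + ?b x) powr 2) powr (1/2)"
    unfolding L2x_norm_eq_powr
  proof (intro powr_mono2 integral_mono integrable_powr_add int)
    show "integrable lborel (\<lambda>x. (indicator torus_cell x * norm (f x - h x)) powr 2)"
      by (intro L2x_integrable_powr L2x_diff assms)
    fix x
    have "norm (f x - h x) \<le> norm (f x - g x) + norm (g x - h x)"
      using norm_triangle_ineq[of "f x - g x" "g x - h x"] by simp
    then show "indicator torus_cell x * norm (f x - h x) \<le> ?a x + ?b x"
      by (auto simp: indicator_def)
  qed (auto intro!: integral_nonneg_AE)
  also have "\<dots> \<le> L2x_norm (\<lambda>x. f x - g x) + L2x_norm (\<lambda>x. g x - h x)"
    unfolding L2x_norm_eq_powr by (rule Minkowski) (use int in auto)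
  finally show ?thesis .
qed

lemma L2x_norm_le_sq_int:
  assumes "f \<in> L2x" "sq_int f \<le> ennreal (c\<^sup>2)" "0 \<le> c"
  shows "L2x_norm f \<le> c"
proof -
  have "(L2x_norm f)\<^sup>2 \<le> c\<^sup>2" using assms by (simp add: sq_int_L2x)
  then show ?thesis using assms(3) by (rule power2_le_imp_le)
qed

section \<open>Limits of sequences with geometric increments\<close>

lemma convergent_if_diff_geometric:
  fixes f :: "nat \<Rightarrow> 'b::banach"
  assumes "\<And>n. norm (f (Suc n) - f n) \<le> C * q ^ n" "0 \<le> q" "q < 1"
  shows "convergent f"
proof -
  have "summable (\<lambda>n. C * q ^ n)" using assms by (intro summable_mult summable_geometric) auto
  then have "summable (\<lambda>n. f (Suc n) - f n)" using assms(1) by (rule summable_comparison_test')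
  then have "convergent (\<lambda>n. \<Sum>i<n. f (Suc i) - f i)" by (simp add: summable_iff_convergent)
  then have "convergent (\<lambda>n. f n - f 0)" by (simp add: sum_lessThan_telescope)
  then show ?thesis by (simp add: convergent_diff_const_right_iff)
qed

text \<open>The squared increments weighted by \<open>2 ^ n\<close> still have a summable sequence
  of integrals. Almost everywhere their sum is therefore finite, which forces geometric decay of the
  increments and pointwise convergence; Fatou then gives convergence in the norm. The explicit limit
  \<open>lim\<close> is Borel and periodic everywhere, and in the time dependent setting it yields a
  limit that is jointly measurable in time and space.\<close>

lemma L2x_complete:
  fixes f :: "nat \<Rightarrow> real^2 \<Rightarrow> real^2"
  assumes f: "\<And>n. f n \<in> L2x"
    and C: "0 \<le> C" "\<And>n. L2x_norm (\<lambda>x. f (Suc n) x - f n x) \<le> C * (1/2) ^ n"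
  defines "g \<equiv> \<lambda>x. lim (\<lambda>n. f n x)"
  shows "g \<in> L2x" and "(\<lambda>n. L2x_norm (\<lambda>x. f n x - g x)) \<longlonglongrightarrow> 0"
proof -
  note [measurable] = f[THEN L2x_borel]
  have g_borel [measurable]: "g \<in> borel_measurable borel"
    unfolding g_def by measurable
  have g_periodic: "periodic g"
    using f[THEN L2x_periodic] by (simp add: g_def periodic_def)
  define s where "s n x = ennreal (2 ^ n * (norm (f (Suc n) x - f n x))\<^sup>2) * indicator torus_cell x" for n x
  have [measurable]: "s n \<in> borel_measurable borel" for n unfolding s_def by measurable
  have "(\<integral>\<^sup>+x. (\<Sum>n. s n x) \<partial>lborel) = (\<Sum>n. \<integral>\<^sup>+x. s n x \<partial>lborel)"
    by (rule nn_integral_suminf) simp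
  also have "\<dots> \<le> (\<Sum>n. ennreal (C\<^sup>2 * (1/2) ^ n))"
  proof (intro suminf_le summableI)
    fix n
    have "(\<integral>\<^sup>+x. s n x \<partial>lborel) = (\<integral>\<^sup>+x. ennreal (2 ^ n) * (ennreal ((norm (f (Suc n) x - f n x))\<^sup>2) * indicator torus_cell x) \<partial>lborel)"
      unfolding s_def by (intro nn_integral_cong) (simp add: ennreal_mult mult.assoc)
    also have "\<dots> = ennreal (2 ^ n) * sq_int (\<lambda>x. f (Suc n) x - f n x)"
      unfolding sq_int_def by (intro nn_integral_cmult) measurable
    also have "\<dots> = ennreal (2 ^ n * (L2x_norm (\<lambda>x. f (Suc n) x - f n x))\<^sup>2)"
      by (subst sq_int_L2x) (auto intro!: L2x_diff f simp: ennreal_mult)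
    also have "\<dots> \<le> ennreal (2 ^ n * (C * (1/2) ^ n)\<^sup>2)"
      using C by (intro ennreal_leI mult_left_mono power_mono) auto
    also have "2 ^ n * (C * (1/2) ^ n)\<^sup>2 = C\<^sup>2 * (1/2) ^ n"
      by (simp add: power_mult_distrib power_divide power2_eq_square)
    finally show "(\<integral>\<^sup>+x. s n x \<partial>lborel) \<le> ennreal (C\<^sup>2 * (1/2) ^ n)" .
  qed
  also have "\<dots> = ennreal (\<Sum>n. C\<^sup>2 * (1/2) ^ n)"
    by (intro suminf_ennreal2 summable_mult summable_geometric) auto
  finally have "(\<integral>\<^sup>+x. (\<Sum>n. s n x) \<partial>lborel) \<noteq> \<infinity>"
    by (auto simp: top_unique)
  then have "AE x in lborel. (\<Sum>n. s n x) \<noteq> \<infinity>"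
    by (intro nn_integral_PInf_AE) auto
  then have lim_AE: "AE x in lborel. x \<in> torus_cell \<longrightarrow> (\<lambda>n. f n x) \<longlonglongrightarrow> g x"
  proof eventually_elim
    case (elim x)
    show ?case
    proof
      assume x: "x \<in> torus_cell"
      obtain S where S: "0 \<le> S" "(\<Sum>n. s n x) = ennreal S"
        using elim by (cases "\<Sum>n. s n x") auto
      have "norm (f (Suc n) x - f n x) \<le> sqrt S * (1 / sqrt 2) ^ n" for n
      proof -
        have "s n x \<le> (\<Sum>n. s n x)"
          using sum_le_suminf[of "\<lambda>n. s n x" "{n}"] by simp
        then have "2 ^ n * (norm (f (Suc n) x - f n x))\<^sup>2 \<le> S"
          using S x by (simp add: s_def)
        then have "sqrt (2 ^ n * (norm (f (Suc n) x - f n x))\<^sup>2) \<le> sqrt S" by simp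
        then show ?thesis by (simp add: real_sqrt_mult real_sqrt_power power_divide field_simps)
      qed
      then have "convergent (\<lambda>n. f n x)"
        by (rule convergent_if_diff_geometric) auto
      then show "(\<lambda>n. f n x) \<longlonglongrightarrow> g x" unfolding g_def by (simp add: convergent_LIMSEQ_iff)
    qed
  qed
  \<comment> \<open>The exact partial sum of the geometric bounds is kept, because the induction
    does not close with its first term alone.\<close>
  have bound: "L2x_norm (\<lambda>x. f n x - f i x) \<le> 2 * C * (1/2) ^ n - 2 * C * (1/2) ^ i" if "n \<le> i" for n i
    using that
  proof (induction i rule: dec_induct)
    case base
    then show ?case by (simp add: L2x_norm_def)
  next
    case (step i)
    have "L2x_norm (\<lambda>x. f n x - f (Suc i) x) \<le> L2x_norm (\<lambda>x. f n x - f i x) + L2x_norm (\<lambda>x. f i x - f (Suc i) x)"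
      by (intro L2x_norm_triangle f)
    also have "L2x_norm (\<lambda>x. f i x - f (Suc i) x) \<le> C * (1/2) ^ i"
      using C(2)[of i] by (simp add: L2x_norm_minus_commute)
    finally show ?case using step.IH by simp
  qed
  have sq: "sq_int (\<lambda>x. f n x - g x) \<le> ennreal ((2 * C * (1/2) ^ n)\<^sup>2)" for n
  proof -
    have "sq_int (\<lambda>x. f n x - g x) \<le>
      (\<integral>\<^sup>+x. liminf (\<lambda>i. ennreal ((norm (f n x - f i x))\<^sup>2) * indicator torus_cell x) \<partial>lborel)"
      unfolding sq_int_def
    proof (intro nn_integral_mono_AE, use lim_AE in eventually_elim)
      case (elim x)
      show ?case
      proof (cases "x \<in> torus_cell")
        case True
        then have "(\<lambda>i. ennreal ((norm (f n x - f i x))\<^sup>2)) \<longlonglongrightarrow> ennreal ((norm (f n x - g x))\<^sup>2)"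
          using elim by (intro tendsto_intros) auto
        from lim_imp_Liminf[OF _ this]
        have "liminf (\<lambda>i. ennreal ((norm (f n x - f i x))\<^sup>2)) = ennreal ((norm (f n x - g x))\<^sup>2)"
          by simp
        then show ?thesis using True by simp
      qed simp
    qed
    also have "\<dots> \<le> liminf (\<lambda>i. sq_int (\<lambda>x. f n x - f i x))"
      unfolding sq_int_def by (intro nn_integral_liminf) auto
    also have "\<dots> \<le> liminf (\<lambda>i::nat. ennreal ((2 * C * (1/2) ^ n)\<^sup>2))"
    proof (intro Liminf_mono eventually_sequentiallyI[of n])
      fix i assume "n \<le> i"
      have "0 \<le> 2 * C * (1/2) ^ i" using C by simp
      then have "L2x_norm (\<lambda>x. f n x - f i x) \<le> 2 * C * (1/2) ^ n"
        using bound[OF \<open>n \<le> i\<close>] by linarith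
      then show "sq_int (\<lambda>x. f n x - f i x) \<le> ennreal ((2 * C * (1/2) ^ n)\<^sup>2)"
        by (subst sq_int_L2x) (auto intro!: L2x_diff f ennreal_leI power_mono)
    qed
    also have "\<dots> = ennreal ((2 * C * (1/2) ^ n)\<^sup>2)" by (simp add: Liminf_const)
    finally show ?thesis .
  qed
  have diff: "(\<lambda>x. f n x - g x) \<in> L2x" for n
    using le_less_trans[OF sq[of n]] by (auto simp: L2x_iff_sq_int intro: periodic_diff g_periodic L2x_periodic f)
  have "(\<lambda>x. f 0 x - (f 0 x - g x)) \<in> L2x" by (intro L2x_diff f diff)
  then show "g \<in> L2x" by simp
  show "(\<lambda>n. L2x_norm (\<lambda>x. f n x - g x)) \<longlonglongrightarrow> 0"
  proof (rule tendsto_sandwich[of "\<lambda>_. 0"])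
    show "\<forall>\<^sub>F n in sequentially. L2x_norm (\<lambda>x. f n x - g x) \<le> 2 * C * (1/2) ^ n"
      using L2x_norm_le_sq_int[OF diff sq] C(1) by (intro always_eventually) auto
    show "(\<lambda>n. 2 * C * (1/2) ^ n) \<longlonglongrightarrow> (0::real)"
      by (intro tendsto_mult_right_zero LIMSEQ_realpow_zero) auto
  qed auto
qed

section \<open>Completeness of \<open>L\<^sup>p(0,T;L\<^sup>2)\<close>\<close>

text \<open>Extension by zero turns measurability on a strip into measurability for the product of
  the Borel algebras, the form in which Tonelli's theorem is applied.\<close>

lemma borel_measurable_slices:
  fixes f :: "real \<Rightarrow> real^2 \<Rightarrow> real^2"
  assumes "(\<lambda>(t, x). f t x) \<in> borel_measurable (restrict_space borel (A \<times> UNIV))"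
    and "A \<in> sets borel"
  shows "(\<lambda>(t, x). indicator A t *\<^sub>R f t x) \<in> borel_measurable (borel \<Otimes>\<^sub>M borel)"
proof -
  have "A \<times> UNIV \<in> sets (borel \<Otimes>\<^sub>M borel :: (real \<times> (real^2)) measure)"
    using assms(2) by (intro pair_measureI) auto
  then have "A \<times> UNIV \<in> sets (borel :: (real \<times> (real^2)) measure)" by (simp only: borel_prod)
  then have "(\<lambda>z. indicator (A \<times> UNIV) z *\<^sub>R (case z of (t, x) \<Rightarrow> f t x)) \<in> borel_measurable borel"
    using assms(1) by (subst (asm) borel_measurable_restrict_space_iff) auto
  also have "(\<lambda>z. indicator (A \<times> UNIV) z *\<^sub>R (case z of (t, x) \<Rightarrow> f t x)) = (\<lambda>(t, x). indicator A t *\<^sub>R f t x)"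
    by (auto simp: indicator_def fun_eq_iff)
  finally show ?thesis by (simp add: borel_prod)
qed

lemma L2x_norm_scaleR_indicator: "L2x_norm (\<lambda>x. indicator A t *\<^sub>R f x) = indicator A t * L2x_norm f"
  by (auto simp: indicator_def L2x_norm_def)

lemma borel_measurable_L2x_norm:
  fixes f :: "real \<Rightarrow> real^2 \<Rightarrow> real^2"
  assumes "(\<lambda>(t, x). f t x) \<in> borel_measurable (restrict_space borel (A \<times> UNIV))"
    and "A \<in> sets borel"
  shows "(\<lambda>t. indicator A t * L2x_norm (f t)) \<in> borel_measurable borel"
proof -
  note [measurable] = borel_measurable_slices[OF assms]
  have "(\<lambda>t. L2x_norm (\<lambda>x. indicator A t *\<^sub>R f t x)) \<in> borel_measurable borel"
    unfolding L2x_norm_def set_lebesgue_integral_def by measurable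
  then show ?thesis by (simp add: L2x_norm_scaleR_indicator)
qed

abbreviation (input) slice_norm :: "real \<Rightarrow> real \<Rightarrow> (real^2 \<Rightarrow> real^2) \<Rightarrow> real" where
  "slice_norm T t f \<equiv> indicator {0<..<T} t * L2x_norm f"

lemma LpL2_measurable:
  assumes "f \<in> LpL2 p T"
  shows "(\<lambda>(t, x). f t x) \<in> borel_measurable (restrict_space borel ({0<..<T} \<times> UNIV))"
    and "(\<lambda>t. slice_norm T t (f t)) \<in> borel_measurable borel"
  using assms borel_measurable_L2x_norm[of f "{0<..<T}"] by (auto simp: LpL2_def)

lemma LpL2_L2x: "f \<in> LpL2 p T \<Longrightarrow> AE t in lborel. t \<in> {0<..<T} \<longrightarrow> f t \<in> L2x"
  by (simp add: LpL2_def)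

lemma indicator_powr: "(indicator A t * x) powr p = indicator A t * x powr p" for x :: real
  by (auto simp: indicator_def)

lemma LpL2_norm_eq: "LpL2_norm p T f = (LINT t|lborel. slice_norm T t (f t) powr p) powr (1 / p)"
  by (simp add: LpL2_norm_def set_lebesgue_integral_def indicator_powr)

lemma LpL2_integrable:
  "f \<in> LpL2 p T \<Longrightarrow> integrable lborel (\<lambda>t. slice_norm T t (f t) powr p)"
  by (simp add: LpL2_def set_integrable_def indicator_powr)

lemma LpL2_norm_nonneg [simp]: "0 \<le> LpL2_norm p T f"
  by (simp add: LpL2_norm_def)

lemma LpL2_norm_minus_commute: "LpL2_norm p T (\<lambda>t x. f t x - g t x) = LpL2_norm p T (\<lambda>t x. g t x - f t x)"
  by (simp add: LpL2_norm_def L2x_norm_minus_commute[of "f t" "g t" for t])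

lemma LpL2_norm_self [simp]: "LpL2_norm p T (\<lambda>t x. f t x - f t x) = 0"
  by (simp add: LpL2_norm_def L2x_norm_def set_lebesgue_integral_def)

lemma LpL2I:
  assumes "(\<lambda>(t, x). f t x) \<in> borel_measurable (restrict_space borel ({0<..<T} \<times> UNIV))"
    and "AE t in lborel. t \<in> {0<..<T} \<longrightarrow> f t \<in> L2x"
    and "integrable lborel b"
    and "AE t in lborel. slice_norm T t (f t) powr p \<le> b t"
  shows "f \<in> LpL2 p T"
proof -
  have [measurable]: "(\<lambda>t. slice_norm T t (f t)) \<in> borel_measurable borel"
    using assms(1) by (rule borel_measurable_L2x_norm) simp
  have "integrable lborel (\<lambda>t. slice_norm T t (f t) powr p)"
    by (rule Bochner_Integration.integrable_bound[OF assms(3)]) (use assms(4) in auto)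
  then show ?thesis
    using assms(1,2) by (simp add: LpL2_def set_integrable_def indicator_powr)
qed

lemma L2x_norm_diff_le:
  assumes "f \<in> L2x" "g \<in> L2x"
  shows "L2x_norm (\<lambda>x. f x - g x) \<le> L2x_norm f + L2x_norm g"
proof -
  have "(\<lambda>x. 0) \<in> L2x"
    using L2x_diff[OF assms(1) assms(1)] by simp
  then show ?thesis
    using L2x_norm_triangle[OF assms(1) _ assms(2), of "\<lambda>x. 0"] L2x_norm_minus_commute[of "\<lambda>x. 0" g] by simp
qed

lemma LpL2_diff:
  assumes "1 \<le> p" and f: "f \<in> LpL2 p T" and g: "g \<in> LpL2 p T"
  shows "(\<lambda>t x. f t x - g t x) \<in> LpL2 p T"
proof (rule LpL2I)
  show "(\<lambda>(t, x). f t x - g t x) \<in> borel_measurable (restrict_space borel ({0<..<T} \<times> UNIV))"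
    using borel_measurable_diff[OF LpL2_measurable(1)[OF f] LpL2_measurable(1)[OF g]]
    by (simp add: case_prod_unfold)
  show "AE t in lborel. t \<in> {0<..<T} \<longrightarrow> (\<lambda>x. f t x - g t x) \<in> L2x"
    using LpL2_L2x[OF f] LpL2_L2x[OF g] by eventually_elim (auto intro: L2x_diff)
  show "integrable lborel (\<lambda>t. (slice_norm T t (f t) + slice_norm T t (g t)) powr p)"
    using assms by (intro integrable_powr_add LpL2_integrable) (auto simp: LpL2_measurable(2)[OF f] LpL2_measurable(2)[OF g])
  show "AE t in lborel. slice_norm T t (\<lambda>x. f t x - g t x) powr p
      \<le> (slice_norm T t (f t) + slice_norm T t (g t)) powr p"
    using LpL2_L2x[OF f] LpL2_L2x[OF g]
    by eventually_elim (use \<open>1 \<le> p\<close> in \<open>auto intro!: powr_mono2 L2x_norm_diff_le simp: indicator_def\<close>)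
qed

text \<open>The spatial triangle inequality holds at almost every time, and the scalar
  \<open>Minkowski\<close> inequality in time does the rest.\<close>

lemma LpL2_norm_triangle:
  assumes "1 \<le> p" and f: "f \<in> LpL2 p T" and g: "g \<in> LpL2 p T" and h: "h \<in> LpL2 p T"
  shows "LpL2_norm p T (\<lambda>t x. f t x - h t x) \<le>
    LpL2_norm p T (\<lambda>t x. f t x - g t x) + LpL2_norm p T (\<lambda>t x. g t x - h t x)"
proof -
  note fg = LpL2_diff[OF assms(1) f g] and gh = LpL2_diff[OF assms(1) g h]
  let ?a = "\<lambda>t. slice_norm T t (\<lambda>x. f t x - g t x)"
  let ?b = "\<lambda>t. slice_norm T t (\<lambda>x. g t x - h t x)"
  have "LpL2_norm p T (\<lambda>t x. f t x - h t x) \<le> (LINT t|lborel. (?a t + ?b t) powr p) powr (1/p)"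
    unfolding LpL2_norm_eq
  proof (intro powr_mono2 integral_mono_AE)
    show "integrable lborel (\<lambda>t. slice_norm T t (\<lambda>x. f t x - h t x) powr p)"
      by (intro LpL2_integrable LpL2_diff assms)
    show "integrable lborel (\<lambda>t. (?a t + ?b t) powr p)"
      using assms(1) by (intro integrable_powr_add LpL2_integrable[OF fg] LpL2_integrable[OF gh])
        (auto simp: LpL2_measurable(2)[OF fg] LpL2_measurable(2)[OF gh])
    show "AE t in lborel. slice_norm T t (\<lambda>x. f t x - h t x) powr p \<le> (?a t + ?b t) powr p"
      using LpL2_L2x[OF f] LpL2_L2x[OF g] LpL2_L2x[OF h]
      by eventually_elim (use \<open>1 \<le> p\<close> in \<open>auto intro!: powr_mono2 L2x_norm_triangle simp: indicator_def\<close>)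
  qed (use assms(1) in \<open>auto intro!: integral_nonneg_AE\<close>)
  also have "\<dots> \<le> LpL2_norm p T (\<lambda>t x. f t x - g t x) + LpL2_norm p T (\<lambda>t x. g t x - h t x)"
    unfolding LpL2_norm_eq using assms(1)
    by (intro Minkowski LpL2_integrable[OF fg] LpL2_integrable[OF gh])
      (auto simp: LpL2_measurable(2)[OF fg] LpL2_measurable(2)[OF gh])
  finally show ?thesis .
qed

lemma nn_integral_LpL2:
  assumes "f \<in> LpL2 p T" "0 < p"
  shows "(\<integral>\<^sup>+t. ennreal (slice_norm T t (f t) powr p) \<partial>lborel) = ennreal (LpL2_norm p T f powr p)"
proof -
  have "0 \<le> (LINT t|lborel. slice_norm T t (f t) powr p)"
    by (auto intro!: integral_nonneg_AE)
  then show ?thesis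
    using nn_integral_eq_integral[OF LpL2_integrable[OF assms(1)]] assms(2)
    by (simp add: LpL2_norm_eq powr_powr)
qed

lemma LpL2_norm_le:
  assumes "f \<in> LpL2 p T" "0 < p" "0 \<le> c"
    and "(\<integral>\<^sup>+t. ennreal (slice_norm T t (f t) powr p) \<partial>lborel) \<le> ennreal (c powr p)"
  shows "LpL2_norm p T f \<le> c"
proof -
  have "LpL2_norm p T f powr p \<le> c powr p"
    using assms(4) by (simp add: nn_integral_LpL2[OF assms(1,2)])
  then show ?thesis using powr_less_mono2[OF assms(2,3)] by (meson not_le)
qed

text \<open>Along a subsequence the steps are at most \<open>(1/4) ^ n\<close>; weighted by
  \<open>2 ^ n\<close> they remain summable. So at almost every time the increments in space decay
  geometrically and \<open>L2x_complete\<close> applies. Fatou in time gives convergence of the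
  subsequence in the norm, and the Cauchy property extends it to the whole sequence.\<close>

lemma LpL2_complete:
  assumes p: "1 \<le> p" and v: "\<And>n::nat. v n \<in> LpL2 p T"
    and Cauchy: "\<And>\<epsilon>. \<epsilon> > 0 \<Longrightarrow> \<exists>N. \<forall>m\<ge>N. \<forall>n\<ge>N. LpL2_norm p T (\<lambda>t x. v m t x - v n t x) < \<epsilon>"
  shows "\<exists>l\<in>LpL2 p T. (\<lambda>n. LpL2_norm p T (\<lambda>t x. v n t x - l t x)) \<longlonglongrightarrow> 0"
proof -
  have "\<exists>N. \<forall>m\<ge>N. \<forall>n\<ge>N. LpL2_norm p T (\<lambda>t x. v m t x - v n t x) < (1/4) ^ k" for k :: nat
    by (rule Cauchy) simp
  from choice[OF allI[OF this]] obtain N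
    where N: "\<forall>k. \<forall>m\<ge>N k. \<forall>n\<ge>N k. LpL2_norm p T (\<lambda>t x. v m t x - v n t x) < (1/4) ^ k" ..
  \<comment> \<open>Summing the thresholds gives an index beyond all the earlier ones, with no need
    for a strictly increasing selection.\<close>
  define r where "r k = (\<Sum>i\<le>k. N i)" for k
  have r: "r k \<ge> N k'" if "k' \<le> k" for k k'
    unfolding r_def using that by (intro member_le_sum) auto
  define w where "w k = v (r k)" for k
  have w: "w k \<in> LpL2 p T" for k using v by (simp add: w_def)
  have w_diff: "LpL2_norm p T (\<lambda>t x. w i t x - w n t x) \<le> (1/4) ^ n" if "n \<le> i" for n i
    unfolding w_def using N r[OF that] r[OF order_refl] by (intro less_imp_le) blast
  define a where "a n t = slice_norm T t (\<lambda>x. w (Suc n) t x - w n t x)" for n t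
  have a_meas [measurable]: "a n \<in> borel_measurable borel" for n
    unfolding a_def by (rule LpL2_measurable(2)[OF LpL2_diff[OF p w w]])
  define s where "s n t = ennreal ((2 ^ n * a n t) powr p)" for n t
  have [measurable]: "s n \<in> borel_measurable borel" for n
    unfolding s_def by measurable
  have "(\<integral>\<^sup>+t. (\<Sum>n. s n t) \<partial>lborel) = (\<Sum>n. \<integral>\<^sup>+t. s n t \<partial>lborel)"
    by (rule nn_integral_suminf) simp
  also have "\<dots> \<le> (\<Sum>n. ennreal ((1/2) ^ n))"
  proof (intro suminf_le summableI)
    fix n
    have "(\<integral>\<^sup>+t. s n t \<partial>lborel) = (\<integral>\<^sup>+t. ennreal ((2 ^ n) powr p) * ennreal (a n t powr p) \<partial>lborel)"
      by (simp add: s_def powr_mult ennreal_mult)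
    also have "\<dots> = ennreal ((2 ^ n) powr p) * (\<integral>\<^sup>+t. ennreal (a n t powr p) \<partial>lborel)"
      by (rule nn_integral_cmult) simp
    also have "\<dots> = ennreal ((2 ^ n) powr p * LpL2_norm p T (\<lambda>t x. w (Suc n) t x - w n t x) powr p)"
      unfolding a_def using p by (subst nn_integral_LpL2[OF LpL2_diff[OF p w w]]) (auto simp: ennreal_mult)
    also have "\<dots> \<le> ennreal ((2 ^ n) powr p * ((1/4) ^ n) powr p)"
      using p w_diff[of n "Suc n"] by (intro ennreal_leI mult_left_mono powr_mono2) auto
    also have "(2 ^ n) powr p * ((1/4) ^ n) powr p = ((1/2) ^ n) powr p"
      by (simp add: powr_mult[symmetric] power_mult_distrib[symmetric])
    also have "\<dots> \<le> ((1/2) ^ n) powr 1"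
      using p by (intro powr_mono') (auto simp: power_le_one)
    finally show "(\<integral>\<^sup>+t. s n t \<partial>lborel) \<le> ennreal ((1/2) ^ n)"
      by (simp add: ennreal_leI)
  qed
  also have "\<dots> = ennreal (\<Sum>n. (1/2) ^ n)"
    by (intro suminf_ennreal2 summable_geometric) auto
  finally have "(\<integral>\<^sup>+t. (\<Sum>n. s n t) \<partial>lborel) \<noteq> \<infinity>"
    by (auto simp: top_unique)
  then have "AE t in lborel. (\<Sum>n. s n t) \<noteq> \<infinity>"
    by (rule nn_integral_PInf_AE[rotated]) measurable
  then have geometric: "AE t in lborel. \<exists>S\<ge>0. \<forall>n. a n t \<le> S * (1/2) ^ n"
  proof eventually_elim
    case (elim t)
    then obtain S where S: "0 \<le> S" "(\<Sum>n. s n t) = ennreal S"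
      by (cases "\<Sum>n. s n t") auto
    have "a n t \<le> S powr (1/p) * (1/2) ^ n" for n
    proof -
      have "s n t \<le> (\<Sum>n. s n t)"
        using sum_le_suminf[of "\<lambda>n. s n t" "{n}"] by simp
      then have "(2 ^ n * a n t) powr p \<le> S"
        using S by (simp add: s_def)
      then have "((2 ^ n * a n t) powr p) powr (1/p) \<le> S powr (1/p)"
        using p by (intro powr_mono2) auto
      moreover have "0 \<le> a n t" by (simp add: a_def)
      ultimately show ?thesis using p by (simp add: powr_powr power_divide field_simps)
    qed
    then show ?case by (intro exI[of _ "S powr (1/p)"]) auto
  qed
  define l where "l t x = lim (\<lambda>n. w n t x)" for t x
  have "AE t in lborel. \<forall>n. t \<in> {0<..<T} \<longrightarrow> w n t \<in> L2x"
    unfolding AE_all_countable using LpL2_L2x[OF w] by blast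
  then have lim_AE: "AE t in lborel. t \<in> {0<..<T} \<longrightarrow> (\<forall>n. w n t \<in> L2x) \<and> l t \<in> L2x \<and>
      (\<lambda>n. L2x_norm (\<lambda>x. w n t x - l t x)) \<longlonglongrightarrow> 0"
    using geometric
  proof eventually_elim
    case (elim t)
    show ?case
    proof
      assume t: "t \<in> {0<..<T}"
      obtain S where "S \<ge> 0" "\<And>n. L2x_norm (\<lambda>x. w (Suc n) t x - w n t x) \<le> S * (1/2) ^ n"
        using elim(2) t by (auto simp: a_def)
      moreover have "l t = (\<lambda>x. lim (\<lambda>n. w n t x))" by (simp add: l_def fun_eq_iff)
      ultimately show "(\<forall>n. w n t \<in> L2x) \<and> l t \<in> L2x \<and> (\<lambda>n. L2x_norm (\<lambda>x. w n t x - l t x)) \<longlonglongrightarrow> 0"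
        using L2x_complete[of "\<lambda>n. w n t" S] elim(1) t by simp
    qed
  qed
  have l_meas: "(\<lambda>(t, x). l t x) \<in> borel_measurable (restrict_space borel ({0<..<T} \<times> UNIV))"
    using LpL2_measurable(1)[OF w] unfolding l_def case_prod_unfold by (rule borel_measurable_lim_metric)
  have l_meas': "(\<lambda>(t, x). w n t x - l t x) \<in> borel_measurable (restrict_space borel ({0<..<T} \<times> UNIV))" for n
    using borel_measurable_diff[OF LpL2_measurable(1)[OF w] l_meas] by (simp add: case_prod_unfold)
  have l_L2x: "AE t in lborel. t \<in> {0<..<T} \<longrightarrow> (\<lambda>x. w n t x - l t x) \<in> L2x" for n
    using lim_AE by eventually_elim (auto intro: L2x_diff)
  have [measurable]: "(\<lambda>t. slice_norm T t (\<lambda>x. w n t x - w i t x)) \<in> borel_measurable borel" for n i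
    by (rule LpL2_measurable(2)[OF LpL2_diff[OF p w w]])
  let ?b = "\<lambda>n t. ennreal (slice_norm T t (\<lambda>x. w n t x - l t x) powr p)"
  let ?c = "\<lambda>n i t. ennreal (slice_norm T t (\<lambda>x. w n t x - w i t x) powr p)"
  have fatou: "(\<integral>\<^sup>+t. ?b n t \<partial>lborel) \<le>
      ennreal (((1/4) ^ n) powr p)" for n
  proof -
    have "(\<integral>\<^sup>+t. ?b n t \<partial>lborel) \<le>
      (\<integral>\<^sup>+t. liminf (\<lambda>i. ?c n i t) \<partial>lborel)"
    proof (intro nn_integral_mono_AE, use lim_AE in eventually_elim)
      case (elim t)
      show ?case
      proof (cases "t \<in> {0<..<T}")
        case True
        with elim have wl: "w i t \<in> L2x" "l t \<in> L2x" "(\<lambda>n. L2x_norm (\<lambda>x. w n t x - l t x)) \<longlonglongrightarrow> 0" for i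
          by auto
        \<comment> \<open>Reverse triangle inequality: the two norms differ by at most the distance
          from \<open>w i t\<close> to \<open>l t\<close>.\<close>
        have "(\<lambda>i. L2x_norm (\<lambda>x. w n t x - w i t x)) \<longlonglongrightarrow> L2x_norm (\<lambda>x. w n t x - l t x)"
        proof (rule LIM_zero_cancel, rule tendsto_rabs_zero_cancel, rule tendsto_sandwich[OF _ _ tendsto_const wl(3)])
          show "\<forall>\<^sub>F i in sequentially. \<bar>L2x_norm (\<lambda>x. w n t x - w i t x) - L2x_norm (\<lambda>x. w n t x - l t x)\<bar> \<le> L2x_norm (\<lambda>x. w i t x - l t x)"
          proof (intro always_eventually allI)
            fix i
            show "\<bar>L2x_norm (\<lambda>x. w n t x - w i t x) - L2x_norm (\<lambda>x. w n t x - l t x)\<bar> \<le> L2x_norm (\<lambda>x. w i t x - l t x)"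
              using L2x_norm_triangle[OF wl(1,1,2), of n i] L2x_norm_triangle[OF wl(1,2,1), of n i]
                L2x_norm_minus_commute[of "l t" "w i t"] by linarith
          qed
        qed simp
        then have "(\<lambda>i. L2x_norm (\<lambda>x. w n t x - w i t x) powr p) \<longlonglongrightarrow> L2x_norm (\<lambda>x. w n t x - l t x) powr p"
          using p by (intro tendsto_powr2 tendsto_const) auto
        then have "(\<lambda>i. ?c n i t) \<longlonglongrightarrow>
            ?b n t"
          using True by (intro tendsto_ennrealI) simp
        from lim_imp_Liminf[OF _ this]
        have "liminf (\<lambda>i. ?c n i t) =
            ?b n t"
          by simp
        then show ?thesis by (simp only: order_refl)
      qed simp
    qed
    also have "\<dots> \<le> liminf (\<lambda>i. \<integral>\<^sup>+t. ?c n i t \<partial>lborel)"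
      by (intro nn_integral_liminf) measurable
    also have "\<dots> \<le> liminf (\<lambda>i::nat. ennreal (((1/4) ^ n) powr p))"
    proof (intro Liminf_mono eventually_sequentiallyI[of n])
      fix i assume "n \<le> i"
      then have "LpL2_norm p T (\<lambda>t x. w n t x - w i t x) powr p \<le> ((1/4) ^ n) powr p"
        using w_diff[of n i] p by (intro powr_mono2) (auto simp: LpL2_norm_minus_commute[of _ _ "w i"])
      then show "(\<integral>\<^sup>+t. ?c n i t \<partial>lborel) \<le>
          ennreal (((1/4) ^ n) powr p)"
        using p by (subst nn_integral_LpL2[OF LpL2_diff[OF p w w]]) (auto intro: ennreal_leI)
    qed
    also have "\<dots> = ennreal (((1/4) ^ n) powr p)" by (simp add: Liminf_const)
    finally show ?thesis .
  qed
  have wl: "(\<lambda>t x. w n t x - l t x) \<in> LpL2 p T" for n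
  proof (rule LpL2I[OF l_meas' l_L2x])
    have [measurable]: "(\<lambda>t. slice_norm T t (\<lambda>x. w n t x - l t x)) \<in> borel_measurable borel"
      using l_meas' by (rule borel_measurable_L2x_norm) simp
    show "integrable lborel (\<lambda>t. slice_norm T t (\<lambda>x. w n t x - l t x) powr p)"
      unfolding integrable_iff_bounded using le_less_trans[OF fatou[of n]] by auto
  qed simp
  have l: "l \<in> LpL2 p T"
    using LpL2_diff[OF p w[of 0] wl[of 0]] by simp
  have wl_norm: "LpL2_norm p T (\<lambda>t x. w n t x - l t x) \<le> (1/4) ^ n" for n
    using p by (intro LpL2_norm_le wl fatou) auto
  have "(\<lambda>n. LpL2_norm p T (\<lambda>t x. v n t x - l t x)) \<longlonglongrightarrow> 0"
  proof (rule LIMSEQ_I)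
    fix e :: real assume "0 < e"
    then obtain k :: nat where k: "(1/4) ^ k < e / 2"
      using real_arch_pow_inv[of "e/2" "1/4"] by auto
    have "LpL2_norm p T (\<lambda>t x. v n t x - l t x) < e" if "n \<ge> N k" for n
    proof -
      have "LpL2_norm p T (\<lambda>t x. v n t x - l t x) \<le> LpL2_norm p T (\<lambda>t x. v n t x - w k t x) + LpL2_norm p T (\<lambda>t x. w k t x - l t x)"
        by (intro LpL2_norm_triangle p v w l)
      also have "\<dots> < e / 2 + e / 2"
        using N[rule_format, OF that r[of k k]] wl_norm[of k] k by (intro add_strict_mono) (auto simp: w_def)
      finally show ?thesis by simp
    qed
    then show "\<exists>no. \<forall>n\<ge>no. norm (LpL2_norm p T (\<lambda>t x. v n t x - l t x) - 0) < e"
      by auto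
  qed
  with l show ?thesis by blast
qed

section \<open>Shifts of periodic functions\<close>

text \<open>A fundamental domain, which the closed cell is not: exactly one lattice translate of
  every point lies in it. The two cells differ by a null set.\<close>

definition half_open_cell :: "(real^2) set" where
  "half_open_cell = {x. \<forall>i. 0 \<le> x $ i \<and> x $ i < 1}"

definition lattice :: "int^2 \<Rightarrow> real^2" where
  "lattice m = (\<chi> i. of_int (m $ i))"

lemma half_open_cell_borel [measurable]: "half_open_cell \<in> sets borel"
  unfolding half_open_cell_def by measurable

lemma AE_half_open_cell: "AE x in lborel. x \<in> torus_cell \<longleftrightarrow> x \<in> half_open_cell"
proof (rule AE_I')
  show "cbox 0 1 - box 0 1 \<in> null_sets (lborel :: (real^2) measure)"
    by (simp add: null_sets_cbox_Diff_box)
  show "{x \<in> space lborel. \<not> (x \<in> torus_cell \<longleftrightarrow> x \<in> half_open_cell)} \<subseteq> cbox 0 1 - box 0 1"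
    by (auto simp: half_open_cell_def mem_box_cart less_imp_le)
qed

lemma half_open_cell_lattice: "\<exists>!m. x + lattice m \<in> half_open_cell"
proof -
  have *: "x + lattice m \<in> half_open_cell \<longleftrightarrow> m = (\<chi> i. - \<lfloor>x $ i\<rfloor>)" for m
  proof -
    have "0 \<le> x $ i + of_int k \<and> x $ i + of_int k < 1 \<longleftrightarrow> k = - \<lfloor>x $ i\<rfloor>" for i and k :: int
      by linarith
    then show ?thesis by (simp add: half_open_cell_def lattice_def vec_eq_iff)
  qed
  then show ?thesis by simp
qed

lemma periodic_lattice:
  assumes "periodic f"
  shows "f (x + lattice m) = f x"
proof -
  have nat: "f (x + of_nat k *\<^sub>R axis i 1) = f x" for x k i
  proof (induction k)
    case (Suc k)
    have "f (x + of_nat (Suc k) *\<^sub>R axis i 1) = f ((x + of_nat k *\<^sub>R axis i 1) + axis i 1)"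
      by (simp add: algebra_simps)
    then show ?case using Suc assms by (simp add: periodic_def)
  qed simp
  have int: "f (x + of_int k *\<^sub>R axis i 1) = f x" for x k i
  proof (cases k rule: int_cases2)
    case (nonneg n)
    then show ?thesis using nat[of x n i] by simp
  next
    case (nonpos n)
    then show ?thesis using nat[of "x - of_nat n *\<^sub>R axis i 1" n i] by simp
  qed
  have "lattice m = of_int (m $ 1) *\<^sub>R axis 1 1 + of_int (m $ 2) *\<^sub>R axis 2 1"
    by (simp add: lattice_def vec_eq_iff forall_2 axis_def)
  then have "f (x + lattice m) = f ((x + of_int (m $ 1) *\<^sub>R axis 1 1) + of_int (m $ 2) *\<^sub>R axis 2 1)"
    by (simp add: add.assoc)
  then show ?thesis by (simp only: int)
qed

lemma nn_integral_lborel_shift: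
  fixes g :: "real^2 \<Rightarrow> ennreal"
  assumes [measurable]: "g \<in> borel_measurable borel"
  shows "(\<integral>\<^sup>+x. g (x + h) \<partial>lborel) = (\<integral>\<^sup>+x. g x \<partial>lborel)"
proof -
  have "(\<integral>\<^sup>+x. g x \<partial>lborel) = (\<integral>\<^sup>+x. g x \<partial>distr lborel borel ((+) h))"
    by (simp add: lborel_distr_plus)
  also have "\<dots> = (\<integral>\<^sup>+x. g (h + x) \<partial>lborel)"
    by (subst nn_integral_distr) auto
  finally show ?thesis by (simp add: add.commute)
qed

lemma borel_measurable_int2_pair:
  assumes "\<And>m. f m \<in> borel_measurable lborel"
  shows "(\<lambda>(m, x). f m x :: ennreal) \<in> borel_measurable (count_space (UNIV :: (int^2) set) \<Otimes>\<^sub>M (lborel :: (real^2) measure))"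
  by (rule measurable_pair_measure_countable1) (use assms in auto)

text \<open>Tonelli's theorem with the counting measure, which is sigma-finite because the lattice
  is countable.\<close>

lemma nn_integral_lattice_swap:
  assumes "\<And>m. f m \<in> borel_measurable lborel"
  shows "(\<integral>\<^sup>+x. (\<integral>\<^sup>+m. f m x \<partial>count_space UNIV) \<partial>lborel) =
    (\<integral>\<^sup>+m. (\<integral>\<^sup>+x. f m x \<partial>(lborel :: (real^2) measure)) \<partial>count_space (UNIV :: (int^2) set))"
proof -
  interpret pair_sigma_finite "count_space (UNIV :: (int^2) set)" "lborel :: (real^2) measure"
    by (intro pair_sigma_finite.intro sigma_finite_measure_count_space_countable sigma_finite_lborel) simp
  show ?thesis using borel_measurable_int2_pair[OF assms] by (rule Fubini')
qed

lemma nn_integral_half_open_cell_lattice: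
  "(\<integral>\<^sup>+m. indicator half_open_cell (x + lattice m) \<partial>count_space UNIV) = (1::ennreal)"
proof -
  obtain m0 where m0: "\<And>m. x + lattice m \<in> half_open_cell \<longleftrightarrow> m = m0"
    using half_open_cell_lattice[of x] by (auto simp: Ex1_def)
  have "(\<integral>\<^sup>+m. indicator half_open_cell (x + lattice m) \<partial>count_space UNIV) =
      (\<integral>\<^sup>+m. indicator {m0} m \<partial>count_space UNIV)"
    by (intro nn_integral_cong) (simp add: indicator_def m0)
  also have "\<dots> = 1" by (subst nn_integral_indicator) auto
  finally show ?thesis .
qed

text \<open>Both cells are tiled by their intersections with the lattice translates of the other.\<close>

lemma nn_integral_cell_shift:
  fixes g :: "real^2 \<Rightarrow> ennreal"
  assumes [measurable]: "g \<in> borel_measurable borel" and per: "periodic g"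
  shows "(\<integral>\<^sup>+x\<in>torus_cell. g (x + h) \<partial>lborel) = (\<integral>\<^sup>+x\<in>torus_cell. g x \<partial>lborel)"
proof -
  let ?Q = "indicator half_open_cell :: real^2 \<Rightarrow> ennreal"
  have cell: "(\<integral>\<^sup>+x\<in>torus_cell. f x \<partial>lborel) = (\<integral>\<^sup>+x. f x * ?Q x \<partial>lborel)" for f
    by (intro nn_integral_cong_AE, use AE_half_open_cell in eventually_elim) (auto simp: indicator_def)
  have "(\<integral>\<^sup>+x. g (x + h) * ?Q x \<partial>lborel) = (\<integral>\<^sup>+x. g (x + h) * ?Q (x + h - h) \<partial>lborel)"
    by simp
  also have "\<dots> = (\<integral>\<^sup>+x. g x * ?Q (x - h) \<partial>lborel)"
    by (rule nn_integral_lborel_shift) measurable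
  \<comment> \<open>The inserted sum over lattice translates is 1. Substituting in each term moves
    the translate to the other cell, and there the sum is 1 again.\<close>
  also have "\<dots> = (\<integral>\<^sup>+x. (\<integral>\<^sup>+m. g x * ?Q (x - h) * ?Q (x + lattice m) \<partial>count_space UNIV) \<partial>lborel)"
    by (subst nn_integral_cmult) (auto simp: nn_integral_half_open_cell_lattice)
  also have "\<dots> = (\<integral>\<^sup>+m. (\<integral>\<^sup>+x. g x * ?Q (x - h) * ?Q (x + lattice m) \<partial>lborel) \<partial>count_space UNIV)"
    by (rule nn_integral_lattice_swap) measurable
  also have "\<dots> = (\<integral>\<^sup>+m. (\<integral>\<^sup>+x. g x * ?Q x * ?Q (x - h + lattice (- m)) \<partial>lborel) \<partial>count_space UNIV)"
  proof (rule nn_integral_cong)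
    fix m :: "int^2"
    have neg: "lattice (- m) = - lattice m" by (simp add: lattice_def vec_eq_iff)
    have "(\<integral>\<^sup>+x. g x * ?Q (x - h) * ?Q (x + lattice m) \<partial>lborel) =
        (\<integral>\<^sup>+x. g (x + lattice m) * ?Q (x + lattice m) * ?Q ((x + lattice m) - h + lattice (- m)) \<partial>lborel)"
      by (intro nn_integral_cong) (simp add: periodic_lattice[OF per] neg algebra_simps)
    also have "\<dots> = (\<integral>\<^sup>+x. g x * ?Q x * ?Q (x - h + lattice (- m)) \<partial>lborel)"
      by (rule nn_integral_lborel_shift) measurable
    finally show "(\<integral>\<^sup>+x. g x * ?Q (x - h) * ?Q (x + lattice m) \<partial>lborel) =
        (\<integral>\<^sup>+x. g x * ?Q x * ?Q (x - h + lattice (- m)) \<partial>lborel)" .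
  qed
  also have "\<dots> = (\<integral>\<^sup>+x. (\<integral>\<^sup>+m. g x * ?Q x * ?Q (x - h + lattice (- m)) \<partial>count_space UNIV) \<partial>lborel)"
    by (rule nn_integral_lattice_swap[symmetric]) measurable
  also have "\<dots> = (\<integral>\<^sup>+x. g x * ?Q x * (\<integral>\<^sup>+m. ?Q (x - h + lattice (- m)) \<partial>count_space UNIV) \<partial>lborel)"
    by (subst nn_integral_cmult) auto
  also have "\<dots> = (\<integral>\<^sup>+x. g x * ?Q x * 1 \<partial>lborel)"
  proof (intro nn_integral_cong arg_cong2[where f="(*)"] refl)
    fix x h
    have "(\<integral>\<^sup>+m. ?Q (x + lattice (- m)) \<partial>count_space UNIV) = (\<integral>\<^sup>+m. ?Q (x + lattice m) \<partial>count_space UNIV)" for x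
      by (rule nn_integral_bij_count_space[of uminus UNIV UNIV "\<lambda>m. ?Q (x + lattice m)"]) (simp add: bij_uminus)
    then show "(\<integral>\<^sup>+m. ?Q (x - h + lattice (- m)) \<partial>count_space UNIV) = 1"
      by (simp add: nn_integral_half_open_cell_lattice)
  qed
  finally show ?thesis by (simp add: cell)
qed

lemma sq_int_shift:
  fixes f :: "real^2 \<Rightarrow> 'b::{real_normed_vector,second_countable_topology}"
  assumes [measurable]: "f \<in> borel_measurable borel" and "periodic f"
  shows "sq_int (\<lambda>x. f (x + h)) = sq_int f"
  unfolding sq_int_def
  by (rule nn_integral_cell_shift) (use assms in \<open>auto simp: periodic_def\<close>)

section \<open>Squared distances between a field and its shifts\<close>

definition shift_diff :: "(real^2 \<Rightarrow> real^2) \<Rightarrow> real^2 \<Rightarrow> ennreal" where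
  "shift_diff f h = sq_int (\<lambda>x. f (x + h) - f x)"

lemma shift_diff_le:
  assumes "f \<in> L2x"
  shows "shift_diff f h \<le> 4 * sq_int f"
proof -
  note [measurable] = L2x_borel[OF assms]
  have "shift_diff f h \<le> 2 * sq_int (\<lambda>x. f (x + h)) + 2 * sq_int f"
    unfolding shift_diff_def by (rule sq_int_diff_le) auto
  also have "\<dots> = 4 * sq_int f"
    by (simp add: sq_int_shift L2x_periodic[OF assms] distrib_right[symmetric])
  finally show ?thesis .
qed

text \<open>The increment by h from x is the increment by h' from x minus the increment by h' - h
  from x + h; the base point x + h can be replaced by x because the field is periodic.\<close>

lemma shift_diff_triangle:
  assumes "f \<in> L2x"
  shows "shift_diff f h \<le> 2 * shift_diff f h' + 2 * shift_diff f (h' - h)"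
proof -
  note [measurable] = L2x_borel[OF assms]
  let ?F = "\<lambda>y. f (y + (h' - h)) - f y"
  have "shift_diff f h = sq_int (\<lambda>x. (f (x + h') - f x) - ?F (x + h))"
    by (simp add: shift_diff_def algebra_simps)
  also have "\<dots> \<le> 2 * sq_int (\<lambda>x. f (x + h') - f x) + 2 * sq_int (\<lambda>x. ?F (x + h))"
    by (rule sq_int_diff_le) auto
  also have "sq_int (\<lambda>x. ?F (x + h)) = sq_int ?F"
    by (rule sq_int_shift) (auto intro!: periodic_diff periodic_shift L2x_periodic[OF assms])
  finally show ?thesis by (simp add: shift_diff_def)
qed

text \<open>Transfers small shift differences from g to a nearby f: the increments of f are those of
  g minus those of g - f, and the latter cost the factor 4 of \<open>shift_diff_le\<close>,
  doubled.\<close>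

lemma shift_diff_diff_le:
  assumes "f \<in> L2x" "g \<in> L2x"
  shows "shift_diff f h \<le> 2 * shift_diff g h + 8 * sq_int (\<lambda>x. f x - g x)"
proof -
  note [measurable] = assms[THEN L2x_borel]
  let ?d = "\<lambda>x. g x - f x"
  have d: "?d \<in> L2x" using assms by (intro L2x_diff)
  have "shift_diff f h = sq_int (\<lambda>x. (g (x + h) - g x) - (?d (x + h) - ?d x))"
    by (simp add: shift_diff_def algebra_simps)
  also have "\<dots> \<le> 2 * sq_int (\<lambda>x. g (x + h) - g x) + 2 * sq_int (\<lambda>x. ?d (x + h) - ?d x)"
    by (rule sq_int_diff_le) auto
  also have "sq_int (\<lambda>x. ?d (x + h) - ?d x) \<le> 4 * sq_int ?d"
    using shift_diff_le[OF d] by (simp add: shift_diff_def)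
  also have "sq_int ?d = sq_int (\<lambda>x. f x - g x)"
    by (simp add: sq_int_def norm_minus_commute)
  finally show ?thesis
    by (simp add: shift_diff_def mult.assoc[symmetric] mult_left_mono add_left_mono)
qed

lemma borel_measurable_shift_diff:
  assumes [measurable]: "(\<lambda>(t, x). U t x) \<in> borel_measurable (M \<Otimes>\<^sub>M borel)"
  shows "(\<lambda>(t, h). shift_diff (U t) h) \<in> borel_measurable (M \<Otimes>\<^sub>M borel)"
  unfolding shift_diff_def sq_int_def by measurable

lemma measure_ball_pos: "0 < r \<Longrightarrow> 0 < measure lborel (ball (0::real^2) r)"
  using content_ball_pos[of r 0] by simp

text \<open>Tonelli exchanges point and shift. The work lies in the real-valued integrals of
  \<open>S2\<close>: the bound \<open>shift_diff_le\<close> makes the double integral finite, so the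
  inner integral is finite at almost every point and nothing is lost by passing to real
  numbers.\<close>

lemma nn_integral_shift_diff_ball:
  assumes f: "f \<in> L2x" and r: "0 < r"
  shows "(\<integral>\<^sup>+h\<in>ball 0 r. shift_diff f h \<partial>lborel) =
    ennreal (measure lborel (ball (0::real^2) r) * (S2 f r)\<^sup>2)"
proof -
  note [measurable] = L2x_borel[OF f]
  let ?m = "measure lborel (ball (0::real^2) r)"
  have m: "0 < ?m" using r by (rule measure_ball_pos)
  have [measurable]: "ball 0 r \<in> sets (borel :: (real^2) measure)" by simp
  define J where "J x = (\<integral>\<^sup>+h\<in>ball 0 r. ennreal ((norm (f (x + h) - f x))\<^sup>2) \<partial>lborel)" for x
  have [measurable]: "J \<in> borel_measurable borel" unfolding J_def by measurable
  have "(\<integral>\<^sup>+h\<in>ball 0 r. shift_diff f h \<partial>lborel) = (\<integral>\<^sup>+h. (\<integral>\<^sup>+x. ennreal ((norm (f (x + h) - f x))\<^sup>2) *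
      indicator torus_cell x * indicator (ball 0 r) h \<partial>lborel) \<partial>lborel)"
    unfolding shift_diff_def sq_int_def by (subst nn_integral_multc) auto
  also have "\<dots> = (\<integral>\<^sup>+x. (\<integral>\<^sup>+h. ennreal ((norm (f (x + h) - f x))\<^sup>2) *
      indicator torus_cell x * indicator (ball 0 r) h \<partial>lborel) \<partial>lborel)"
    by (rule lborel_pair.Fubini') measurable
  also have "\<dots> = (\<integral>\<^sup>+x. J x * indicator torus_cell x \<partial>lborel)"
    unfolding J_def by (subst nn_integral_multc[symmetric]) (auto intro!: nn_integral_cong simp: mult_ac)
  finally have J: "(\<integral>\<^sup>+h\<in>ball 0 r. shift_diff f h \<partial>lborel) = (\<integral>\<^sup>+x. J x * indicator torus_cell x \<partial>lborel)" .
  have "(\<integral>\<^sup>+h\<in>ball 0 r. shift_diff f h \<partial>lborel) \<le> (\<integral>\<^sup>+h. 4 * sq_int f * indicator (ball (0::real^2) r) h \<partial>lborel)"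
    by (intro nn_integral_mono mult_right_mono shift_diff_le f) auto
  also have "\<dots> = 4 * sq_int f * emeasure lborel (ball (0::real^2) r)"
    by (intro nn_integral_cmult_indicator) auto
  also have "\<dots> < \<infinity>"
    using f emeasure_lborel_ball_finite[of "0::real^2" r] by (auto simp: sq_int_L2x ennreal_mult_less_top)
  finally have J_fin: "(\<integral>\<^sup>+x. J x * indicator torus_cell x \<partial>lborel) \<noteq> \<infinity>" by (simp add: J)
  then have AE_fin: "AE x in lborel. J x * indicator torus_cell x \<noteq> \<infinity>"
    by (rule nn_integral_PInf_AE[rotated]) measurable
  \<comment> \<open>Valid at every x: where the extended integral is infinite, both the Bochner
    integral and \<open>enn2real\<close> default to 0.\<close>
  have inner: "(LINT h:ball 0 r|lborel. (norm (f (x + h) - f x))\<^sup>2) = enn2real (J x)" for x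
    unfolding set_lebesgue_integral_def J_def
    by (subst integral_eq_nn_integral) (auto intro!: arg_cong[where f=enn2real] nn_integral_cong simp: indicator_def)
  have "(S2 f r)\<^sup>2 = (LINT x|lborel. indicator torus_cell x *\<^sub>R (1 / ?m * enn2real (J x)))"
    unfolding S2_def set_lebesgue_integral_def inner[unfolded set_lebesgue_integral_def]
    by (subst real_sqrt_pow2) (auto intro!: integral_nonneg_AE)
  also have "\<dots> = enn2real (\<integral>\<^sup>+x. ennreal (indicator torus_cell x *\<^sub>R (1 / ?m * enn2real (J x))) \<partial>lborel)"
    by (rule integral_eq_nn_integral) auto
  also have "(\<integral>\<^sup>+x. ennreal (indicator torus_cell x *\<^sub>R (1 / ?m * enn2real (J x))) \<partial>lborel) =
      (\<integral>\<^sup>+x. ennreal (1 / ?m) * (J x * indicator torus_cell x) \<partial>lborel)"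
  proof (intro nn_integral_cong_AE, use AE_fin in eventually_elim)
    case (elim x)
    show ?case
    proof (cases "x \<in> torus_cell")
      case True
      then have "ennreal (enn2real (J x)) = J x" using elim by (simp add: less_top)
      moreover have "ennreal (1 / ?m * enn2real (J x)) = ennreal (1 / ?m) * ennreal (enn2real (J x))"
        using m by (intro ennreal_mult) auto
      ultimately show ?thesis using True by simp
    qed simp
  qed
  also have "\<dots> = ennreal (1 / ?m) * (\<integral>\<^sup>+x. J x * indicator torus_cell x \<partial>lborel)"
    by (rule nn_integral_cmult) measurable
  finally have "?m * (S2 f r)\<^sup>2 = enn2real (\<integral>\<^sup>+x. J x * indicator torus_cell x \<partial>lborel)"
    using m by (simp add: enn2real_mult)
  then show ?thesis using J_fin by (simp add: J less_top)
qed

section \<open>Structure functions and shifts\<close>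

definition energy :: "real \<Rightarrow> (real \<Rightarrow> real^2 \<Rightarrow> real^2) \<Rightarrow> ennreal" where
  "energy T F = (\<integral>\<^sup>+t\<in>{0<..<T}. sq_int (F t) \<partial>lborel)"

definition shift_energy :: "real \<Rightarrow> (real \<Rightarrow> real^2 \<Rightarrow> real^2) \<Rightarrow> real^2 \<Rightarrow> ennreal" where
  "shift_energy T U h = (\<integral>\<^sup>+t\<in>{0<..<T}. shift_diff (U t) h \<partial>lborel)"

lemma emeasure_ball: "emeasure lborel (ball (0::real^2) r) = ennreal (measure lborel (ball (0::real^2) r))"
  using emeasure_lborel_ball_finite[of "0::real^2" r] by (intro emeasure_eq_ennreal_measure) auto

lemma measure_ball_double:
  assumes "0 < r"
  shows "measure lborel (ball (0::real^2) (2 * r)) = 4 * measure lborel (ball (0::real^2) r)"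
proof -
  have "measure lborel (ball (0::real^2) s) = s ^ 2 * measure lborel (ball (0::real^2) 1)" if "0 < s" for s
    using content_ball_conv_unit_ball[of s "0::real^2"] that by simp
  from this[of r] this[of "2 * r"] show ?thesis using assms by (simp only: power_mult_distrib) simp
qed

text \<open>Measurability and membership in \<open>L2x\<close> are required at all times, not only
  in (0,T), so that product measurability can be used without restricted spaces. Extension by zero
  provides this later.\<close>

locale bounded_field =
  fixes T M :: real and U :: "real \<Rightarrow> real^2 \<Rightarrow> real^2"
  assumes T_pos: "0 < T"
    and U_measurable [measurable]: "(\<lambda>(t, x). U t x) \<in> borel_measurable (borel \<Otimes>\<^sub>M borel)"
    and U_L2x: "\<And>t. U t \<in> L2x"
    and U_bound: "AE t in lborel. sq_int (U t) \<le> ennreal (M\<^sup>2)"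
begin

lemma shift_diff_measurable [measurable]: "(\<lambda>(t, h). shift_diff (U t) h) \<in> borel_measurable (borel \<Otimes>\<^sub>M borel)"
  by (rule borel_measurable_shift_diff) measurable

lemma shift_energy_measurable [measurable]: "shift_energy T U \<in> borel_measurable borel"
  unfolding shift_energy_def by measurable

lemma nn_integral_interval_const: "(\<integral>\<^sup>+t\<in>{0<..<T}. ennreal c \<partial>lborel) = ennreal (T * c)" if "0 \<le> c"
  using T_pos that by (subst nn_integral_cmult_indicator) (auto simp: ennreal_mult mult.commute)

lemma shift_diff_AE_le:
  "AE t in lborel. shift_diff (U t) h * indicator {0<..<T} t \<le> ennreal (4 * M\<^sup>2) * indicator {0<..<T} t"
  using U_bound
proof eventually_elim
  case (elim t)
  have "shift_diff (U t) h \<le> 4 * sq_int (U t)" by (rule shift_diff_le[OF U_L2x])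
  also have "\<dots> \<le> 4 * ennreal (M\<^sup>2)" by (intro mult_left_mono elim) simp
  also have "\<dots> = ennreal (4 * M\<^sup>2)" by (simp add: ennreal_mult)
  finally show ?case by (rule mult_right_mono) simp
qed

lemma shift_energy_le: "shift_energy T U h \<le> ennreal (4 * T * M\<^sup>2)"
proof -
  have "shift_energy T U h \<le> (\<integral>\<^sup>+t\<in>{0<..<T}. ennreal (4 * M\<^sup>2) \<partial>lborel)"
    unfolding shift_energy_def by (intro nn_integral_mono_AE shift_diff_AE_le)
  also have "\<dots> = ennreal (4 * T * M\<^sup>2)"
    by (subst nn_integral_interval_const) (auto simp: mult_ac)
  finally show ?thesis .
qed

text \<open>Identifies the squared structure function in space-time as the mean of
  \<open>shift_energy\<close> over the ball. Finiteness, needed to return from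
  \<open>enn2real\<close>, comes from the uniform bound \<open>shift_energy_le\<close>.\<close>

lemma nn_integral_shift_energy_ball:
  assumes r: "0 < r"
  shows "(\<integral>\<^sup>+h\<in>ball 0 r. shift_energy T U h \<partial>lborel) =
    ennreal (measure lborel (ball (0::real^2) r) * (S2T T U r)\<^sup>2)"
proof -
  let ?m = "measure lborel (ball (0::real^2) r)"
  have m: "0 < ?m" using r by (rule measure_ball_pos)
  have [measurable]: "ball 0 r \<in> sets (borel :: (real^2) measure)" by simp
  define N where "N t = (\<integral>\<^sup>+h\<in>ball 0 r. shift_diff (U t) h \<partial>lborel)" for t
  have [measurable]: "N \<in> borel_measurable borel" unfolding N_def by measurable
  have N: "N t = ennreal (?m * (S2 (U t) r)\<^sup>2)" for t
    unfolding N_def using U_L2x r by (rule nn_integral_shift_diff_ball)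
  \<comment> \<open>Measurability in time of the structure function is read off from the measurable
    integral \<open>N\<close>.\<close>
  have "(S2 (U t) r)\<^sup>2 = enn2real (N t) / ?m" for t
    using m by (simp add: N)
  then have [measurable]: "(\<lambda>t. (S2 (U t) r)\<^sup>2) \<in> borel_measurable borel" by simp
  have "(\<integral>\<^sup>+h\<in>ball 0 r. shift_energy T U h \<partial>lborel) =
      (\<integral>\<^sup>+h. (\<integral>\<^sup>+t. shift_diff (U t) h * indicator {0<..<T} t * indicator (ball 0 r) h \<partial>lborel) \<partial>lborel)"
    unfolding shift_energy_def by (subst nn_integral_multc) auto
  also have "\<dots> = (\<integral>\<^sup>+t. (\<integral>\<^sup>+h. shift_diff (U t) h * indicator {0<..<T} t * indicator (ball 0 r) h \<partial>lborel) \<partial>lborel)"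
    by (rule lborel_pair.Fubini') measurable
  also have "\<dots> = (\<integral>\<^sup>+t. N t * indicator {0<..<T} t \<partial>lborel)"
    unfolding N_def by (subst nn_integral_multc[symmetric]) (auto intro!: nn_integral_cong simp: mult_ac)
  finally have eq: "(\<integral>\<^sup>+h\<in>ball 0 r. shift_energy T U h \<partial>lborel) = (\<integral>\<^sup>+t. N t * indicator {0<..<T} t \<partial>lborel)" .
  have "(\<integral>\<^sup>+h\<in>ball 0 r. shift_energy T U h \<partial>lborel) \<le>
      (\<integral>\<^sup>+h. ennreal (4 * T * M\<^sup>2) * indicator (ball (0::real^2) r) h \<partial>lborel)"
    by (intro nn_integral_mono mult_right_mono shift_energy_le) auto
  also have "\<dots> = ennreal (4 * T * M\<^sup>2) * emeasure lborel (ball (0::real^2) r)"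
    by (intro nn_integral_cmult_indicator) auto
  also have "\<dots> < \<infinity>"
    using emeasure_lborel_ball_finite[of "0::real^2" r] by (auto simp: ennreal_mult_less_top)
  finally have fin: "(\<integral>\<^sup>+h\<in>ball 0 r. shift_energy T U h \<partial>lborel) \<noteq> \<infinity>" by simp
  have "(S2T T U r)\<^sup>2 = (LINT t|lborel. indicator {0<..<T} t *\<^sub>R (S2 (U t) r)\<^sup>2)"
    unfolding S2T_def set_lebesgue_integral_def
    by (subst real_sqrt_pow2) (auto intro!: integral_nonneg_AE)
  also have "\<dots> = enn2real (\<integral>\<^sup>+t. ennreal (indicator {0<..<T} t *\<^sub>R (S2 (U t) r)\<^sup>2) \<partial>lborel)"
    by (rule integral_eq_nn_integral) auto
  also have "(\<integral>\<^sup>+t. ennreal (indicator {0<..<T} t *\<^sub>R (S2 (U t) r)\<^sup>2) \<partial>lborel) =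
      (\<integral>\<^sup>+t. ennreal (1 / ?m) * (N t * indicator {0<..<T} t) \<partial>lborel)"
  proof (intro nn_integral_cong)
    fix t
    have "ennreal (1 / ?m) * N t = ennreal (1 / ?m * (?m * (S2 (U t) r)\<^sup>2))"
      unfolding N using m by (subst ennreal_mult[symmetric]) auto
    then have "ennreal ((S2 (U t) r)\<^sup>2) = ennreal (1 / ?m) * N t" using m by simp
    then show "ennreal (indicator {0<..<T} t *\<^sub>R (S2 (U t) r)\<^sup>2) = ennreal (1 / ?m) * (N t * indicator {0<..<T} t)"
      by (auto simp: indicator_def)
  qed
  also have "\<dots> = ennreal (1 / ?m) * (\<integral>\<^sup>+t. N t * indicator {0<..<T} t \<partial>lborel)"
    by (rule nn_integral_cmult) measurable
  finally have "?m * (S2T T U r)\<^sup>2 = enn2real (\<integral>\<^sup>+t. N t * indicator {0<..<T} t \<partial>lborel)"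
    using m by (simp add: enn2real_mult)
  then show ?thesis using fin by (simp add: eq less_top)
qed

lemma S2T_nonneg: "0 \<le> S2T T U r"
  by (auto simp: S2T_def set_lebesgue_integral_def intro!: integral_nonneg_AE)

lemma S2T_le:
  assumes r: "0 < r" and e: "0 \<le> e" "\<And>h. h \<in> ball 0 r \<Longrightarrow> shift_energy T U h \<le> ennreal e"
  shows "(S2T T U r)\<^sup>2 \<le> e"
proof -
  let ?m = "measure lborel (ball (0::real^2) r)"
  have m: "0 < ?m" using r by (rule measure_ball_pos)
  have "ennreal (?m * (S2T T U r)\<^sup>2) \<le> (\<integral>\<^sup>+h. ennreal e * indicator (ball (0::real^2) r) h \<partial>lborel)"
    unfolding nn_integral_shift_energy_ball[OF r, symmetric]
    by (intro nn_integral_mono) (auto simp: indicator_def e)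
  also have "\<dots> = ennreal e * emeasure lborel (ball (0::real^2) r)"
    by (intro nn_integral_cmult_indicator) auto
  also have "\<dots> = ennreal (?m * e)"
    using e(1) by (simp only: emeasure_ball ennreal_mult[symmetric] measure_nonneg mult.commute)
  finally show ?thesis using m e(1) by simp
qed

lemma shift_energy_triangle:
  "shift_energy T U h \<le> 2 * shift_energy T U h' + 2 * shift_energy T U (h' - h)"
proof -
  have "shift_energy T U h \<le> (\<integral>\<^sup>+t. 2 * (shift_diff (U t) h' * indicator {0<..<T} t)
      + 2 * (shift_diff (U t) (h' - h) * indicator {0<..<T} t) \<partial>lborel)"
    unfolding shift_energy_def
    by (intro nn_integral_mono) (auto simp: indicator_def shift_diff_triangle[OF U_L2x])
  also have "\<dots> = 2 * shift_energy T U h' + 2 * shift_energy T U (h' - h)"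
    unfolding shift_energy_def by (simp add: nn_integral_add nn_integral_cmult)
  finally show ?thesis .
qed

text \<open>Averaging the triangle inequality over intermediate points turns the bound on ball averages
  into a bound for every single shift.\<close>

lemma shift_energy_le_S2T:
  assumes h: "norm h < r"
  shows "shift_energy T U h \<le> ennreal (2 * (S2T T U r)\<^sup>2 + 8 * (S2T T U (2 * r))\<^sup>2)"
proof -
  have r: "0 < r" using h norm_ge_zero[of h] by linarith
  then have r2: "0 < 2 * r" by simp
  let ?m = "measure lborel (ball (0::real^2) r)"
  have m: "0 < ?m" using r by (rule measure_ball_pos)
  have [measurable]: "ball 0 r \<in> sets (borel :: (real^2) measure)" "ball 0 (2 * r) \<in> sets (borel :: (real^2) measure)"
    by simp_all
  have "ennreal ?m * shift_energy T U h = (\<integral>\<^sup>+h'. shift_energy T U h * indicator (ball (0::real^2) r) h' \<partial>lborel)"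
    by (subst nn_integral_cmult_indicator) (simp_all add: emeasure_ball mult.commute)
  also have "\<dots> \<le> (\<integral>\<^sup>+h'. 2 * (shift_energy T U h' * indicator (ball 0 r) h') +
      2 * (shift_energy T U (h' + - h) * indicator (ball 0 (2 * r)) (h' + - h)) \<partial>lborel)"
  proof (intro nn_integral_mono)
    fix h'
    \<comment> \<open>The second term is averaged over a ball of twice the radius, whose area is
      four times as large; this turns its factor 2 into 8.\<close>
    have "h' + - h \<in> ball 0 (2 * r)" if "h' \<in> ball 0 r"
      using that h norm_triangle_ineq4[of h' h] by simp
    then show "shift_energy T U h * indicator (ball 0 r) h' \<le>
      2 * (shift_energy T U h' * indicator (ball 0 r) h') +
      2 * (shift_energy T U (h' + - h) * indicator (ball 0 (2 * r)) (h' + - h))"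
      using shift_energy_triangle[of h h'] by (cases "h' \<in> ball 0 r") (auto simp: indicator_def)
  qed
  also have "\<dots> = 2 * (\<integral>\<^sup>+h'. shift_energy T U h' * indicator (ball 0 r) h' \<partial>lborel) +
      2 * (\<integral>\<^sup>+h'. shift_energy T U (h' + - h) * indicator (ball 0 (2 * r)) (h' + - h) \<partial>lborel)"
    by (simp add: nn_integral_add nn_integral_cmult)
  also have "(\<integral>\<^sup>+h'. shift_energy T U (h' + - h) * indicator (ball 0 (2 * r)) (h' + - h) \<partial>lborel) =
      (\<integral>\<^sup>+h'. shift_energy T U h' * indicator (ball 0 (2 * r)) h' \<partial>lborel)"
    by (rule nn_integral_lborel_shift) measurable
  also have "2 * (\<integral>\<^sup>+h'. shift_energy T U h' * indicator (ball 0 r) h' \<partial>lborel) +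
      2 * (\<integral>\<^sup>+h'. shift_energy T U h' * indicator (ball 0 (2 * r)) h' \<partial>lborel) =
      2 * ennreal (?m * (S2T T U r)\<^sup>2) + 2 * ennreal (4 * ?m * (S2T T U (2 * r))\<^sup>2)"
    by (simp only: nn_integral_shift_energy_ball[OF r] nn_integral_shift_energy_ball[OF r2] measure_ball_double[OF r])
  also have "\<dots> = ennreal (2 * (?m * (S2T T U r)\<^sup>2) + 2 * (4 * ?m * (S2T T U (2 * r))\<^sup>2))"
    by (rule ennreal_double_add) (use m in auto)
  also have "2 * (?m * (S2T T U r)\<^sup>2) + 2 * (4 * ?m * (S2T T U (2 * r))\<^sup>2) =
      ?m * (2 * (S2T T U r)\<^sup>2 + 8 * (S2T T U (2 * r))\<^sup>2)"
    by (simp add: algebra_simps)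
  finally have le: "ennreal ?m * shift_energy T U h \<le> ennreal (?m * (2 * (S2T T U r)\<^sup>2 + 8 * (S2T T U (2 * r))\<^sup>2))" .
  obtain s where s: "0 \<le> s" "shift_energy T U h = ennreal s"
    using shift_energy_le[of h] by (cases "shift_energy T U h") (auto simp: top_unique)
  have "?m * s \<le> ?m * (2 * (S2T T U r)\<^sup>2 + 8 * (S2T T U (2 * r))\<^sup>2)"
    using le m s by (subst (asm) s(2), subst (asm) ennreal_mult[symmetric]) (auto simp: ennreal_le_iff)
  then have "s \<le> 2 * (S2T T U r)\<^sup>2 + 8 * (S2T T U (2 * r))\<^sup>2" using m by simp
  then show ?thesis unfolding s(2) by (rule ennreal_leI)
qed

end

section \<open>Continuity of shifts in \<open>L\<^sup>2\<close>\<close>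

lemma dominated_nn_integral_tendsto_0:
  assumes "\<And>n. f n \<in> borel_measurable M" "w \<in> borel_measurable M"
    and "\<And>n. AE x in M. f n x \<le> w x" "(\<integral>\<^sup>+x. w x \<partial>M) < \<infinity>"
    and "AE x in M. (\<lambda>n. f n x) \<longlonglongrightarrow> 0"
  shows "(\<lambda>n::nat. \<integral>\<^sup>+x. f n x \<partial>M) \<longlonglongrightarrow> (0::ennreal)"
  using nn_integral_dominated_convergence[of f M "\<lambda>_. 0" w] assms by simp

lemma tendsto_0_ennreal_eventually_le:
  assumes "f \<longlonglongrightarrow> (0::ennreal)" "0 < e"
  shows "\<exists>n::nat. f n \<le> ennreal e"
proof -
  have "\<forall>\<^sub>F n in sequentially. f n < ennreal e"
    using assms by (intro order_tendstoD(2)[of f 0]) auto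
  then show ?thesis by (metis (mono_tags) eventually_sequentially order_refl less_imp_le)
qed

text \<open>Truncation, then almost everywhere approximation of the bounded truncation by continuous
  functions, which are truncated as well so that dominated convergence applies.\<close>

lemma continuous_L2_approximation:
  fixes f :: "'a::euclidean_space \<Rightarrow> 'b::euclidean_space"
  assumes f [measurable]: "f \<in> borel_measurable borel" and S [measurable]: "S \<in> sets borel" "bounded S"
    and fin: "(\<integral>\<^sup>+x\<in>S. ennreal ((norm (f x))\<^sup>2) \<partial>lborel) < \<infinity>" and e: "0 < e"
  shows "\<exists>g. continuous_on UNIV g \<and> (\<integral>\<^sup>+x\<in>S. ennreal ((norm (f x - g x))\<^sup>2) \<partial>lborel) \<le> ennreal e"
proof -
  \<comment> \<open>The nearest point projection is a continuous truncation: it is bounded by m,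
    fixes the ball of radius m, and moves no point by more than its norm since 0 lies in the
    ball.\<close>
  define c where "c m = closest_point (cball (0::'b) (real m))" for m :: nat
  have c_cont: "continuous_on A (c m)" for A m
    unfolding c_def by (rule continuous_on_closest_point) auto
  then have [measurable]: "c m \<in> borel_measurable borel" for m
    by (rule borel_measurable_continuous_onI)
  have c_norm: "norm (c m y) \<le> real m" for m y
    using closest_point_in_set[of "cball (0::'b) (real m)" y] by (simp add: c_def)
  have c_self: "c m y = y" if "norm y \<le> real m" for m y
    using that by (simp add: c_def closest_point_self)
  have c_dist: "norm (y - c m y) \<le> norm y" for m y
    using closest_point_le[of "cball (0::'b) (real m)" 0 y] by (simp add: c_def dist_norm)
  let ?p = "\<lambda>m x. ennreal ((norm (f x - c m (f x)))\<^sup>2)"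
  have "(\<lambda>m. \<integral>\<^sup>+x. ?p m x * indicator S x \<partial>lborel) \<longlonglongrightarrow> 0"
  proof (rule dominated_nn_integral_tendsto_0[OF _ _ _ fin])
    show "AE x in lborel. ?p m x * indicator S x \<le> ennreal ((norm (f x))\<^sup>2) * indicator S x" for m
      by (intro AE_I2 mult_right_mono ennreal_leI power_mono c_dist) auto
    show "AE x in lborel. (\<lambda>m. ?p m x * indicator S x) \<longlonglongrightarrow> 0"
    proof (rule AE_I2)
      fix x
      obtain m0 :: nat where m0: "norm (f x) \<le> real m0" using real_arch_simple by blast
      show "(\<lambda>m. ?p m x * indicator S x) \<longlonglongrightarrow> 0"
      proof (rule tendsto_eventually, rule eventually_sequentiallyI[of m0])
        fix m assume "m0 \<le> m"
        then have "c m (f x) = f x" using m0 by (intro c_self) linarith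
        then show "?p m x * indicator S x = 0" by simp
      qed
    qed
  qed measurable
  from tendsto_0_ennreal_eventually_le[OF this, of "e/4"] e
  obtain m where m: "(\<integral>\<^sup>+x. ?p m x * indicator S x \<partial>lborel) \<le> ennreal (e/4)"
    by auto
  \<comment> \<open>Lebesgue measurability means being a limit of continuous functions off a
    negligible set, which is what \<open>measurable_on\<close> unfolds to.\<close>
  have "(\<lambda>x. c m (f x)) \<in> borel_measurable lebesgue"
    by (intro measurable_completion) measurable
  then have "(\<lambda>x. c m (f x)) measurable_on UNIV"
    by (rule lebesgue_measurable_imp_measurable_on) simp
  then obtain N g where N: "negligible N" and g_cont: "\<And>n::nat. continuous_on UNIV (g n)"
    and g_lim: "\<And>x. x \<notin> N \<Longrightarrow> (\<lambda>n. g n x) \<longlonglongrightarrow> c m (f x)"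
    unfolding measurable_on_def by auto
  have cg_cont: "continuous_on UNIV (\<lambda>x. c m (g n x))" for n
    using continuous_on_compose2[OF c_cont[of UNIV m] g_cont[of n]] by simp
  then have [measurable]: "(\<lambda>x. c m (g n x)) \<in> borel_measurable borel" for n
    by (rule borel_measurable_continuous_onI)
  have AE_N: "AE x in lborel. x \<notin> N"
    using AE_not_in[of N lebesgue] N by (simp add: negligible_iff_null_sets AE_completion_iff)
  let ?q = "\<lambda>m n x. ennreal ((norm (c m (f x) - c m (g n x)))\<^sup>2)"
  have "(\<lambda>n. \<integral>\<^sup>+x. ?q m n x * indicator S x \<partial>lborel) \<longlonglongrightarrow> 0"
  proof (rule dominated_nn_integral_tendsto_0)
    show "AE x in lborel. ?q m n x * indicator S x \<le> ennreal ((2 * real m)\<^sup>2) * indicator S x" for n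
    proof (intro AE_I2 mult_right_mono ennreal_leI power_mono)
      fix x
      show "norm (c m (f x) - c m (g n x)) \<le> 2 * real m"
        using norm_triangle_ineq4[of "c m (f x)" "c m (g n x)"] c_norm[of m "f x"] c_norm[of m "g n x"] by linarith
    qed auto
    have "(\<integral>\<^sup>+x. ennreal ((2 * real m)\<^sup>2) * indicator S x \<partial>lborel) = ennreal ((2 * real m)\<^sup>2) * emeasure lborel S"
      by (intro nn_integral_cmult_indicator) simp
    then show "(\<integral>\<^sup>+x. ennreal ((2 * real m)\<^sup>2) * indicator S x \<partial>lborel) < \<infinity>"
      using emeasure_bounded_finite[OF S(2)] by (simp add: ennreal_mult_less_top)
    show "AE x in lborel. (\<lambda>n. ?q m n x * indicator S x) \<longlonglongrightarrow> 0"
      using AE_N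
    proof eventually_elim
      case (elim x)
      have "(\<lambda>n. c m (g n x)) \<longlonglongrightarrow> c m (c m (f x))"
        using continuous_on_tendsto_compose[OF c_cont[of UNIV m] g_lim[OF elim]] by simp
      then have "(\<lambda>n. c m (g n x)) \<longlonglongrightarrow> c m (f x)"
        using c_self[OF c_norm] by simp
      then have "(\<lambda>n. (norm (c m (f x) - c m (g n x)))\<^sup>2) \<longlonglongrightarrow> (norm (c m (f x) - c m (f x)))\<^sup>2"
        by (intro tendsto_intros)
      from tendsto_ennrealI[OF this]
      have "(\<lambda>n. ?q m n x) \<longlonglongrightarrow> 0" by simp
      then show ?case by (cases "x \<in> S") auto
    qed
  qed measurable
  from tendsto_0_ennreal_eventually_le[OF this, of "e/4"] e
  obtain n where n: "(\<integral>\<^sup>+x. ?q m n x * indicator S x \<partial>lborel) \<le> ennreal (e/4)"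
    by auto
  have "(\<integral>\<^sup>+x\<in>S. ennreal ((norm (f x - c m (g n x)))\<^sup>2) \<partial>lborel) \<le>
    (\<integral>\<^sup>+x. 2 * (?p m x * indicator S x) +
      2 * (?q m n x * indicator S x) \<partial>lborel)"
  proof (intro nn_integral_mono)
    fix x
    have "(norm (f x - c m (g n x)))\<^sup>2 \<le> 2 * (norm (f x - c m (f x)))\<^sup>2 + 2 * (norm (c m (f x) - c m (g n x)))\<^sup>2"
      using norm_diff_sq_le[of "f x - c m (f x)" "c m (g n x) - c m (f x)"] by (simp add: norm_minus_commute)
    then have "ennreal ((norm (f x - c m (g n x)))\<^sup>2) \<le>
        ennreal (2 * (norm (f x - c m (f x)))\<^sup>2 + 2 * (norm (c m (f x) - c m (g n x)))\<^sup>2)"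
      by (rule ennreal_leI)
    also have "\<dots> = 2 * ?p m x + 2 * ?q m n x"
      by (simp add: ennreal_double_add)
    finally show "ennreal ((norm (f x - c m (g n x)))\<^sup>2) * indicator S x \<le>
      2 * (?p m x * indicator S x) +
      2 * (?q m n x * indicator S x)"
      by (auto simp: indicator_def)
  qed
  also have "\<dots> = 2 * (\<integral>\<^sup>+x. ?p m x * indicator S x \<partial>lborel) +
      2 * (\<integral>\<^sup>+x. ?q m n x * indicator S x \<partial>lborel)"
    by (simp add: nn_integral_add nn_integral_cmult)
  also have "\<dots> \<le> 2 * ennreal (e/4) + 2 * ennreal (e/4)"
    by (intro add_mono mult_left_mono m n) auto
  also have "\<dots> = ennreal (2 * (e/4) + 2 * (e/4))"
    by (rule ennreal_double_add) (use e in auto)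
  finally show ?thesis using cg_cont by (intro exI[of _ "\<lambda>x. c m (g n x)"]) simp
qed

lemma finite_int2_box: "finite {m :: int^2. \<forall>i. m $ i \<in> {a..b}}"
proof (rule finite_subset)
  show "{m :: int^2. \<forall>i. m $ i \<in> {a..b}} \<subseteq> (\<lambda>(p, q). \<chi> i. if i = 1 then p else q) ` ({a..b} \<times> {a..b})"
  proof
    fix m :: "int^2" assume "m \<in> {m. \<forall>i. m $ i \<in> {a..b}}"
    then have "(m $ 1, m $ 2) \<in> {a..b} \<times> {a..b}" by simp
    moreover have "m = (\<lambda>(p, q). \<chi> i. if i = 1 then p else q) (m $ 1, m $ 2)"
      by (simp add: vec_eq_iff forall_2)
    ultimately show "m \<in> (\<lambda>(p, q). \<chi> i. if i = 1 then p else q) ` ({a..b} \<times> {a..b})" by blast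
  qed
qed simp

text \<open>This box contains every x + h with x in the cell and h of norm at most 1. Finitely many
  lattice translates of the cell cover it, and by periodicity each contributes
  \<open>sq_int f\<close>.\<close>

lemma L2x_locally_square_integrable:
  assumes "f \<in> L2x"
  shows "(\<integral>\<^sup>+x\<in>{x. \<forall>i. -1 \<le> x $ i \<and> x $ i \<le> 2}. ennreal ((norm (f x))\<^sup>2) \<partial>lborel) < \<infinity>"
proof -
  note [measurable] = L2x_borel[OF assms]
  let ?F = "{m :: int^2. \<forall>i. m $ i \<in> {-2..1}}"
  have F: "finite ?F" by (rule finite_int2_box)
  have "(\<integral>\<^sup>+x\<in>{x. \<forall>i. -1 \<le> x $ i \<and> x $ i \<le> 2}. ennreal ((norm (f x))\<^sup>2) \<partial>lborel) \<le>
    (\<integral>\<^sup>+x. (\<Sum>m\<in>?F. ennreal ((norm (f (x + lattice m)))\<^sup>2) * indicator torus_cell (x + lattice m)) \<partial>lborel)"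
  proof (intro nn_integral_mono)
    fix x :: "real^2"
    show "ennreal ((norm (f x))\<^sup>2) * indicator {x. \<forall>i. -1 \<le> x $ i \<and> x $ i \<le> 2} x \<le>
      (\<Sum>m\<in>?F. ennreal ((norm (f (x + lattice m)))\<^sup>2) * indicator torus_cell (x + lattice m))"
    proof (cases "\<forall>i. -1 \<le> x $ i \<and> x $ i \<le> 2")
      case True
      define m :: "int^2" where "m = (\<chi> i. - \<lfloor>x $ i\<rfloor>)"
      have "-1 \<le> \<lfloor>x $ i\<rfloor> \<and> \<lfloor>x $ i\<rfloor> \<le> 2" for i
        using True[rule_format, of i] by linarith
      then have "m $ i \<in> {-2..1}" for i
        by (simp add: m_def)
      then have m: "m \<in> ?F" by simp
      have "0 \<le> x $ i + of_int (- \<lfloor>x $ i\<rfloor>) \<and> x $ i + of_int (- \<lfloor>x $ i\<rfloor>) \<le> 1" for i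
        by linarith
      then have cell: "x + lattice m \<in> torus_cell"
        by (simp add: m_def lattice_def mem_box_cart)
      have "ennreal ((norm (f x))\<^sup>2) * indicator {x. \<forall>i. -1 \<le> x $ i \<and> x $ i \<le> 2} x =
          ennreal ((norm (f (x + lattice m)))\<^sup>2) * indicator torus_cell (x + lattice m)"
        using True cell by (simp add: periodic_lattice[OF L2x_periodic[OF assms]])
      also have "\<dots> \<le> (\<Sum>m\<in>?F. ennreal ((norm (f (x + lattice m)))\<^sup>2) * indicator torus_cell (x + lattice m))"
        using m F by (intro member_le_sum) auto
      finally show ?thesis .
    qed simp
  qed
  also have "\<dots> = (\<Sum>m\<in>?F. \<integral>\<^sup>+x. ennreal ((norm (f (x + lattice m)))\<^sup>2) * indicator torus_cell (x + lattice m) \<partial>lborel)"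
    by (intro nn_integral_sum) measurable
  also have "\<dots> = (\<Sum>m\<in>?F. sq_int f)"
    unfolding sq_int_def
    by (intro sum.cong refl nn_integral_lborel_shift[of "\<lambda>x. ennreal ((norm (f x))\<^sup>2) * indicator torus_cell x"]) measurable
  also have "\<dots> < \<infinity>"
    using assms F by (simp add: sq_int_L2x ennreal_mult_less_top of_nat_less_top)
  finally show ?thesis .
qed

lemma emeasure_torus_cell: "emeasure lborel torus_cell = 1"
proof -
  have "(\<Prod>b\<in>Basis. (1 - 0 :: real^2) \<bullet> b) = 1"
    by (intro prod.neutral) (auto simp: Basis_vec_def inner_axis)
  then show ?thesis by (subst emeasure_lborel_cbox) (auto simp: Basis_vec_def inner_axis)
qed

text \<open>Continuity of translations: a continuous approximation g is uniformly continuous on the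
  enlarged box, and f - g is small there, both at x and at x + h.\<close>

lemma shift_diff_tendsto_0:
  assumes f: "f \<in> L2x" and e: "0 < e"
  shows "\<exists>\<delta>>0. \<forall>h. norm h < \<delta> \<longrightarrow> shift_diff f h \<le> ennreal e"
proof -
  note [measurable] = L2x_borel[OF f]
  let ?B = "{x :: real^2. \<forall>i. -1 \<le> x $ i \<and> x $ i \<le> 2}"
  have B: "?B = cbox (\<chi> i. -1) (\<chi> i. 2)" by (auto simp: mem_box_cart)
  have [measurable]: "?B \<in> sets borel" unfolding B by simp
  \<comment> \<open>The three small quantities are combined with weights 2 * (2 + 2) + 2 = 10, from
    two uses of the squared triangle inequality.\<close>
  define e' where "e' = e / 10"
  have e': "0 < e'" using e by (simp add: e'_def)
  have "\<exists>g. continuous_on UNIV g \<and> (\<integral>\<^sup>+x\<in>?B. ennreal ((norm (f x - g x))\<^sup>2) \<partial>lborel) \<le> ennreal e'"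
    using L2x_locally_square_integrable[OF f] e'
    by (intro continuous_L2_approximation) (auto simp: B)
  then obtain g where g: "continuous_on UNIV g" "(\<integral>\<^sup>+x\<in>?B. ennreal ((norm (f x - g x))\<^sup>2) \<partial>lborel) \<le> ennreal e'"
    by blast
  have [measurable]: "g \<in> borel_measurable borel" using g(1) by (rule borel_measurable_continuous_onI)
  have "uniformly_continuous_on ?B g"
    unfolding B by (intro compact_uniformly_continuous continuous_on_subset[OF g(1)]) auto
  then have "\<exists>d>0. \<forall>x\<in>?B. \<forall>y\<in>?B. dist y x < d \<longrightarrow> dist (g y) (g x) < sqrt e'"
    unfolding uniformly_continuous_on_def using real_sqrt_gt_zero[OF e'] by fast
  then obtain d where d: "0 < d" "\<And>x y. x \<in> ?B \<Longrightarrow> y \<in> ?B \<Longrightarrow> dist y x < d \<Longrightarrow> dist (g y) (g x) < sqrt e'"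
    by blast
  have "shift_diff f h \<le> ennreal e" if h: "norm h < min d 1" for h
  proof -
    have inB: "x + h \<in> ?B \<and> x \<in> ?B" if "x \<in> torus_cell" for x
    proof -
      have "-1 \<le> (x + h) $ i \<and> (x + h) $ i \<le> 2 \<and> -1 \<le> x $ i \<and> x $ i \<le> 2" for i
      proof -
        have "\<bar>h $ i\<bar> < 1" using h component_le_norm_cart[of h i] by linarith
        moreover have "0 \<le> x $ i \<and> x $ i \<le> 1" using that by (simp add: mem_box_cart)
        ultimately show ?thesis unfolding vector_add_component by linarith
      qed
      then show ?thesis by blast
    qed
    let ?w = "\<lambda>x. f x - g x"
    have w1: "sq_int (\<lambda>x. ?w (x + h)) \<le> ennreal e'"
    proof -
      have "sq_int (\<lambda>x. ?w (x + h)) \<le> (\<integral>\<^sup>+x. ennreal ((norm (?w (x + h)))\<^sup>2) * indicator ?B (x + h) \<partial>lborel)"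
        unfolding sq_int_def using inB by (intro nn_integral_mono) (auto simp: indicator_def)
      also have "\<dots> = (\<integral>\<^sup>+x. ennreal ((norm (?w x))\<^sup>2) * indicator ?B x \<partial>lborel)"
        by (rule nn_integral_lborel_shift) measurable
      finally show ?thesis using g(2) by simp
    qed
    have w2: "sq_int ?w \<le> ennreal e'"
    proof -
      have "sq_int ?w \<le> (\<integral>\<^sup>+x. ennreal ((norm (?w x))\<^sup>2) * indicator ?B x \<partial>lborel)"
        unfolding sq_int_def using inB by (intro nn_integral_mono) (auto simp: indicator_def)
      then show ?thesis using g(2) by simp
    qed
    have q: "sq_int (\<lambda>x. g x - g (x + h)) \<le> ennreal e'"
    proof -
      have "sq_int (\<lambda>x. g x - g (x + h)) \<le> (\<integral>\<^sup>+x. ennreal e' * indicator torus_cell x \<partial>lborel)"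
        unfolding sq_int_def
      proof (intro nn_integral_mono)
        fix x
        have "(norm (g x - g (x + h)))\<^sup>2 \<le> e'" if "x \<in> torus_cell"
        proof -
          have "norm (g x - g (x + h)) < sqrt e'"
            using d(2)[of "x + h" x] inB[OF that] h by (simp add: dist_norm)
          then have "(norm (g x - g (x + h)))\<^sup>2 \<le> (sqrt e')\<^sup>2" by (intro power_mono) auto
          then show ?thesis using e' by simp
        qed
        then show "ennreal ((norm (g x - g (x + h)))\<^sup>2) * indicator torus_cell x \<le> ennreal e' * indicator torus_cell x"
          by (auto simp: indicator_def intro: ennreal_leI)
      qed
      also have "\<dots> = ennreal e'" by (subst nn_integral_cmult_indicator) (auto simp: emeasure_torus_cell)
      finally show ?thesis .
    qed
    have "shift_diff f h = sq_int (\<lambda>x. (?w (x + h) - ?w x) - (g x - g (x + h)))"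
      by (simp add: shift_diff_def algebra_simps)
    also have "\<dots> \<le> 2 * sq_int (\<lambda>x. ?w (x + h) - ?w x) + 2 * sq_int (\<lambda>x. g x - g (x + h))"
      by (rule sq_int_diff_le) auto
    also have "\<dots> \<le> 2 * (2 * sq_int (\<lambda>x. ?w (x + h)) + 2 * sq_int ?w) + 2 * sq_int (\<lambda>x. g x - g (x + h))"
      by (intro add_mono mult_left_mono sq_int_diff_le) auto
    also have "\<dots> \<le> 2 * (2 * ennreal e' + 2 * ennreal e') + 2 * ennreal e'"
      by (intro add_mono mult_left_mono w1 w2 q) auto
    also have "\<dots> = 2 * ennreal (2 * e' + 2 * e') + 2 * ennreal e'"
      by (subst ennreal_double_add) (use e' in auto)
    also have "\<dots> = ennreal (2 * (2 * e' + 2 * e') + 2 * e')"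
      by (rule ennreal_double_add) (use e' in auto)
    also have "2 * (2 * e' + 2 * e') + 2 * e' = e" by (simp add: e'_def)
    finally show ?thesis .
  qed
  then show ?thesis using d(1) by (intro exI[of _ "min d 1"]) auto
qed

text \<open>Dominated convergence speaks about sequences, hence the indirect proof with shifts h n
  tending to 0. At each fixed time the integrand tends to 0, and almost everywhere it is below a
  constant on (0,T).\<close>

lemma (in bounded_field) shift_energy_tendsto_0:
  assumes e: "0 < e"
  shows "\<exists>\<delta>>0. \<forall>h. norm h < \<delta> \<longrightarrow> shift_energy T U h \<le> ennreal e"
proof (rule ccontr)
  assume "\<not> ?thesis"
  then have "\<exists>h. norm h < inverse (real (Suc n)) \<and> \<not> shift_energy T U h \<le> ennreal e" for n
    by (metis inverse_positive_iff_positive of_nat_0_less_iff zero_less_Suc)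
  then obtain h where h: "\<And>n. norm (h n) < inverse (real (Suc n))" "\<And>n. \<not> shift_energy T U (h n) \<le> ennreal e"
    by metis
  have "h \<longlonglongrightarrow> 0"
    using less_imp_le[OF h(1)] by (intro Lim_null_comparison[OF _ LIMSEQ_inverse_real_of_nat] always_eventually) auto
  have "(\<lambda>n. \<integral>\<^sup>+t. shift_diff (U t) (h n) * indicator {0<..<T} t \<partial>lborel) \<longlonglongrightarrow> 0"
  proof (rule dominated_nn_integral_tendsto_0)
    show "AE t in lborel. shift_diff (U t) (h n) * indicator {0<..<T} t \<le> ennreal (4 * M\<^sup>2) * indicator {0<..<T} t" for n
      by (rule shift_diff_AE_le)
    show "(\<integral>\<^sup>+t. ennreal (4 * M\<^sup>2) * indicator {0<..<T} t \<partial>lborel) < \<infinity>"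
      by (simp add: nn_integral_interval_const)
    show "AE t in lborel. (\<lambda>n. shift_diff (U t) (h n) * indicator {0<..<T} t) \<longlonglongrightarrow> 0"
    proof (rule AE_I2)
      fix t
      have "(\<lambda>n. shift_diff (U t) (h n)) \<longlonglongrightarrow> 0"
      proof (rule order_tendstoI)
        fix a :: ennreal assume "0 < a"
        \<comment> \<open>The threshold a may be infinite, so a positive real c is placed below
          it.\<close>
        then obtain c where c: "0 < c" "ennreal c < a"
          by (metis dense ennreal_less_zero_iff ennreal_cases less_top not_less_iff_gr_or_eq order.strict_trans top_greatest)
        obtain \<delta> where \<delta>: "0 < \<delta>" "\<And>h. norm h < \<delta> \<Longrightarrow> shift_diff (U t) h \<le> ennreal c"
          using shift_diff_tendsto_0[OF U_L2x c(1)] by blast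
        have "\<forall>\<^sub>F n in sequentially. norm (h n) < \<delta>"
          using \<open>h \<longlonglongrightarrow> 0\<close> \<delta>(1) by (auto simp: tendsto_iff dist_norm)
        then show "\<forall>\<^sub>F n in sequentially. shift_diff (U t) (h n) < a"
          by eventually_elim (use \<delta>(2) c(2) le_less_trans in blast)
      qed simp
      then show "(\<lambda>n. shift_diff (U t) (h n) * indicator {0<..<T} t) \<longlonglongrightarrow> 0"
        by (cases "t \<in> {0<..<T}") auto
    qed
  qed measurable
  then have "(\<lambda>n. shift_energy T U (h n)) \<longlonglongrightarrow> 0" by (simp add: shift_energy_def)
  from tendsto_0_ennreal_eventually_le[OF this e] h(2) show False by blast
qed

section \<open>Trigonometric kernels\<close>

text \<open>The sign in the exponent is that of \<open>fourier_coeff\<close>, so integrating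
  \<open>mode n\<close> against a component gives the coefficient directly.\<close>

definition mode :: "int^2 \<Rightarrow> real^2 \<Rightarrow> complex" where
  "mode n x = cis (- 2 * pi * (\<Sum>i\<in>UNIV. of_int (n $ i) * x $ i))"

text \<open>An inductive description in place of explicit finite sums: closure under products and
  the extraction of a finite set of frequencies become rule inductions.\<close>

inductive trig_poly :: "(real^2 \<Rightarrow> complex) \<Rightarrow> bool" where
  trig_poly_0: "trig_poly (\<lambda>x. 0)"
| trig_poly_step: "trig_poly f \<Longrightarrow> trig_poly (\<lambda>x. c * mode n x + f x)"

lemma mode_add: "mode n (x + y) = mode n x * mode n y"
  by (simp add: mode_def cis_mult sum_2 algebra_simps)

lemma mode_mult: "mode n x * mode m x = mode (n + m) x"
  by (simp add: mode_def cis_mult sum_2 algebra_simps)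

lemma mode_0 [simp]: "mode 0 x = 1"
  by (simp add: mode_def)

lemma norm_mode [simp]: "norm (mode n x) = 1"
  by (simp add: mode_def)

lemma continuous_on_mode [continuous_intros]: "continuous_on A (mode n)"
  unfolding mode_def by (intro continuous_intros)

lemma mode_measurable [measurable]: "mode n \<in> borel_measurable borel"
  by (intro borel_measurable_continuous_onI continuous_on_mode)

lemma mode_periodic: "mode n (x + axis i 1) = mode n x"
proof -
  have "mode n (axis i 1) = 1"
  proof -
    have "(\<Sum>j\<in>UNIV. of_int (n $ j) * (axis i 1 :: real^2) $ j) = of_int (n $ i)"
      using exhaust_2[of i] by (auto simp: sum_2 axis_def)
    moreover have "cis (- 2 * pi * of_int k) = 1" for k
      using cis_multiple_2pi[of "of_int (- k)"] by (simp add: mult_ac)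
    ultimately show ?thesis by (simp only: mode_def)
  qed
  then show ?thesis by (simp add: mode_add)
qed

lemma trig_poly_single: "trig_poly (\<lambda>x. c * mode n x)"
  using trig_poly_step[OF trig_poly_0, of c n] by simp

lemma trig_poly_const: "trig_poly (\<lambda>x. c)"
  using trig_poly_single[of c 0] by simp

lemma trig_poly_add: "trig_poly f \<Longrightarrow> trig_poly g \<Longrightarrow> trig_poly (\<lambda>x. f x + g x)"
proof (induction rule: trig_poly.induct)
  case (trig_poly_step f c n)
  then show ?case using trig_poly.trig_poly_step[of "\<lambda>x. f x + g x" c n] by (simp add: add.assoc)
qed simp

lemma trig_poly_mult_single: "trig_poly f \<Longrightarrow> trig_poly (\<lambda>x. c * mode n x * f x)"
proof (induction rule: trig_poly.induct)
  case (trig_poly_step f d m)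
  have "c * mode n x * (d * mode m x + f x) = (c * d) * mode (n + m) x + c * mode n x * f x" for x
    unfolding mode_mult[symmetric] by (simp add: algebra_simps)
  then show ?case using trig_poly.trig_poly_step[OF trig_poly_step.IH, of "c * d" "n + m"] by simp
qed (simp add: trig_poly_0)

lemma trig_poly_mult: "trig_poly f \<Longrightarrow> trig_poly g \<Longrightarrow> trig_poly (\<lambda>x. f x * g x)"
proof (induction rule: trig_poly.induct)
  case (trig_poly_step f c n)
  then show ?case
    using trig_poly_add[OF trig_poly_mult_single[of g c n]] by (simp add: distrib_right)
qed (simp add: trig_poly_0)

lemma trig_poly_power: "trig_poly f \<Longrightarrow> trig_poly (\<lambda>x. f x ^ N)"
  by (induction N) (auto intro: trig_poly_const trig_poly_mult)

lemma trig_poly_periodic: "trig_poly f \<Longrightarrow> periodic f"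
  by (induction rule: trig_poly.induct) (auto simp: periodic_def mode_periodic)

lemma trig_poly_continuous: "trig_poly f \<Longrightarrow> continuous_on A f"
  by (induction rule: trig_poly.induct) (auto intro!: continuous_intros)

lemma trig_poly_bounded: "trig_poly f \<Longrightarrow> \<exists>B. \<forall>x. norm (f x) \<le> B"
proof (induction rule: trig_poly.induct)
  case (trig_poly_step f c n)
  then obtain B where "\<forall>x. norm (f x) \<le> B" by blast
  then have "norm (c * mode n x + f x) \<le> norm c + B" for x
    using norm_triangle_ineq[of "c * mode n x" "f x"] by (simp add: norm_mult) (smt (verit))
  then show ?case by blast
qed auto

lemma trig_poly_cos: "trig_poly (\<lambda>x. complex_of_real (cos (2 * pi * x $ i)))"
proof -
  have "(\<Sum>j\<in>UNIV. of_int ((axis i k :: int^2) $ j) * x $ j) = of_int k * x $ i" for x :: "real^2" and k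
    using exhaust_2[of i] by (auto simp: sum_2 axis_def)
  then have "mode (axis i k) x = cis (- 2 * pi * (of_int k * x $ i))" for x k
    by (simp only: mode_def)
  then have "complex_of_real (cos (2 * pi * x $ i)) = 1/2 * mode (axis i 1) x + 1/2 * mode (axis i (-1)) x" for x
    by (simp add: complex_eq_iff)
  then show ?thesis
    using trig_poly_add[OF trig_poly_single[of "1/2" "axis i 1"] trig_poly_single[of "1/2" "axis i (-1)"]] by simp
qed

section \<open>Integrability on the cell and convolution with trigonometric polynomials\<close>

lemma set_integrable_dominated:
  fixes f :: "'a \<Rightarrow> 'b::{banach,second_countable_topology}" and g :: "'a \<Rightarrow> 'c::{banach,second_countable_topology}"
  assumes f: "set_integrable M A f" and g: "(\<lambda>x. indicator A x *\<^sub>R g x) \<in> borel_measurable M"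
    and le: "\<And>x. x \<in> A \<Longrightarrow> norm (g x) \<le> B * norm (f x)"
  shows "set_integrable M A g"
  unfolding set_integrable_def
proof (rule Bochner_Integration.integrable_bound[OF _ g])
  show "integrable M (\<lambda>x. B * norm (indicator A x *\<^sub>R f x))"
    using f unfolding set_integrable_def by (intro integrable_mult_right integrable_norm)
  show "AE x in M. norm (indicat_real A x *\<^sub>R g x) \<le> norm (B * norm (indicator A x *\<^sub>R f x))"
  proof (rule AE_I2)
    fix x
    show "norm (indicat_real A x *\<^sub>R g x) \<le> norm (B * norm (indicator A x *\<^sub>R f x))"
      using le[of x] abs_ge_self[of "B * norm (f x)"] by (auto simp: indicator_def)
  qed
qed

lemma borel_measurable_vec_nth [measurable (raw)]:
  fixes f :: "'a \<Rightarrow> real^2"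
  shows "f \<in> borel_measurable M \<Longrightarrow> (\<lambda>x. f x $ j) \<in> borel_measurable M"
  by (rule measurable_compose[OF _ borel_measurable_continuous_onI]) (auto intro!: continuous_intros)

lemma set_integrable_cell_const: "set_integrable lborel torus_cell (\<lambda>x. c :: real)"
  unfolding set_integrable_def using emeasure_torus_cell
  by (intro integrable_scaleR_left integrable_real_indicator) auto

text \<open>The cell has finite measure and
  \<open>norm (f x) \<le> 1 + (norm (f x))\<^sup>2\<close>.\<close>

lemma L2x_set_integrable:
  assumes "f \<in> L2x"
  shows "set_integrable lborel torus_cell f"
  unfolding set_integrable_def
proof (rule Bochner_Integration.integrable_bound)
  note [measurable] = L2x_borel[OF assms]
  have "integrable lborel (indicator torus_cell :: real^2 \<Rightarrow> real)"
    using emeasure_torus_cell by (intro integrable_real_indicator) auto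
  moreover have "integrable lborel (\<lambda>x. indicator torus_cell x *\<^sub>R (norm (f x))\<^sup>2)"
    using assms by (simp add: L2x_def set_integrable_def)
  ultimately show "integrable lborel (\<lambda>x. indicator torus_cell x + indicator torus_cell x *\<^sub>R (norm (f x))\<^sup>2 :: real)"
    by (rule Bochner_Integration.integrable_add)
  show "(\<lambda>x. indicat_real torus_cell x *\<^sub>R f x) \<in> borel_measurable lborel" by measurable
  have "norm (f x) \<le> 1 + (norm (f x))\<^sup>2" for x
    using sum_squares_bound[of "norm (f x)" 1] norm_ge_zero[of "f x"] by (simp del: norm_ge_zero)
  then show "AE x in lborel. norm (indicat_real torus_cell x *\<^sub>R f x) \<le>
      norm (indicator torus_cell x + indicator torus_cell x *\<^sub>R (norm (f x))\<^sup>2 :: real)"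
    by (intro AE_I2) (auto simp: indicator_def)
qed

lemma L2x_component_integrable:
  assumes "f \<in> L2x"
  shows "set_integrable lborel torus_cell (\<lambda>x. complex_of_real (f x $ j))"
proof -
  have "integrable lborel (\<lambda>x. (indicator torus_cell x *\<^sub>R f x) $ j)"
    using L2x_set_integrable[OF assms] unfolding set_integrable_def
    by (rule integrable_bounded_linear[OF bounded_linear_vec_nth])
  then have "integrable lborel (\<lambda>x. complex_of_real ((indicator torus_cell x *\<^sub>R f x) $ j))"
    by (rule integrable_of_real)
  also have "(\<lambda>x. complex_of_real ((indicator torus_cell x *\<^sub>R f x) $ j)) =
      (\<lambda>x. indicator torus_cell x *\<^sub>R complex_of_real (f x $ j))"
    by (auto simp: indicator_def)
  finally show ?thesis by (simp add: set_integrable_def)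
qed

lemma L2x_mode_integrable:
  assumes "f \<in> L2x"
  shows "set_integrable lborel torus_cell (\<lambda>y. mode n y * complex_of_real (f y $ j))"
proof (rule set_integrable_dominated[where B=1, OF L2x_component_integrable[OF assms, of j]])
  note [measurable] = L2x_borel[OF assms]
  show "(\<lambda>y. indicat_real torus_cell y *\<^sub>R (mode n y * complex_of_real (f y $ j))) \<in> borel_measurable lborel"
    by measurable
qed (simp add: norm_mult)

lemma trig_poly_measurable: "trig_poly K \<Longrightarrow> K \<in> borel_measurable borel"
  by (intro borel_measurable_continuous_onI trig_poly_continuous)

lemma trig_poly_shift_mult_integrable:
  assumes "trig_poly K" "f \<in> L2x"
  shows "set_integrable lborel torus_cell (\<lambda>y. K (y - x) * complex_of_real (f y $ j))"
proof -
  note [measurable] = trig_poly_measurable[OF assms(1)] L2x_borel[OF assms(2)]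
  obtain B where "\<forall>x. norm (K x) \<le> B" using trig_poly_bounded[OF assms(1)] by blast
  then show ?thesis
  proof (intro set_integrable_dominated[where B=B, OF L2x_component_integrable[OF assms(2), of j]])
    show "(\<lambda>y. indicat_real torus_cell y *\<^sub>R (K (y - x) * complex_of_real (f y $ j))) \<in> borel_measurable lborel"
      by measurable
  qed (auto simp: norm_mult intro!: mult_right_mono)
qed

text \<open>By \<open>mode_add\<close>, \<open>mode n (y - x)\<close> is \<open>mode n y\<close>
  times a number of modulus one depending on x, so convolution with a single mode has the size of
  one Fourier coefficient, at every x. The set F and the constant B come from the kernel
  alone.\<close>

lemma trig_poly_convolution_bound:
  assumes "trig_poly K"
  shows "\<exists>F B. finite F \<and> 0 \<le> B \<and> (\<forall>f\<in>L2x. \<forall>x j.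
    norm (LINT y:torus_cell|lborel. K (y - x) * complex_of_real (f y $ j)) \<le> B * (\<Sum>n\<in>F. norm (fourier_coeff f n)))"
  using assms
proof (induction rule: trig_poly.induct)
  case trig_poly_0
  show ?case by (intro exI[of _ "{}"] exI[of _ 0]) (simp add: set_lebesgue_integral_def)
next
  case (trig_poly_step K c n)
  then obtain F B where F: "finite F" and B: "0 \<le> B" and FB: "\<And>f x j. f \<in> L2x \<Longrightarrow>
      norm (LINT y:torus_cell|lborel. K (y - x) * complex_of_real (f y $ j)) \<le> B * (\<Sum>n\<in>F. norm (fourier_coeff f n))"
    by blast
  let ?G = "insert n F"
  have "norm (LINT y:torus_cell|lborel. (c * mode n (y - x) + K (y - x)) * complex_of_real (f y $ j)) \<le>
      (norm c + B) * (\<Sum>m\<in>?G. norm (fourier_coeff f m))" if f: "f \<in> L2x" for f x j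
  proof -
    let ?S = "\<Sum>m\<in>?G. norm (fourier_coeff f m)"
    have "(LINT y:torus_cell|lborel. (c * mode n (y - x) + K (y - x)) * complex_of_real (f y $ j)) =
        (LINT y:torus_cell|lborel. (c * mode n (- x)) * (mode n y * complex_of_real (f y $ j)) + K (y - x) * complex_of_real (f y $ j))"
      using mode_add[of n _ "- x"] by (simp add: algebra_simps)
    also have "\<dots> = (c * mode n (- x)) * (LINT y:torus_cell|lborel. mode n y * complex_of_real (f y $ j)) +
        (LINT y:torus_cell|lborel. K (y - x) * complex_of_real (f y $ j))"
      using L2x_mode_integrable[OF f] trig_poly_shift_mult_integrable[OF trig_poly_step.hyps f]
      by (subst set_integral_add) (auto simp: set_integral_mult_right)
    also have "(LINT y:torus_cell|lborel. mode n y * complex_of_real (f y $ j)) = fourier_coeff f n $ j"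
      by (simp add: fourier_coeff_def mode_def)
    finally have "norm (LINT y:torus_cell|lborel. (c * mode n (y - x) + K (y - x)) * complex_of_real (f y $ j)) \<le>
        norm ((c * mode n (- x)) * fourier_coeff f n $ j) + norm (LINT y:torus_cell|lborel. K (y - x) * complex_of_real (f y $ j))"
      by (simp only: norm_triangle_ineq)
    also have "norm ((c * mode n (- x)) * fourier_coeff f n $ j) \<le> norm c * ?S"
    proof -
      have "norm (fourier_coeff f n $ j) \<le> norm (fourier_coeff f n)" by (rule Finite_Cartesian_Product.norm_nth_le)
      also have "\<dots> \<le> ?S" using F by (intro member_le_sum) auto
      finally show ?thesis by (simp add: norm_mult mult_left_mono)
    qed
    also have "norm (LINT y:torus_cell|lborel. K (y - x) * complex_of_real (f y $ j)) \<le> B * ?S"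
    proof -
      have "(\<Sum>m\<in>F. norm (fourier_coeff f m)) \<le> ?S" using F by (intro sum_mono2) auto
      then show ?thesis using FB[OF f, of x j] B by (meson mult_left_mono order_trans)
    qed
    finally show ?thesis by (simp add: distrib_right)
  qed
  then show ?case using F B by (intro exI[of _ ?G] exI[of _ "norm c + B"]) auto
qed

text \<open>Jensen's inequality for the square and a probability density, by expanding the
  nonnegative integral of K times the squared deviation from the mean \<open>a\<close>.\<close>

lemma norm_integral_sq_le:
  fixes \<psi> :: "'a \<Rightarrow> real"
  assumes K: "\<And>y. 0 \<le> K y" "set_integrable M A K" "(LINT y:A|M. K y) = 1"
    and 1: "set_integrable M A (\<lambda>y. K y * \<psi> y)" and 2: "set_integrable M A (\<lambda>y. K y * (\<psi> y)\<^sup>2)"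
  shows "(LINT y:A|M. K y * \<psi> y)\<^sup>2 \<le> (LINT y:A|M. K y * (\<psi> y)\<^sup>2)"
proof -
  define a where "a = (LINT y:A|M. K y * \<psi> y)"
  have "0 \<le> (LINT y:A|M. K y * (\<psi> y - a)\<^sup>2)"
    unfolding set_lebesgue_integral_def using K(1) by (intro integral_nonneg_AE) auto
  also have "(LINT y:A|M. K y * (\<psi> y - a)\<^sup>2) = (LINT y:A|M. K y * (\<psi> y)\<^sup>2 - 2 * a * (K y * \<psi> y) + a\<^sup>2 * K y)"
    by (simp add: power2_diff algebra_simps)
  also have "\<dots> = (LINT y:A|M. K y * (\<psi> y)\<^sup>2) - 2 * a * a + a\<^sup>2 * 1"
    using K(2) 1 2 by (simp add: set_integral_add set_integral_diff set_integral_mult_right a_def K(3))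
  finally show ?thesis by (simp add: a_def power2_eq_square)
qed

text \<open>Since the kernel has mass one, f x is the convolved field at x minus the average of f y
  - f x. The squared triangle inequality separates the two, Jensen's inequality moves the square
  inside the average, and periodicity recentres the integral at x.\<close>

lemma kernel_pointwise_estimate:
  fixes K :: "real^2 \<Rightarrow> real"
  assumes K: "continuous_on UNIV K" "periodic K" "\<And>x. 0 \<le> K x" "\<And>x. K x \<le> B"
    and K1: "(\<integral>\<^sup>+h\<in>torus_cell. ennreal (K h) \<partial>lborel) = 1" and f: "f \<in> L2x"
  shows "ennreal ((norm (f x))\<^sup>2) \<le> 2 * (\<integral>\<^sup>+h\<in>torus_cell. ennreal (K h) * ennreal ((norm (f (x + h) - f x))\<^sup>2) \<partial>lborel)
    + 2 * ennreal ((norm (LINT y:torus_cell|lborel. K (y - x) *\<^sub>R f y))\<^sup>2)"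
proof -
  note [measurable] = L2x_borel[OF f]
  have [measurable]: "K \<in> borel_measurable borel" using K(1) by (rule borel_measurable_continuous_onI)
  define k where "k y = K (y - x)" for y
  have [measurable]: "k \<in> borel_measurable borel" unfolding k_def by measurable
  have k: "0 \<le> k y" "k y \<le> B" for y using K by (auto simp: k_def)
  have kB: "norm (k y) \<le> B" "\<bar>k y\<bar> \<le> B" for y using k[of y] by simp_all
  have k_int: "set_integrable lborel torus_cell k"
    using kB by (intro set_integrable_dominated[where B=B, OF set_integrable_cell_const[of 1]]) auto
  have "(\<integral>\<^sup>+y\<in>torus_cell. ennreal (k y) \<partial>lborel) = 1"
    using nn_integral_cell_shift[of "\<lambda>y. ennreal (K y)" "- x"] K(2) K1 by (simp add: k_def periodic_def)
  moreover have "(LINT y:torus_cell|lborel. k y) = enn2real (\<integral>\<^sup>+y\<in>torus_cell. ennreal (k y) \<partial>lborel)"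
    unfolding set_lebesgue_integral_def using k
    by (subst integral_eq_nn_integral) (auto intro!: arg_cong[where f=enn2real] nn_integral_cong simp: indicator_def)
  ultimately have k1: "(LINT y:torus_cell|lborel. k y) = 1" by simp
  have const: "(\<lambda>y. c) \<in> L2x" for c :: "real^2"
    using emeasure_torus_cell by (simp add: L2x_iff_sq_int periodic_def sq_int_def nn_integral_cmult ennreal_mult_less_top)
  have f_diff: "(\<lambda>y. f y - f x) \<in> L2x" by (intro L2x_diff f const)
  have int_f: "set_integrable lborel torus_cell (\<lambda>y. k y *\<^sub>R f y)"
    using kB by (intro set_integrable_dominated[where B=B, OF L2x_set_integrable[OF f]]) (auto intro!: mult_right_mono)
  have int_c: "set_integrable lborel torus_cell (\<lambda>y. k y *\<^sub>R f x)"
    using integrable_scaleR_left[of "f x" lborel "\<lambda>y. indicator torus_cell y *\<^sub>R k y"] k_int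
    by (simp add: set_integrable_def)
  have int_1: "set_integrable lborel torus_cell (\<lambda>y. k y * norm (f y - f x))"
  proof (intro set_integrable_dominated[where B=B, OF L2x_set_integrable[OF f_diff]])
    show "norm (k y * norm (f y - f x)) \<le> B * norm (f y - f x)" for y
      using kB(2)[of y] by (simp add: abs_mult mult_right_mono)
  qed measurable
  have int_2: "set_integrable lborel torus_cell (\<lambda>y. k y * (norm (f y - f x))\<^sup>2)"
  proof (rule set_integrable_dominated[where B=B])
    show "set_integrable lborel torus_cell (\<lambda>y. (norm (f y - f x))\<^sup>2)" using f_diff by (simp add: L2x_def)
    show "norm (k y * (norm (f y - f x))\<^sup>2) \<le> B * norm ((norm (f y - f x))\<^sup>2)" for y
      using kB(2)[of y] by (simp add: abs_mult mult_right_mono)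
  qed measurable
  let ?I = "LINT y:torus_cell|lborel. k y *\<^sub>R f y"
  let ?J = "LINT y:torus_cell|lborel. k y *\<^sub>R (f y - f x)"
  have "(LINT y:torus_cell|lborel. k y *\<^sub>R f x) = (LINT y:torus_cell|lborel. k y) *\<^sub>R f x"
    unfolding set_lebesgue_integral_def using k_int
    by (subst integral_scaleR_left[symmetric]) (auto simp: set_integrable_def)
  then have "?J = ?I - f x"
    using int_f int_c by (simp add: scaleR_diff_right set_integral_diff k1)
  then have "(norm (f x))\<^sup>2 \<le> 2 * (norm ?I)\<^sup>2 + 2 * (norm ?J)\<^sup>2"
    using norm_diff_sq_le[of ?I ?J] by simp
  moreover have "(norm ?J)\<^sup>2 \<le> (LINT y:torus_cell|lborel. k y * (norm (f y - f x))\<^sup>2)"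
  proof -
    have "norm ?J \<le> (LINT y:torus_cell|lborel. k y * norm (f y - f x))"
    proof -
      have "norm ?J \<le> (LINT y|lborel. norm (indicator torus_cell y *\<^sub>R k y *\<^sub>R (f y - f x)))"
        unfolding set_lebesgue_integral_def by (rule integral_norm_bound)
      also have "\<dots> = (LINT y:torus_cell|lborel. k y * norm (f y - f x))"
        unfolding set_lebesgue_integral_def using k by (simp add: abs_mult mult.assoc)
      finally show ?thesis .
    qed
    then have "(norm ?J)\<^sup>2 \<le> (LINT y:torus_cell|lborel. k y * norm (f y - f x))\<^sup>2"
      by (intro power_mono) auto
    also have "\<dots> \<le> (LINT y:torus_cell|lborel. k y * (norm (f y - f x))\<^sup>2)"
      by (rule norm_integral_sq_le[OF k(1) k_int k1 int_1 int_2])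
    finally show ?thesis .
  qed
  ultimately have "(norm (f x))\<^sup>2 \<le> 2 * (LINT y:torus_cell|lborel. k y * (norm (f y - f x))\<^sup>2) + 2 * (norm ?I)\<^sup>2"
    by linarith
  then have "ennreal ((norm (f x))\<^sup>2) \<le> ennreal (2 * (LINT y:torus_cell|lborel. k y * (norm (f y - f x))\<^sup>2) + 2 * (norm ?I)\<^sup>2)"
    by (rule ennreal_leI)
  also have "\<dots> = 2 * ennreal (LINT y:torus_cell|lborel. k y * (norm (f y - f x))\<^sup>2) + 2 * ennreal ((norm ?I)\<^sup>2)"
    using k by (intro ennreal_double_add[symmetric]) (auto simp: set_lebesgue_integral_def intro!: integral_nonneg_AE)
  also have "ennreal (LINT y:torus_cell|lborel. k y * (norm (f y - f x))\<^sup>2) =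
      (\<integral>\<^sup>+y. ennreal (indicator torus_cell y *\<^sub>R (k y * (norm (f y - f x))\<^sup>2)) \<partial>lborel)"
    unfolding set_lebesgue_integral_def using int_2 k
    by (intro nn_integral_eq_integral[symmetric]) (auto simp: set_integrable_def)
  also have "\<dots> = (\<integral>\<^sup>+y\<in>torus_cell. ennreal (k y) * ennreal ((norm (f y - f x))\<^sup>2) \<partial>lborel)"
    using k by (intro nn_integral_cong) (auto simp: indicator_def ennreal_mult)
  also have "\<dots> = (\<integral>\<^sup>+h\<in>torus_cell. ennreal (k (h + x)) * ennreal ((norm (f (h + x) - f x))\<^sup>2) \<partial>lborel)"
  proof (rule nn_integral_cell_shift[symmetric])
    have "k (y + axis i 1) = k y" for y i
      using K(2)[unfolded periodic_def, rule_format, of "y - x" i] by (simp add: k_def algebra_simps)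
    then show "periodic (\<lambda>y. ennreal (k y) * ennreal ((norm (f y - f x))\<^sup>2))"
      using L2x_periodic[OF f] by (simp add: periodic_def)
  qed measurable
  finally show ?thesis by (simp add: k_def add.commute)
qed

section \<open>Control of a field by averaged shifts and finitely many coefficients\<close>

abbreviation (input) kernel_average :: "(real^2 \<Rightarrow> real) \<Rightarrow> (real^2 \<Rightarrow> ennreal) \<Rightarrow> ennreal" where
  "kernel_average K E \<equiv> (\<integral>\<^sup>+h\<in>torus_cell. ennreal (K h) * E h \<partial>lborel)"

text \<open>The pivotal inequality: F and B are the same for all fields, so it can be applied to
  differences. The factor 4 combines the 2 of the pointwise estimate with the two components of the
  convolved field.\<close>

lemma sq_int_kernel_estimate:
  fixes K :: "real^2 \<Rightarrow> real"
  assumes trig: "trig_poly (\<lambda>x. complex_of_real (K x))" and K: "\<And>x. 0 \<le> K x"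
    and K1: "(\<integral>\<^sup>+h\<in>torus_cell. ennreal (K h) \<partial>lborel) = 1"
  shows "\<exists>F B. finite F \<and> 0 \<le> B \<and> (\<forall>f\<in>L2x. sq_int f \<le>
    2 * kernel_average K (shift_diff f) +
    ennreal (4 * (B * (\<Sum>n\<in>F. norm (fourier_coeff f n)))\<^sup>2))"
proof -
  obtain F B where F: "finite F" and B: "0 \<le> B" and FB: "\<And>f x j. f \<in> L2x \<Longrightarrow>
      norm (LINT y:torus_cell|lborel. complex_of_real (K (y - x)) * complex_of_real (f y $ j)) \<le> B * (\<Sum>n\<in>F. norm (fourier_coeff f n))"
    using trig_poly_convolution_bound[OF trig] by blast
  obtain C where C: "\<And>x. \<bar>K x\<bar> \<le> C" using trig_poly_bounded[OF trig] by auto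
  have "continuous_on UNIV (\<lambda>x. Re (complex_of_real (K x)))"
    by (intro continuous_on_Re trig_poly_continuous trig)
  then have K_cont: "continuous_on UNIV K" by simp
  have K_per: "periodic K" using trig_poly_periodic[OF trig] by (simp add: periodic_def)
  have K_le: "K x \<le> C" for x using C[of x] by linarith
  have [measurable]: "K \<in> borel_measurable borel" using K_cont by (rule borel_measurable_continuous_onI)
  have "sq_int f \<le> 2 * kernel_average K (shift_diff f) +
    ennreal (4 * (B * (\<Sum>n\<in>F. norm (fourier_coeff f n)))\<^sup>2)" if f: "f \<in> L2x" for f
  proof -
    note [measurable] = L2x_borel[OF f]
    let ?S = "B * (\<Sum>n\<in>F. norm (fourier_coeff f n))"
    let ?I = "\<lambda>x. LINT y:torus_cell|lborel. K (y - x) *\<^sub>R f y"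
    have I_le: "(norm (?I x))\<^sup>2 \<le> 2 * ?S\<^sup>2" for x
    proof -
      have int: "set_integrable lborel torus_cell (\<lambda>y. K (y - x) *\<^sub>R f y)"
        using C by (intro set_integrable_dominated[where B=C, OF L2x_set_integrable[OF f]]) (auto intro!: mult_right_mono)
      have "\<bar>?I x $ j\<bar> \<le> ?S" for j
      proof -
        have "?I x $ j = (LINT y|lborel. (indicator torus_cell y *\<^sub>R K (y - x) *\<^sub>R f y) $ j)"
          unfolding set_lebesgue_integral_def using int
          by (intro integral_bounded_linear[OF bounded_linear_vec_nth, symmetric]) (simp add: set_integrable_def)
        then have "complex_of_real (?I x $ j) = (LINT y|lborel. complex_of_real ((indicator torus_cell y *\<^sub>R K (y - x) *\<^sub>R f y) $ j))"
          by (simp only: integral_complex_of_real)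
        also have "\<dots> = (LINT y:torus_cell|lborel. complex_of_real (K (y - x)) * complex_of_real (f y $ j))"
          unfolding set_lebesgue_integral_def by (intro Bochner_Integration.integral_cong) (auto simp: indicator_def)
        finally have eq: "complex_of_real (?I x $ j) =
            (LINT y:torus_cell|lborel. complex_of_real (K (y - x)) * complex_of_real (f y $ j))" .
        have "norm (complex_of_real (?I x $ j)) \<le> ?S"
          unfolding eq by (rule FB[OF f])
        then show ?thesis by (simp only: norm_of_real)
      qed
      then have "(?I x $ j)\<^sup>2 \<le> ?S\<^sup>2" for j by (meson abs_le_square_iff abs_ge_self order_trans)
      then have "(\<Sum>j\<in>UNIV. (?I x $ j)\<^sup>2) \<le> (\<Sum>j\<in>(UNIV::2 set). ?S\<^sup>2)" by (intro sum_mono) auto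
      also have "(\<Sum>j\<in>UNIV. (?I x $ j)\<^sup>2) = (norm (?I x))\<^sup>2"
        unfolding power2_norm_eq_inner inner_vec_def by (simp add: power2_eq_square)
      finally show ?thesis by simp
    qed
    let ?g = "\<lambda>h x. ennreal (K h) * ennreal ((norm (f (x + h) - f x))\<^sup>2) * indicator torus_cell h * indicator torus_cell x"
    have "sq_int f \<le> (\<integral>\<^sup>+x. 2 * (\<integral>\<^sup>+h. ?g h x \<partial>lborel)
        + ennreal (4 * ?S\<^sup>2) * indicator torus_cell x \<partial>lborel)"
      unfolding sq_int_def
    proof (intro nn_integral_mono)
      fix x
      have "2 * ennreal ((norm (?I x))\<^sup>2) \<le> 2 * ennreal (2 * ?S\<^sup>2)" by (intro mult_left_mono ennreal_leI I_le) auto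
      also have "\<dots> = ennreal (2 * (2 * ?S\<^sup>2))" by (subst ennreal_mult) auto
      also have "\<dots> = ennreal (4 * ?S\<^sup>2)" by simp
      finally have "2 * ennreal ((norm (?I x))\<^sup>2) \<le> ennreal (4 * ?S\<^sup>2)" .
      with kernel_pointwise_estimate[OF K_cont K_per K K_le K1 f, of x]
      have "ennreal ((norm (f x))\<^sup>2) \<le> 2 * (\<integral>\<^sup>+h\<in>torus_cell. ennreal (K h) * ennreal ((norm (f (x + h) - f x))\<^sup>2) \<partial>lborel) + ennreal (4 * ?S\<^sup>2)"
        by (meson add_left_mono order_trans)
      then show "ennreal ((norm (f x))\<^sup>2) * indicator torus_cell x \<le>
          2 * (\<integral>\<^sup>+h. ?g h x \<partial>lborel)
          + ennreal (4 * ?S\<^sup>2) * indicator torus_cell x"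
        by (cases "x \<in> torus_cell") auto
    qed
    also have "\<dots> = 2 * (\<integral>\<^sup>+x. (\<integral>\<^sup>+h. ?g h x \<partial>lborel) \<partial>lborel)
        + ennreal (4 * ?S\<^sup>2)"
      by (subst nn_integral_add) (auto simp: nn_integral_cmult emeasure_torus_cell)
    also have "(\<integral>\<^sup>+x. (\<integral>\<^sup>+h. ?g h x \<partial>lborel) \<partial>lborel) =
        (\<integral>\<^sup>+h. (\<integral>\<^sup>+x. ?g h x \<partial>lborel) \<partial>lborel)"
      by (rule lborel_pair.Fubini') measurable
    also have "\<dots> = kernel_average K (shift_diff f)"
    proof (intro nn_integral_cong)
      fix h
      have "(\<integral>\<^sup>+x. ?g h x \<partial>lborel) =
          (\<integral>\<^sup>+x. (ennreal (K h) * indicator torus_cell h) * (ennreal ((norm (f (x + h) - f x))\<^sup>2) * indicator torus_cell x) \<partial>lborel)"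
        by (intro nn_integral_cong) (simp add: mult_ac)
      also have "\<dots> = (ennreal (K h) * indicator torus_cell h) * shift_diff f h"
        unfolding shift_diff_def sq_int_def by (rule nn_integral_cmult) measurable
      finally show "(\<integral>\<^sup>+x. ?g h x \<partial>lborel) =
          ennreal (K h) * shift_diff f h * indicator torus_cell h"
        by (simp add: mult_ac)
    qed
    finally show ?thesis .
  qed
  then show ?thesis using F B by blast
qed

text \<open>The function \<open>w\<close> is 1 exactly on the lattice and smaller elsewhere. By
  compactness it stays below some b < 1 far from the lattice, while it exceeds some a > b on a small
  square Q at the origin. The normalised power of order N is then at most \<open>(b / a) ^ N\<close>
  divided by the area of Q in the far region.\<close>

lemma trig_kernel:
  assumes \<delta>: "0 < \<delta>" and \<eta>: "0 < \<eta>"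
  shows "\<exists>K. trig_poly (\<lambda>x. complex_of_real (K x)) \<and> (\<forall>x. 0 \<le> K x) \<and>
    (\<integral>\<^sup>+h\<in>torus_cell. ennreal (K h) \<partial>lborel) = 1 \<and>
    (\<integral>\<^sup>+h\<in>torus_cell \<inter> {h. \<forall>m. \<delta> \<le> norm (h - lattice m)}. ennreal (K h) \<partial>lborel) \<le> ennreal \<eta>"
proof -
  let ?far = "{h :: real^2. \<forall>m. \<delta> \<le> norm (h - lattice m)}"
  define w where "w h = (2 + cos (2 * pi * h $ 1) + cos (2 * pi * h $ 2)) / 4" for h :: "real^2"
  have w_trig: "trig_poly (\<lambda>x. complex_of_real (w x))"
  proof -
    have "trig_poly (\<lambda>x. 1/4 * ((2 + complex_of_real (cos (2 * pi * x $ 1))) + complex_of_real (cos (2 * pi * x $ 2))))"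
      by (intro trig_poly_mult trig_poly_add trig_poly_const trig_poly_cos)
    then show ?thesis by (simp add: w_def)
  qed
  have w_cont: "continuous_on A w" for A
    unfolding w_def by (intro continuous_intros) auto
  have [measurable]: "w \<in> borel_measurable borel"
    by (rule borel_measurable_continuous_onI[OF w_cont])
  have average: "0 \<le> (2 + a + b) / 4" "(2 + a + b) / 4 \<le> 1" "\<not> (2 + a + b) / 4 < 1 \<Longrightarrow> a = 1 \<and> b = 1"
    if "-1 \<le> a" "a \<le> 1" "-1 \<le> b" "b \<le> 1" for a b :: real
    using that by auto
  have w_nonneg: "0 \<le> w h" and w_le_1: "w h \<le> 1" for h
    unfolding w_def by (intro average cos_ge_minus_one cos_le_one)+
  note w_range = w_nonneg w_le_1
  have w_lt_1: "w h < 1" if "h \<in> ?far" for h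
  proof (rule ccontr)
    assume "\<not> w h < 1"
    then have "cos (2 * pi * h $ 1) = 1 \<and> cos (2 * pi * h $ 2) = 1"
      unfolding w_def by (intro average cos_ge_minus_one cos_le_one)
    then have "\<exists>k :: int. h $ i = of_int k" for i
      using exhaust_2[of i] by (auto simp: cos_one_2pi_int)
    then obtain k :: "2 \<Rightarrow> int" where "\<And>i. h $ i = of_int (k i)" by metis
    then have "h = lattice (\<chi> i. k i)" by (simp add: lattice_def vec_eq_iff)
    then have "norm (h - lattice (\<chi> i. k i)) = 0" by simp
    then show False using that \<delta> by (metis (mono_tags, lifting) mem_Collect_eq not_le)
  qed
  have far_closed: "closed ?far"
    by (intro closed_Collect_all closed_Collect_le continuous_intros)
  then have [measurable]: "?far \<in> sets borel" by (rule borel_closed)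
  \<comment> \<open>For large \<delta> no point of the cell is far from the lattice, and b = 0
    serves.\<close>
  have "\<exists>b. 0 \<le> b \<and> b < 1 \<and> (\<forall>h\<in>torus_cell \<inter> ?far. w h \<le> b)"
  proof (cases "torus_cell \<inter> ?far = {}")
    case False
    then obtain h where h: "h \<in> torus_cell \<inter> ?far" "\<forall>y\<in>torus_cell \<inter> ?far. w y \<le> w h"
      using continuous_attains_sup[of "torus_cell \<inter> ?far" w] w_cont far_closed by (auto simp: compact_Int_closed)
    then show ?thesis using w_lt_1[of h] w_range(1)[of h] by blast
  qed (auto intro: exI[of _ 0])
  then obtain b where b: "0 \<le> b" "b < 1" "\<And>h. h \<in> torus_cell \<inter> ?far \<Longrightarrow> w h \<le> b" by blast
  \<comment> \<open>Any value strictly between b and 1 would do: below 1 it is exceeded near the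
    origin, and above b it makes b / a smaller than 1.\<close>
  define a where "a = (1 + b) / 2"
  have a: "b < a" "a < 1" "0 < a" using b by (auto simp: a_def)
  have "w 0 = 1" by (simp add: w_def)
  have "(w \<longlongrightarrow> w 0) (at 0)" using w_cont[of UNIV] by (simp add: continuous_on_def)
  then have "\<forall>\<^sub>F h in at 0. a < w h"
    by (rule order_tendstoD(1)) (use a(2) \<open>w 0 = 1\<close> in simp)
  then obtain \<rho> where \<rho>: "0 < \<rho>" "\<And>h. norm h < \<rho> \<Longrightarrow> h \<noteq> 0 \<Longrightarrow> a < w h"
    by (auto simp: eventually_at)
  have \<rho>_w: "a \<le> w h" if "norm h < \<rho>" for h
    using \<rho>(2)[OF that] a(2) \<open>w 0 = 1\<close> by (cases "h = 0") auto
  \<comment> \<open>A point of the square with side s has norm at most s + s, hence below \<rho>;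
    the cap 1 keeps the square inside the cell.\<close>
  define s where "s = min 1 (\<rho> / 4)"
  have s: "0 < s" "s \<le> 1" "s \<le> \<rho> / 4" using \<rho> by (auto simp: s_def)
  define Q :: "(real^2) set" where "Q = cbox 0 (\<chi> i. s)"
  have Q: "Q \<subseteq> torus_cell" "\<And>h. h \<in> Q \<Longrightarrow> norm h < \<rho>"
  proof -
    show "Q \<subseteq> torus_cell" using order_trans[OF _ s(2)] by (auto simp: Q_def mem_box_cart)
    fix h assume "h \<in> Q"
    then have h: "0 \<le> h $ i" "h $ i \<le> s" for i by (auto simp: Q_def mem_box_cart)
    have "norm h \<le> (\<Sum>i\<in>UNIV. \<bar>h $ i\<bar>)" by (rule norm_le_l1_cart)
    also have "\<dots> \<le> s + s" using h[of 1] h[of 2] by (simp add: sum_2)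
    finally show "norm h < \<rho>" using s \<rho>(1) by linarith
  qed
  have Q_meas: "emeasure lborel Q = ennreal (measure lborel Q)"
    using emeasure_lborel_cbox_finite[of "0 :: real^2" "\<chi> i. s"]
    unfolding Q_def by (intro emeasure_eq_ennreal_measure) auto
  have Q_box: "box 0 (\<chi> i. s) \<noteq> ({} :: (real^2) set)"
    using s by (simp add: box_ne_empty Basis_vec_def inner_axis)
  have Q_pos: "0 < measure lborel Q"
    unfolding Q_def using Q_box content_pos_lt_eq[of "0 :: real^2" "\<chi> i. s"] by (simp add: box_ne_empty)
  define c where "c = measure lborel Q"
  have "(\<lambda>N. (b / a) ^ N / c) \<longlonglongrightarrow> 0"
    using a b by (intro tendsto_divide_zero LIMSEQ_realpow_zero) auto
  then have "\<forall>\<^sub>F N in sequentially. (b / a) ^ N / c < \<eta>" using \<eta> by (rule order_tendstoD(2))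
  then obtain N where N: "(b / a) ^ N / c < \<eta>" by (auto simp: eventually_sequentially)
  define I where "I = (\<integral>\<^sup>+h\<in>torus_cell. ennreal (w h ^ N) \<partial>lborel)"
  have I_le: "I \<le> 1"
  proof -
    have "I \<le> (\<integral>\<^sup>+h. indicator torus_cell h \<partial>lborel)"
      unfolding I_def using w_range by (intro nn_integral_mono) (auto simp: indicator_def power_le_one)
    then show ?thesis by (simp add: emeasure_torus_cell)
  qed
  have I_ge: "ennreal (a ^ N * c) \<le> I"
  proof -
    have "ennreal (a ^ N * c) = ennreal (a ^ N) * emeasure lborel Q"
      using a by (simp add: Q_meas c_def ennreal_mult)
    also have "\<dots> = (\<integral>\<^sup>+h. ennreal (a ^ N) * indicator Q h \<partial>lborel)"
      by (intro nn_integral_cmult_indicator[symmetric]) (simp add: Q_def)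
    also have "\<dots> \<le> I"
      unfolding I_def using Q \<rho>_w a by (intro nn_integral_mono) (auto simp: indicator_def intro!: ennreal_leI power_mono)
    finally show ?thesis .
  qed
  obtain W where W: "0 \<le> W" "I = ennreal W" using I_le by (cases I) (auto simp: top_unique)
  have W_ge: "a ^ N * c \<le> W" using I_ge W by simp
  have ac: "0 < a ^ N * c" using a Q_pos by (simp add: c_def)
  have W_pos: "0 < W" using W_ge ac by linarith
  define K where "K x = 1 / W * w x ^ N" for x
  have "trig_poly (\<lambda>x. complex_of_real (1 / W) * complex_of_real (w x) ^ N)"
    by (intro trig_poly_mult trig_poly_const trig_poly_power w_trig)
  then have K_trig: "trig_poly (\<lambda>x. complex_of_real (K x))" by (simp add: K_def)
  have K_nonneg: "0 \<le> K x" for x using W_pos w_range by (simp add: K_def)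
  have K_1: "(\<integral>\<^sup>+h\<in>torus_cell. ennreal (K h) \<partial>lborel) = 1"
  proof -
    have "(\<integral>\<^sup>+h\<in>torus_cell. ennreal (K h) \<partial>lborel) = (\<integral>\<^sup>+h. ennreal (1 / W) * (ennreal (w h ^ N) * indicator torus_cell h) \<partial>lborel)"
      unfolding K_def using W_pos w_range by (intro nn_integral_cong) (subst ennreal_mult, auto simp: mult.assoc)
    also have "\<dots> = ennreal (1 / W) * I"
      unfolding I_def by (rule nn_integral_cmult) measurable
    also have "\<dots> = ennreal (1 / W * W)" unfolding W(2) using W(1) by (intro ennreal_mult[symmetric]) auto
    finally show ?thesis using W_pos by simp
  qed
  have K_far: "(\<integral>\<^sup>+h\<in>torus_cell \<inter> ?far. ennreal (K h) \<partial>lborel) \<le> ennreal \<eta>"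
  proof -
    have K_le: "K h \<le> \<eta>" if "h \<in> torus_cell \<inter> ?far" for h
    proof -
      have "w h ^ N \<le> b ^ N" using b(3)[OF that] w_range by (intro power_mono) auto
      then have "K h \<le> b ^ N / W" using W_pos by (simp add: K_def divide_right_mono)
      also have "\<dots> \<le> b ^ N / (a ^ N * c)" using W_ge ac b by (intro divide_left_mono) auto
      also have "\<dots> = (b / a) ^ N / c" by (simp add: power_divide)
      finally show ?thesis using N by linarith
    qed
    have "(\<integral>\<^sup>+h\<in>torus_cell \<inter> ?far. ennreal (K h) \<partial>lborel) \<le> (\<integral>\<^sup>+h. ennreal \<eta> * indicator torus_cell h \<partial>lborel)"
      using K_le by (intro nn_integral_mono) (auto simp: indicator_def intro!: ennreal_leI)
    also have "\<dots> = ennreal \<eta>" by (subst nn_integral_cmult_indicator) (auto simp: emeasure_torus_cell)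
    finally show ?thesis .
  qed
  show ?thesis
    by (intro exI[of _ K] conjI allI K_trig K_nonneg K_1 K_far)
qed

text \<open>Mass near any lattice point, including the other corners of the cell, is moved to the
  origin by periodicity and meets the small values of E; the remaining mass \<eta> meets only the
  global bound C.\<close>

lemma kernel_average_le:
  fixes E :: "real^2 \<Rightarrow> ennreal"
  assumes [measurable]: "E \<in> borel_measurable borel" "K \<in> borel_measurable borel"
    and E: "periodic E" "\<And>h. norm h < \<delta> \<Longrightarrow> E h \<le> e" "\<And>h. E h \<le> C"
    and K: "(\<integral>\<^sup>+h\<in>torus_cell. ennreal (K h) \<partial>lborel) = 1"
      "(\<integral>\<^sup>+h\<in>torus_cell \<inter> {h. \<forall>m. \<delta> \<le> norm (h - lattice m)}. ennreal (K h) \<partial>lborel) \<le> \<eta>"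
  shows "kernel_average K E \<le> e + C * \<eta>"
proof -
  let ?far = "{h :: real^2. \<forall>m. \<delta> \<le> norm (h - lattice m)}"
  have "closed ?far" by (intro closed_Collect_all closed_Collect_le continuous_intros)
  then have [measurable]: "?far \<in> sets borel" by (rule borel_closed)
  have "kernel_average K E \<le>
    (\<integral>\<^sup>+h. e * (ennreal (K h) * indicator torus_cell h) + C * (ennreal (K h) * indicator (torus_cell \<inter> ?far) h) \<partial>lborel)"
  proof (intro nn_integral_mono)
    fix h
    show "ennreal (K h) * E h * indicator torus_cell h \<le>
      e * (ennreal (K h) * indicator torus_cell h) + C * (ennreal (K h) * indicator (torus_cell \<inter> ?far) h)"
    proof (cases "h \<in> ?far")
      case True
      have "ennreal (K h) * E h \<le> C * ennreal (K h)" using mult_left_mono[OF E(3), of "ennreal (K h)" h] by (simp add: mult.commute)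
      then have "ennreal (K h) * E h \<le> e * ennreal (K h) + C * ennreal (K h)" by (simp add: add_increasing)
      then show ?thesis using True by (cases "h \<in> torus_cell") auto
    next
      case False
      then obtain m where "norm (h - lattice m) < \<delta>" by (auto simp: not_le)
      then have "E (h - lattice m) \<le> e" by (rule E(2))
      moreover have "E (h - lattice m) = E h" using periodic_lattice[OF E(1), of "h - lattice m" m] by simp
      ultimately have "ennreal (K h) * E h \<le> e * ennreal (K h)" using mult_left_mono[of "E h" e "ennreal (K h)"] by (simp add: mult.commute)
      then show ?thesis using False by (cases "h \<in> torus_cell") auto
    qed
  qed
  also have "\<dots> = e * 1 + C * (\<integral>\<^sup>+h. ennreal (K h) * indicator (torus_cell \<inter> ?far) h \<partial>lborel)"
    by (simp add: nn_integral_add nn_integral_cmult K(1))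
  also have "\<dots> \<le> e + C * \<eta>" using K(2) by (simp add: mult_left_mono add_left_mono)
  finally show ?thesis .
qed

section \<open>Fourier coefficients and negative Sobolev norms\<close>

lemma fourier_coeff_diff:
  assumes "f \<in> L2x" "g \<in> L2x"
  shows "fourier_coeff (\<lambda>x. f x - g x) n = fourier_coeff f n - fourier_coeff g n"
proof -
  have "(LINT y:torus_cell|lborel. mode n y * complex_of_real ((f y - g y) $ j)) =
      (LINT y:torus_cell|lborel. mode n y * complex_of_real (f y $ j)) - (LINT y:torus_cell|lborel. mode n y * complex_of_real (g y $ j))" for j
    using assms[THEN L2x_mode_integrable] by (simp add: set_integral_diff right_diff_distrib)
  then show ?thesis by (simp add: fourier_coeff_def mode_def vec_eq_iff)
qed

lemma sobolev_weight_pos: "0 < sobolev_weight s n"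
proof -
  have "0 \<le> (\<Sum>i\<in>UNIV. (real_of_int (n $ i))\<^sup>2)" by (intro sum_nonneg) auto
  then show ?thesis by (simp add: sobolev_weight_def)
qed

text \<open>A single term of a sum of nonnegative terms. The loss depends on n, which is harmless as
  long as finitely many modes are involved.\<close>

lemma norm_fourier_coeff_le_Hs:
  assumes "in_Hs s f"
  shows "norm (fourier_coeff f n) \<le> Hs_norm s f / sqrt (sobolev_weight s n)"
proof -
  let ?g = "\<lambda>n. sobolev_weight s n * (norm (fourier_coeff f n))\<^sup>2"
  have "?g n = (\<Sum>m\<in>{n}. ?g m)" by simp
  also have "\<dots> \<le> infsum ?g UNIV"
    using assms sobolev_weight_pos by (intro finite_sum_le_infsum) (auto simp: in_Hs_def less_imp_le)
  finally have "sqrt (?g n) \<le> Hs_norm s f" by (simp add: Hs_norm_def)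
  then show ?thesis
    using sobolev_weight_pos[of s n] by (simp add: real_sqrt_mult pos_le_divide_eq mult.commute)
qed

text \<open>The infinite sum in \<open>Hs_norm\<close> defaults to 0 without summability, so a
  Lipschitz bound in this norm says something about coefficients only once the differences are known
  to lie in the space.\<close>

lemma in_Hs_diff:
  assumes "f \<in> L2x" "g \<in> L2x" "in_Hs s f" "in_Hs s g"
  shows "in_Hs s (\<lambda>x. f x - g x)"
  unfolding in_Hs_def
proof (rule summable_on_comparison_test)
  show "(\<lambda>n. 2 * (sobolev_weight s n * (norm (fourier_coeff f n))\<^sup>2) + 2 * (sobolev_weight s n * (norm (fourier_coeff g n))\<^sup>2)) summable_on UNIV"
    using assms(3,4) unfolding in_Hs_def by (intro summable_on_add summable_on_cmult_right)
  fix n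
  have "sobolev_weight s n * (norm (fourier_coeff f n - fourier_coeff g n))\<^sup>2 \<le>
      sobolev_weight s n * (2 * (norm (fourier_coeff f n))\<^sup>2 + 2 * (norm (fourier_coeff g n))\<^sup>2)"
    using sobolev_weight_pos[of s n] by (intro mult_left_mono norm_diff_sq_le) auto
  then show "sobolev_weight s n * (norm (fourier_coeff (\<lambda>x. f x - g x) n))\<^sup>2 \<le>
      2 * (sobolev_weight s n * (norm (fourier_coeff f n))\<^sup>2) + 2 * (sobolev_weight s n * (norm (fourier_coeff g n))\<^sup>2)"
    by (simp add: fourier_coeff_diff[OF assms(1,2)] algebra_simps)
  show "0 \<le> sobolev_weight s n * (norm (fourier_coeff (\<lambda>x. f x - g x) n))\<^sup>2"
    using sobolev_weight_pos[of s n] by simp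
qed

text \<open>Arzela-Ascoli as a pigeonhole argument: every member is recorded at finitely many times
  by points of a finite net in the target. Only finitely many records occur, and one index is kept
  for each. Members with equal records differ by at most \<rho> / 4 at the grid times, and moving
  each of them to a grid time costs another \<rho> / 4.\<close>

lemma finite_net_Lipschitz_family:
  fixes g :: "nat \<Rightarrow> 'i \<Rightarrow> real \<Rightarrow> 'b::euclidean_space"
  assumes T: "0 < T" and F: "finite F" and \<rho>: "0 < \<rho>" and C: "0 \<le> C"
    and bound: "\<And>k n t. n \<in> F \<Longrightarrow> t \<in> {0<..<T} \<Longrightarrow> norm (g k n t) \<le> C"
    and lipschitz: "\<And>k n s t. n \<in> F \<Longrightarrow> s \<in> {0<..<T} \<Longrightarrow> t \<in> {0<..<T} \<Longrightarrow> norm (g k n t - g k n s) \<le> C * \<bar>t - s\<bar>"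
  shows "\<exists>J. finite J \<and> (\<forall>k. \<exists>j\<in>J. \<forall>n\<in>F. \<forall>t\<in>{0<..<T}. norm (g k n t - g j n t) \<le> \<rho>)"
proof -
  obtain N :: nat where N: "0 < N" "C * T / real N \<le> \<rho> / 4"
  proof -
    obtain N :: nat where N: "4 * C * T / \<rho> < real N" using reals_Archimedean2 by blast
    have "0 \<le> 4 * C * T / \<rho>" using C T \<rho> by simp
    then have "0 < N" using N by (cases N) auto
    moreover have "C * T / real N \<le> \<rho> / 4"
      using N \<rho> \<open>0 < N\<close> by (simp add: field_simps)
    ultimately show ?thesis using that by blast
  qed
  \<comment> \<open>Midpoints of N equal subintervals: they lie in the open interval, where the
    hypotheses hold.\<close>
  define P where "P = (\<lambda>i. (real i + 1/2) * T / real N) ` {..<N}"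
  have P_sub: "P \<subseteq> {0<..<T}"
  proof -
    have "(real i + 1/2) * T / real N < T" if "i < N" for i
    proof -
      have "real i + 1/2 < real N" using that by linarith
      then have "(real i + 1/2) * T < real N * T" using T by simp
      then show ?thesis using N(1) by (simp add: divide_less_eq mult.commute)
    qed
    then show ?thesis using T N(1) by (auto simp: P_def)
  qed
  have P_near: "\<exists>s\<in>P. \<bar>t - s\<bar> \<le> T / real N" if t: "t \<in> {0<..<T}" for t
  proof -
    define i where "i = nat \<lfloor>t * real N / T\<rfloor>"
    have x: "0 \<le> t * real N / T" "t * real N / T < real N" using t T N(1) by (auto simp: divide_less_eq)
    have i: "real i \<le> t * real N / T" "t * real N / T < real i + 1" proof -
      have "real i = of_int \<lfloor>t * real N / T\<rfloor>" using x(1) by (simp add: i_def)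
      then show "real i \<le> t * real N / T" "t * real N / T < real i + 1" by (linarith+)
    qed
    then have "i < N" using x(2) by linarith
    moreover have "\<bar>t - (real i + 1/2) * T / real N\<bar> \<le> T / real N"
    proof -
      have "\<bar>t * real N / T - (real i + 1/2)\<bar> \<le> 1" using i by linarith
      then have "\<bar>t * real N / T - (real i + 1/2)\<bar> * (T / real N) \<le> 1 * (T / real N)"
        using T by (intro mult_right_mono) auto
      moreover have "t - (real i + 1/2) * T / real N = (t * real N / T - (real i + 1/2)) * (T / real N)"
        using T N(1) by (simp add: field_simps)
      moreover have "\<bar>(t * real N / T - (real i + 1/2)) * (T / real N)\<bar> = \<bar>t * real N / T - (real i + 1/2)\<bar> * (T / real N)"
        using T by (simp add: abs_mult)
      ultimately show ?thesis by (simp only: mult_1)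
    qed
    ultimately show ?thesis unfolding P_def by blast
  qed
  have "\<forall>e>0. \<exists>Z. finite Z \<and> cball (0::'b) C \<subseteq> (\<Union>z\<in>Z. ball z e)"
    using compact_cball[of "0::'b" C] unfolding compact_eq_totally_bounded by simp
  then have "\<exists>Z. finite Z \<and> cball (0::'b) C \<subseteq> (\<Union>z\<in>Z. ball z (\<rho> / 8))"
    using \<rho> by simp
  then obtain Z where Z: "finite Z" "cball (0::'b) C \<subseteq> (\<Union>z\<in>Z. ball z (\<rho> / 8))"
    by blast
  \<comment> \<open>The restricted abstraction makes a record extensional, hence an element of a
    finite function space.\<close>
  define q where "q k = (\<lambda>(n, s)\<in>F \<times> P. SOME z. z \<in> Z \<and> dist z (g k n s) < \<rho> / 8)" for k
  have q: "q k (n, s) \<in> Z \<and> dist (q k (n, s)) (g k n s) < \<rho> / 8" if "n \<in> F" "s \<in> P" for k n s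
  proof -
    have "g k n s \<in> cball 0 C" using bound[of n s k] that P_sub by auto
    from subsetD[OF Z(2) this] have "\<exists>z. z \<in> Z \<and> dist z (g k n s) < \<rho> / 8" by auto
    from someI_ex[OF this] show ?thesis using that by (simp add: q_def)
  qed
  have "range q \<subseteq> PiE (F \<times> P) (\<lambda>_. Z)"
    using q by (auto simp: q_def PiE_def extensional_def)
  moreover have "finite (PiE (F \<times> P) (\<lambda>_. Z))"
    using F Z(1) by (intro finite_PiE) (auto simp: P_def)
  ultimately have "finite (range q)" by (rule finite_subset)
  then obtain J where J: "finite J" "range q = q ` J"
    by (metis finite_subset_image subset_refl)
  have "\<exists>j\<in>J. \<forall>n\<in>F. \<forall>t\<in>{0<..<T}. norm (g k n t - g j n t) \<le> \<rho>" for k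
  proof -
    obtain j where j: "j \<in> J" "q k = q j" using J(2) by blast
    have "norm (g k n t - g j n t) \<le> \<rho>" if n: "n \<in> F" and t: "t \<in> {0<..<T}" for n t
    proof -
      obtain s where s: "s \<in> P" "\<bar>t - s\<bar> \<le> T / real N" using P_near[OF t] by blast
      have "C * \<bar>t - s\<bar> \<le> C * (T / real N)" using s(2) C by (rule mult_left_mono)
      then have Cts: "C * \<bar>t - s\<bar> \<le> \<rho> / 4" using N(2) unfolding times_divide_eq_right by linarith
      have 1: "norm (g k n t - g k n s) \<le> \<rho> / 4" for k
        using lipschitz[OF n _ t, of s k] s(1) P_sub Cts by force
      have "dist (q k (n, s)) (g k n s) < \<rho> / 8" "dist (q k (n, s)) (g j n s) < \<rho> / 8"
        using q[OF n s(1), of k] q[OF n s(1), of j] j(2) by auto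
      then have "dist (g k n s) (g j n s) < \<rho> / 4" by metric
      then have "norm (g k n s - g j n s) \<le> \<rho> / 4" by (simp add: dist_norm)
      moreover have "norm (g k n t - g j n t) \<le> norm (g k n t - g k n s) + norm (g k n s - g j n s) + norm (g j n t - g j n s)"
        using norm_triangle_ineq[of "g k n t - g k n s" "g k n s - g j n s"]
          norm_triangle_ineq4[of "g k n t - g j n s" "g j n t - g j n s"] by simp
      ultimately show ?thesis using 1[of k] 1[of j] \<rho> by linarith
    qed
    then show ?thesis using j(1) by blast
  qed
  then show ?thesis using J(1) by blast
qed

section \<open>Families of bounded fields\<close>

lemma shift_diff_of_diff_le:
  assumes "f \<in> L2x" "g \<in> L2x"
  shows "shift_diff (\<lambda>x. f x - g x) h \<le> 2 * shift_diff f h + 2 * shift_diff g h"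
proof -
  note [measurable] = assms[THEN L2x_borel]
  have "shift_diff (\<lambda>x. f x - g x) h = sq_int (\<lambda>x. (f (x + h) - f x) - (g (x + h) - g x))"
    by (simp add: shift_diff_def algebra_simps)
  also have "\<dots> \<le> 2 * sq_int (\<lambda>x. f (x + h) - f x) + 2 * sq_int (\<lambda>x. g (x + h) - g x)"
    by (rule sq_int_diff_le) auto
  finally show ?thesis by (simp add: shift_diff_def)
qed

lemma shift_energy_periodic: "(\<And>t. periodic (U t)) \<Longrightarrow> periodic (shift_energy T U)"
  by (simp add: periodic_def shift_energy_def shift_diff_def add.assoc[symmetric])

definition uniformly_shift_continuous :: "real \<Rightarrow> (nat \<Rightarrow> real \<Rightarrow> real^2 \<Rightarrow> real^2) \<Rightarrow> bool" where
  "uniformly_shift_continuous T U \<longleftrightarrow>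
    (\<forall>e>0. \<exists>\<delta>>0. \<forall>h. norm h < \<delta> \<longrightarrow> (\<forall>k. shift_energy T (U k) h \<le> ennreal e))"

definition energy_totally_bounded :: "real \<Rightarrow> (nat \<Rightarrow> real \<Rightarrow> real^2 \<Rightarrow> real^2) \<Rightarrow> bool" where
  "energy_totally_bounded T U \<longleftrightarrow>
    (\<forall>e>0. \<exists>J. finite J \<and> (\<forall>k. \<exists>j\<in>J. energy T (\<lambda>t x. U k t x - U j t x) \<le> ennreal e))"

locale bounded_family =
  fixes T M :: real and U :: "nat \<Rightarrow> real \<Rightarrow> real^2 \<Rightarrow> real^2"
  assumes family: "\<And>k. bounded_field T M (U k)"
begin

sublocale field: bounded_field T M "U k" for k by (rule family)

text \<open>The kernel inequality is applied to \<open>U k t - U j t\<close>, whose shift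
  differences are dominated by those of the two fields; this doubles the factor 2. Tonelli then
  moves the time integral inside the kernel average.\<close>

lemma energy_le_kernel:
  assumes K [measurable]: "K \<in> borel_measurable borel" and B: "0 \<le> B"
    and K_est: "\<And>f. f \<in> L2x \<Longrightarrow> sq_int f \<le> 2 * kernel_average K (shift_diff f) +
      ennreal (4 * (B * (\<Sum>n\<in>F. norm (fourier_coeff f n)))\<^sup>2)"
    and fc: "\<And>n t. n \<in> F \<Longrightarrow> t \<in> {0<..<T} \<Longrightarrow> norm (fourier_coeff (U k t) n - fourier_coeff (U j t) n) \<le> \<rho>"
  shows "energy T (\<lambda>t x. U k t x - U j t x) \<le>
    4 * kernel_average K (shift_energy T (U k)) +
    4 * kernel_average K (shift_energy T (U j)) +
    ennreal (T * (4 * (B * (real (card F) * \<rho>))\<^sup>2))"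
proof -
  let ?R = "ennreal (4 * (B * (real (card F) * \<rho>))\<^sup>2)"
  let ?A = "\<lambda>k t h. ennreal (K h) * shift_diff (U k t) h * indicator torus_cell h"
  have swap: "(\<integral>\<^sup>+t. (\<integral>\<^sup>+h. ?A k t h \<partial>lborel) * indicator {0<..<T} t \<partial>lborel) =
      kernel_average K (shift_energy T (U k))" for k
  proof -
    have "(\<integral>\<^sup>+t. (\<integral>\<^sup>+h. ?A k t h \<partial>lborel) * indicator {0<..<T} t \<partial>lborel) =
        (\<integral>\<^sup>+t. (\<integral>\<^sup>+h. ?A k t h * indicator {0<..<T} t \<partial>lborel) \<partial>lborel)"
      by (simp add: nn_integral_multc)
    also have "\<dots> = (\<integral>\<^sup>+h. (\<integral>\<^sup>+t. ?A k t h * indicator {0<..<T} t \<partial>lborel) \<partial>lborel)"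
      by (rule lborel_pair.Fubini') measurable
    also have "\<dots> = (\<integral>\<^sup>+h. (ennreal (K h) * indicator torus_cell h) * shift_energy T (U k) h \<partial>lborel)"
      unfolding shift_energy_def
      by (subst nn_integral_cmult[symmetric]) (auto intro!: nn_integral_cong simp: mult_ac)
    finally show ?thesis by (simp add: mult_ac)
  qed
  have "sq_int (\<lambda>x. U k t x - U j t x) \<le> 4 * (\<integral>\<^sup>+h. ?A k t h \<partial>lborel) + 4 * (\<integral>\<^sup>+h. ?A j t h \<partial>lborel) + ?R"
    if t: "t \<in> {0<..<T}" for t
  proof -
    have "kernel_average K (shift_diff (\<lambda>x. U k t x - U j t x)) \<le>
        (\<integral>\<^sup>+h. 2 * ?A k t h + 2 * ?A j t h \<partial>lborel)"
    proof (intro nn_integral_mono)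
      fix h
      have "ennreal (K h) * shift_diff (\<lambda>x. U k t x - U j t x) h \<le>
          ennreal (K h) * (2 * shift_diff (U k t) h + 2 * shift_diff (U j t) h)"
        by (intro mult_left_mono shift_diff_of_diff_le field.U_L2x) simp
      also have "\<dots> = 2 * (ennreal (K h) * shift_diff (U k t) h) + 2 * (ennreal (K h) * shift_diff (U j t) h)"
        by (simp add: distrib_left mult_ac)
      finally show "ennreal (K h) * shift_diff (\<lambda>x. U k t x - U j t x) h * indicator torus_cell h \<le> 2 * ?A k t h + 2 * ?A j t h"
        by (auto simp: indicator_def)
    qed
    also have "\<dots> = 2 * (\<integral>\<^sup>+h. ?A k t h \<partial>lborel) + 2 * (\<integral>\<^sup>+h. ?A j t h \<partial>lborel)"
      by (simp add: nn_integral_add nn_integral_cmult)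
    finally have 1: "2 * kernel_average K (shift_diff (\<lambda>x. U k t x - U j t x)) \<le>
        2 * (2 * (\<integral>\<^sup>+h. ?A k t h \<partial>lborel) + 2 * (\<integral>\<^sup>+h. ?A j t h \<partial>lborel))"
      by (rule mult_left_mono) simp
    have "norm (fourier_coeff (\<lambda>x. U k t x - U j t x) n) \<le> \<rho>" if "n \<in> F" for n
      using fc[OF that t] by (simp add: fourier_coeff_diff field.U_L2x)
    then have "(\<Sum>n\<in>F. norm (fourier_coeff (\<lambda>x. U k t x - U j t x) n)) \<le> (\<Sum>n\<in>F. \<rho>)"
      by (rule sum_mono)
    then have 2: "ennreal (4 * (B * (\<Sum>n\<in>F. norm (fourier_coeff (\<lambda>x. U k t x - U j t x) n)))\<^sup>2) \<le> ?R"
      using B by (intro ennreal_leI mult_left_mono power_mono) (auto intro!: mult_nonneg_nonneg sum_nonneg)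
    have "sq_int (\<lambda>x. U k t x - U j t x) \<le> 2 * (2 * (\<integral>\<^sup>+h. ?A k t h \<partial>lborel) + 2 * (\<integral>\<^sup>+h. ?A j t h \<partial>lborel)) + ?R"
      by (rule order_trans[OF K_est[OF L2x_diff[OF field.U_L2x field.U_L2x]] add_mono[OF 1 2]])
    then show ?thesis by (simp add: distrib_left mult.assoc[symmetric])
  qed
  then have "energy T (\<lambda>t x. U k t x - U j t x) \<le> (\<integral>\<^sup>+t. 4 * ((\<integral>\<^sup>+h. ?A k t h \<partial>lborel) * indicator {0<..<T} t) +
      4 * ((\<integral>\<^sup>+h. ?A j t h \<partial>lborel) * indicator {0<..<T} t) + ?R * indicator {0<..<T} t \<partial>lborel)"
    unfolding energy_def by (intro nn_integral_mono) (auto simp: indicator_def)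
  also have "\<dots> = 4 * (\<integral>\<^sup>+t. (\<integral>\<^sup>+h. ?A k t h \<partial>lborel) * indicator {0<..<T} t \<partial>lborel) +
      4 * (\<integral>\<^sup>+t. (\<integral>\<^sup>+h. ?A j t h \<partial>lborel) * indicator {0<..<T} t \<partial>lborel) + (\<integral>\<^sup>+t. ?R * indicator {0<..<T} t \<partial>lborel)"
    by (simp add: nn_integral_add nn_integral_cmult)
  also have "(\<integral>\<^sup>+t. ?R * indicator {0<..<T} t \<partial>lborel) = ennreal (T * (4 * (B * (real (card F) * \<rho>))\<^sup>2))"
    by (rule field.nn_integral_interval_const) simp
  finally show ?thesis by (simp only: swap)
qed

text \<open>The order of the choices matters. The kernel depends on e alone and fixes F and B; only
  then is the accuracy \<rho> of the coefficients chosen, with Lipschitz constants that are uniform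
  over the finite set F.\<close>

lemma totally_bounded_if_shift_continuous:
  assumes equi: "uniformly_shift_continuous T U"
    and lipschitz: "\<And>n. \<exists>C\<ge>0. \<forall>k. \<forall>s\<in>{0<..<T}. \<forall>t\<in>{0<..<T}. norm (fourier_coeff (U k t) n) \<le> C \<and>
      norm (fourier_coeff (U k t) n - fourier_coeff (U k s) n) \<le> C * \<bar>t - s\<bar>"
  shows "energy_totally_bounded T U"
  unfolding energy_totally_bounded_def
proof (intro allI impI)
  fix e :: real assume e: "0 < e"
  have T: "0 < T" by (rule field.T_pos)
  \<comment> \<open>The shift energy is at most \<open>4 * T * M\<^sup>2\<close>, so mass \<eta>
    away from the lattice contributes at most e / 32. The summand 1 covers M = 0.\<close>
  define \<eta> where "\<eta> = e / (128 * T * (M\<^sup>2 + 1))"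
  have M: "0 < M\<^sup>2 + 1" using zero_le_power2[of M] by linarith
  have \<eta>: "0 < \<eta>" using e T M by (simp add: \<eta>_def)
  have M\<eta>: "4 * T * M\<^sup>2 * \<eta> \<le> e / 32"
  proof -
    have "128 * T * (M\<^sup>2 + 1) * \<eta> = e" using T M by (simp add: \<eta>_def)
    moreover have "128 * T * M\<^sup>2 * \<eta> \<le> 128 * T * (M\<^sup>2 + 1) * \<eta>" using T \<eta> by (intro mult_right_mono mult_left_mono) auto
    ultimately show ?thesis by linarith
  qed
  have "0 < e / 32" using e by simp
  then obtain \<delta> where \<delta>: "0 < \<delta>" "\<And>h k. norm h < \<delta> \<Longrightarrow> shift_energy T (U k) h \<le> ennreal (e / 32)"
    using equi unfolding uniformly_shift_continuous_def by blast
  obtain K where K: "trig_poly (\<lambda>x. complex_of_real (K x))" "\<And>x. 0 \<le> K x"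
    "(\<integral>\<^sup>+h\<in>torus_cell. ennreal (K h) \<partial>lborel) = 1"
    "(\<integral>\<^sup>+h\<in>torus_cell \<inter> {h. \<forall>m. \<delta> \<le> norm (h - lattice m)}. ennreal (K h) \<partial>lborel) \<le> ennreal \<eta>"
    using trig_kernel[OF \<delta>(1) \<eta>] by blast
  have "(\<lambda>x. Re (complex_of_real (K x))) \<in> borel_measurable borel"
    by (intro measurable_compose[OF trig_poly_measurable[OF K(1)]]) simp
  then have [measurable]: "K \<in> borel_measurable borel" by simp
  have K_avg: "kernel_average K (shift_energy T (U k)) \<le> ennreal (e / 16)" for k
  proof -
    have "kernel_average K (shift_energy T (U k)) \<le> ennreal (e / 32) + ennreal (4 * T * M\<^sup>2) * ennreal \<eta>"
      by (rule kernel_average_le[OF _ _ _ \<delta>(2) field.shift_energy_le K(3,4)])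
        (auto intro!: shift_energy_periodic L2x_periodic field.U_L2x)
    also have "ennreal (4 * T * M\<^sup>2) * ennreal \<eta> = ennreal (4 * T * M\<^sup>2 * \<eta>)"
      using T \<eta> by (intro ennreal_mult[symmetric]) auto
    also have "\<dots> \<le> ennreal (e / 32)" by (rule ennreal_leI[OF M\<eta>])
    also have "ennreal (e / 32) + ennreal (e / 32) = ennreal (e / 32 + e / 32)" using e by (intro ennreal_plus[symmetric]) auto
    also have "e / 32 + e / 32 = e / 16" by simp
    finally show ?thesis by (simp add: add_left_mono)
  qed
  obtain F B where F: "finite F" and B: "0 \<le> B" and K_est: "\<And>f. f \<in> L2x \<Longrightarrow>
      sq_int f \<le> 2 * kernel_average K (shift_diff f) +
      ennreal (4 * (B * (\<Sum>n\<in>F. norm (fourier_coeff f n)))\<^sup>2)"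
    using sq_int_kernel_estimate[OF K(1,2,3)] by blast
  \<comment> \<open>The summand 1 keeps \<open>b\<close> positive. Capping \<rho> at 1 gives \<rho>
    * \<rho> \<le> \<rho>, so a linear condition on \<rho> confines the coefficients to half of
    e.\<close>
  define b where "b = B * real (card F) + 1"
  have b: "0 < b" using B by (simp add: b_def add_nonneg_pos)
  define \<rho> where "\<rho> = min 1 (e / (8 * T * b\<^sup>2))"
  have \<rho>: "0 < \<rho>" "\<rho> \<le> 1" "\<rho> \<le> e / (8 * T * b\<^sup>2)" using e T b by (auto simp: \<rho>_def)
  have small: "T * (4 * (B * (real (card F) * \<rho>))\<^sup>2) \<le> e / 2"
  proof -
    have "B * (real (card F) * \<rho>) \<le> b * \<rho>" using \<rho>(1) by (simp add: b_def algebra_simps)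
    then have "(B * (real (card F) * \<rho>))\<^sup>2 \<le> (b * \<rho>)\<^sup>2" using B \<rho>(1) by (intro power_mono) auto
    also have "\<dots> = b\<^sup>2 * (\<rho> * \<rho>)" by (simp add: power2_eq_square)
    also have "\<dots> \<le> b\<^sup>2 * (\<rho> * 1)" using \<rho> by (intro mult_left_mono) auto
    finally have "T * (4 * (B * (real (card F) * \<rho>))\<^sup>2) \<le> T * (4 * (b\<^sup>2 * \<rho>))" using T by simp
    also have "\<dots> = 4 * T * b\<^sup>2 * \<rho>" by simp
    also have "\<dots> \<le> 4 * T * b\<^sup>2 * (e / (8 * T * b\<^sup>2))" using \<rho>(3) T by (intro mult_left_mono) auto
    also have "\<dots> = e / 2" using T b by simp
    finally show ?thesis .
  qed
  obtain C where C: "\<And>n. 0 \<le> C n" "\<And>n k s t. s \<in> {0<..<T} \<Longrightarrow> t \<in> {0<..<T} \<Longrightarrow>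
      norm (fourier_coeff (U k t) n) \<le> C n \<and> norm (fourier_coeff (U k t) n - fourier_coeff (U k s) n) \<le> C n * \<bar>t - s\<bar>"
    using lipschitz by metis
  define C' where "C' = (\<Sum>n\<in>F. C n)"
  have C': "0 \<le> C'" "\<And>n. n \<in> F \<Longrightarrow> C n \<le> C'"
    using C(1) F by (auto simp: C'_def intro!: sum_nonneg member_le_sum)
  have "\<exists>J. finite J \<and> (\<forall>k. \<exists>j\<in>J. \<forall>n\<in>F. \<forall>t\<in>{0<..<T}. norm (fourier_coeff (U k t) n - fourier_coeff (U j t) n) \<le> \<rho>)"
  proof (rule finite_net_Lipschitz_family[OF T F \<rho>(1) C'(1)])
    show "norm (fourier_coeff (U k t) n) \<le> C'" if "n \<in> F" "t \<in> {0<..<T}" for k n t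
      using C(2)[OF that(2,2), of k n] C'(2)[OF that(1)] by linarith
    show "norm (fourier_coeff (U k t) n - fourier_coeff (U k s) n) \<le> C' * \<bar>t - s\<bar>"
      if "n \<in> F" "s \<in> {0<..<T}" "t \<in> {0<..<T}" for k n s t
      using C(2)[OF that(2,3), of k n] mult_right_mono[OF C'(2)[OF that(1)], of "\<bar>t - s\<bar>"] by simp
  qed
  then obtain J where J: "finite J" "\<And>k. \<exists>j\<in>J. \<forall>n\<in>F. \<forall>t\<in>{0<..<T}. norm (fourier_coeff (U k t) n - fourier_coeff (U j t) n) \<le> \<rho>"
    by blast
  have "\<exists>j\<in>J. energy T (\<lambda>t x. U k t x - U j t x) \<le> ennreal e" for k
  proof -
    obtain j where j: "j \<in> J" "\<And>n t. n \<in> F \<Longrightarrow> t \<in> {0<..<T} \<Longrightarrow> norm (fourier_coeff (U k t) n - fourier_coeff (U j t) n) \<le> \<rho>"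
      using J(2)[of k] by blast
    have "energy T (\<lambda>t x. U k t x - U j t x) \<le>
        4 * kernel_average K (shift_energy T (U k)) +
        4 * kernel_average K (shift_energy T (U j)) +
        ennreal (T * (4 * (B * (real (card F) * \<rho>))\<^sup>2))"
      by (rule energy_le_kernel[OF _ B K_est j(2)]) measurable
    also have "\<dots> \<le> 4 * ennreal (e / 16) + 4 * ennreal (e / 16) + ennreal (e / 2)"
      by (intro add_mono mult_left_mono K_avg ennreal_leI small) auto
    also have "4 * ennreal (e / 16) = ennreal (e / 4)"
    proof -
      have "4 * ennreal (e / 16) = ennreal 4 * ennreal (e / 16)" by simp
      also have "\<dots> = ennreal (4 * (e / 16))" using e by (intro ennreal_mult[symmetric]) auto
      finally show ?thesis by simp
    qed
    also have "ennreal (e / 4) + ennreal (e / 4) + ennreal (e / 2) = ennreal (e / 4 + e / 4 + e / 2)"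
      using e by (subst ennreal_plus[symmetric], simp, simp, subst ennreal_plus[symmetric]) auto
    also have "e / 4 + e / 4 + e / 2 = e" by simp
    finally show ?thesis using j(1) by blast
  qed
  then show "\<exists>J. finite J \<and> (\<forall>k. \<exists>j\<in>J. energy T (\<lambda>t x. U k t x - U j t x) \<le> ennreal e)"
    using J(1) by blast
qed

text \<open>Each of the finitely many centres has its own \<delta>, and the least of them serves the
  whole family by \<open>shift_diff_diff_le\<close>. The bounds e / 4 and e / 16 match the factors 2
  and 8 there. The minimum exists because the net must serve the index 0 and so is nonempty.\<close>

lemma shift_continuous_if_totally_bounded:
  assumes "energy_totally_bounded T U"
  shows "uniformly_shift_continuous T U"
  unfolding uniformly_shift_continuous_def
proof (intro allI impI)
  fix e :: real assume e: "0 < e"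
  then have "0 < e / 16" by simp
  then obtain J where J: "finite J" "\<And>k. \<exists>j\<in>J. energy T (\<lambda>t x. U k t x - U j t x) \<le> ennreal (e / 16)"
    using assms unfolding energy_totally_bounded_def by blast
  have "\<exists>\<delta>>0. \<forall>h. norm h < \<delta> \<longrightarrow> shift_energy T (U j) h \<le> ennreal (e / 4)" for j
    by (rule field.shift_energy_tendsto_0) (use e in simp)
  then obtain d where d: "\<And>j. 0 < d j" "\<And>j h. norm h < d j \<Longrightarrow> shift_energy T (U j) h \<le> ennreal (e / 4)"
    by metis
  have J_ne: "J \<noteq> {}" using J(2)[of 0] by auto
  have "shift_energy T (U k) h \<le> ennreal e" if h: "norm h < Min (d ` J)" for h k
  proof -
    obtain j where j: "j \<in> J" "energy T (\<lambda>t x. U k t x - U j t x) \<le> ennreal (e / 16)" using J(2) by blast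
    have "norm h < d j" using h J(1) j(1) J_ne by simp
    have "shift_energy T (U k) h \<le> (\<integral>\<^sup>+t. 2 * (shift_diff (U j t) h * indicator {0<..<T} t) +
        8 * (sq_int (\<lambda>x. U k t x - U j t x) * indicator {0<..<T} t) \<partial>lborel)"
      unfolding shift_energy_def
      by (intro nn_integral_mono) (auto simp: indicator_def shift_diff_diff_le field.U_L2x)
    also have "\<dots> = 2 * shift_energy T (U j) h + 8 * energy T (\<lambda>t x. U k t x - U j t x)"
      unfolding shift_energy_def energy_def sq_int_def by (simp add: nn_integral_add nn_integral_cmult)
    also have "\<dots> \<le> 2 * ennreal (e / 4) + 8 * ennreal (e / 16)"
      by (intro add_mono mult_left_mono d(2) \<open>norm h < d j\<close> j(2)) auto
    also have "\<dots> = ennreal 2 * ennreal (e / 4) + ennreal 8 * ennreal (e / 16)" by simp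
    also have "\<dots> = ennreal (2 * (e / 4)) + ennreal (8 * (e / 16))"
      using e by (subst (1 2) ennreal_mult[symmetric]) auto
    also have "\<dots> = ennreal (2 * (e / 4) + 8 * (e / 16))" using e by (intro ennreal_plus[symmetric]) auto
    also have "2 * (e / 4) + 8 * (e / 16) = e" by simp
    finally show ?thesis .
  qed
  moreover have "0 < Min (d ` J)" using J(1) J_ne d(1) by simp
  ultimately show "\<exists>\<delta>>0. \<forall>h. norm h < \<delta> \<longrightarrow> (\<forall>k. shift_energy T (U k) h \<le> ennreal e)" by blast
qed

lemma shift_continuous_iff_modulus:
  "uniformly_shift_continuous T U \<longleftrightarrow> (\<exists>\<phi>. modulus_of_continuity \<phi> \<and> (\<forall>r>0. \<forall>k. S2T T (U k) r \<le> \<phi> r))"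
proof
  assume equi: "uniformly_shift_continuous T U"
  \<comment> \<open>The smallest possible modulus. The supremum is finite because the shift energies
    have a common bound.\<close>
  define \<phi> where "\<phi> r = (if 0 < r then SUP k. S2T T (U k) r else 0)" for r
  have le: "S2T T (U k) r \<le> sqrt (4 * T * M\<^sup>2)" if "0 < r" for k r
  proof (rule real_le_rsqrt)
    show "(S2T T (U k) r)\<^sup>2 \<le> 4 * T * M\<^sup>2"
      using field.T_pos by (intro field.S2T_le that field.shift_energy_le) auto
  qed
  have bdd: "bdd_above (range (\<lambda>k. S2T T (U k) r))" if "0 < r" for r
    using le[OF that] by (intro bdd_aboveI[of _ "sqrt (4 * T * M\<^sup>2)"]) auto
  have upper: "S2T T (U k) r \<le> \<phi> r" if "0 < r" for k r
    using cSUP_upper[OF UNIV_I bdd[OF that], of k] that by (simp add: \<phi>_def)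
  have nonneg: "0 \<le> \<phi> r" for r
    using order_trans[OF field.S2T_nonneg[of 0 r] upper[of r 0]] by (cases "0 < r") (auto simp: \<phi>_def)
  have "(\<phi> \<longlongrightarrow> 0) (at_right 0)"
  proof (rule order_tendstoI)
    fix a :: real assume "a < 0"
    then show "\<forall>\<^sub>F r in at_right 0. a < \<phi> r" using nonneg by (intro always_eventually) (metis less_le_trans)
  next
    fix a :: real assume a: "0 < a"
    then have "0 < (a / 2)\<^sup>2" by simp
    then obtain \<delta> where \<delta>: "0 < \<delta>" "\<And>h k. norm h < \<delta> \<Longrightarrow> shift_energy T (U k) h \<le> ennreal ((a / 2)\<^sup>2)"
      using equi unfolding uniformly_shift_continuous_def by blast
    have "\<phi> r < a" if r: "0 < r" "r < \<delta>" for r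
    proof -
      have "S2T T (U k) r \<le> a / 2" for k
      proof (rule power2_le_imp_le)
        show "(S2T T (U k) r)\<^sup>2 \<le> (a / 2)\<^sup>2"
          using r \<delta>(2) by (intro field.S2T_le) auto
      qed (use a in simp)
      then have "(SUP k. S2T T (U k) r) \<le> a / 2" by (intro cSUP_least) auto
      then have "\<phi> r \<le> a / 2" using r(1) by (simp add: \<phi>_def)
      then show ?thesis using a by linarith
    qed
    then show "\<forall>\<^sub>F r in at_right 0. \<phi> r < a"
      using \<delta>(1) by (auto simp: eventually_at_right_field)
  qed
  then show "\<exists>\<phi>. modulus_of_continuity \<phi> \<and> (\<forall>r>0. \<forall>k. S2T T (U k) r \<le> \<phi> r)"
    using nonneg upper by (intro exI[of _ \<phi>]) (auto simp: modulus_of_continuity_def)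
next
  assume "\<exists>\<phi>. modulus_of_continuity \<phi> \<and> (\<forall>r>0. \<forall>k. S2T T (U k) r \<le> \<phi> r)"
  then obtain \<phi> where \<phi>: "(\<phi> \<longlongrightarrow> 0) (at_right 0)" "\<And>r k. 0 < r \<Longrightarrow> S2T T (U k) r \<le> \<phi> r"
    by (auto simp: modulus_of_continuity_def)
  show "uniformly_shift_continuous T U"
    unfolding uniformly_shift_continuous_def
  proof (intro allI impI)
    fix e :: real assume e: "0 < e"
    \<comment> \<open>The tenth is for the weights 2 + 8 in \<open>shift_energy_le_S2T\<close>.
      Below, d / 3 keeps both radii, d / 3 and its double, under d.\<close>
    have "\<forall>\<^sub>F r in at_right 0. \<phi> r < sqrt (e / 10)"
      using \<phi>(1) by (rule order_tendstoD(2)) (use e in simp)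
    then obtain d where d: "0 < d" "\<And>r. 0 < r \<Longrightarrow> r < d \<Longrightarrow> \<phi> r < sqrt (e / 10)"
      by (auto simp: eventually_at_right_field)
    have S: "(S2T T (U k) r)\<^sup>2 \<le> e / 10" if "0 < r" "r < d" for k r
    proof -
      have "S2T T (U k) r \<le> sqrt (e / 10)" using \<phi>(2)[OF that(1), of k] d(2)[OF that] by linarith
      then have "(S2T T (U k) r)\<^sup>2 \<le> (sqrt (e / 10))\<^sup>2" using field.S2T_nonneg by (intro power_mono) auto
      then show ?thesis using e by simp
    qed
    have "shift_energy T (U k) h \<le> ennreal e" if h: "norm h < d / 3" for h k
    proof -
      have "shift_energy T (U k) h \<le> ennreal (2 * (S2T T (U k) (d / 3))\<^sup>2 + 8 * (S2T T (U k) (2 * (d / 3)))\<^sup>2)"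
        using h by (rule field.shift_energy_le_S2T)
      also have "\<dots> \<le> ennreal e"
        using S[of "d / 3" k] S[of "2 * (d / 3)" k] d(1) by (intro ennreal_leI) auto
      finally show ?thesis .
    qed
    then show "\<exists>\<delta>>0. \<forall>h. norm h < \<delta> \<longrightarrow> (\<forall>k. shift_energy T (U k) h \<le> ennreal e)"
      using d(1) by (intro exI[of _ "d / 3"]) auto
  qed
qed

end

section \<open>The compactness criterion\<close>

text \<open>Where \<open>a powr q\<close> exceeds \<eta>, \<open>a powr p\<close> is at least
  \<open>\<eta> powr (p / q)\<close>, so a multiple of it absorbs the bound \<open>b powr q\<close>.
  For q < p the additive term is unavoidable, since near 0 no multiple of \<open>a powr p\<close>
  dominates \<open>a powr q\<close>.\<close>

lemma powr_interpolation:
  fixes p q \<eta> b :: real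
  assumes "0 < p" "0 < q" "0 < \<eta>" "0 \<le> b"
  shows "\<exists>C\<ge>0. \<forall>a. 0 \<le> a \<and> a \<le> b \<longrightarrow> a powr q \<le> \<eta> + C * a powr p"
proof (intro exI[of _ "b powr q / \<eta> powr (p / q)"] conjI allI impI)
  fix a assume a: "0 \<le> a \<and> a \<le> b"
  show "a powr q \<le> \<eta> + b powr q / \<eta> powr (p / q) * a powr p"
  proof (cases "a powr q \<le> \<eta>")
    case True
    then show ?thesis by (simp add: add_increasing2)
  next
    case False
    then have "\<eta> powr (p / q) \<le> (a powr q) powr (p / q)" using assms by (intro powr_mono2) auto
    also have "\<dots> = a powr p" using assms by (simp add: powr_powr)
    finally have "1 \<le> a powr p / \<eta> powr (p / q)" using assms by simp
    then have "b powr q * 1 \<le> b powr q * (a powr p / \<eta> powr (p / q))" by (intro mult_left_mono) auto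
    moreover have "a powr q \<le> b powr q" using a assms by (intro powr_mono2) auto
    ultimately show ?thesis using assms(3) by simp
  qed
qed simp

text \<open>One constant serves all functions with the same bound and support, hence all pairs of
  members of the sequence. It will be used with the exponents p and 2 in both orders.\<close>

lemma nn_integral_powr_interpolation:
  assumes "0 < p" "0 < q" "0 < \<eta>" "0 \<le> b" "0 < T"
  shows "\<exists>C\<ge>0. \<forall>a. a \<in> borel_measurable lborel \<longrightarrow> (AE t in lborel. 0 \<le> a t \<and> a t \<le> b) \<longrightarrow>
    (\<forall>t. t \<notin> {0<..<T} \<longrightarrow> a t = 0) \<longrightarrow>
    (\<integral>\<^sup>+t. ennreal (a t powr q) \<partial>lborel) \<le> ennreal (\<eta> * T) + ennreal C * (\<integral>\<^sup>+t. ennreal (a t powr p) \<partial>lborel)"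
proof -
  obtain C where C: "0 \<le> C" "\<And>a. 0 \<le> a \<Longrightarrow> a \<le> b \<Longrightarrow> a powr q \<le> \<eta> + C * a powr p"
    using powr_interpolation[OF assms(1-4)] by blast
  have "(\<integral>\<^sup>+t. ennreal (a t powr q) \<partial>lborel) \<le> ennreal (\<eta> * T) + ennreal C * (\<integral>\<^sup>+t. ennreal (a t powr p) \<partial>lborel)"
    if [measurable]: "a \<in> borel_measurable lborel" and bound: "AE t in lborel. 0 \<le> a t \<and> a t \<le> b"
      and supp: "\<And>t. t \<notin> {0<..<T} \<Longrightarrow> a t = 0" for a :: "real \<Rightarrow> real"
  proof -
    have "(\<integral>\<^sup>+t. ennreal (a t powr q) \<partial>lborel) \<le>
        (\<integral>\<^sup>+t. ennreal \<eta> * indicator {0<..<T} t + ennreal C * ennreal (a t powr p) \<partial>lborel)"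
    proof (intro nn_integral_mono_AE, use bound in eventually_elim)
      case (elim t)
      show ?case
      proof (cases "t \<in> {0<..<T}")
        case True
        have "ennreal (a t powr q) \<le> ennreal (\<eta> + C * a t powr p)" using C(2) elim by (intro ennreal_leI) auto
        also have "\<dots> = ennreal \<eta> + ennreal C * ennreal (a t powr p)"
          using assms(3) C(1) by (simp add: ennreal_plus ennreal_mult)
        finally show ?thesis using True by simp
      qed (simp add: supp)
    qed
    also have "\<dots> = ennreal \<eta> * emeasure lborel {0<..<T} + ennreal C * (\<integral>\<^sup>+t. ennreal (a t powr p) \<partial>lborel)"
      by (subst nn_integral_add) (auto simp: nn_integral_cmult)
    also have "ennreal \<eta> * emeasure lborel {0<..<T} = ennreal (\<eta> * T)"
      using assms(3,5) by (simp add: ennreal_mult)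
    finally show ?thesis .
  qed
  then show ?thesis using C(1) by blast
qed

lemma relatively_compactin_LpL2_iff:
  fixes u :: "nat \<Rightarrow> real \<Rightarrow> real^2 \<Rightarrow> real^2"
  assumes p: "1 \<le> p" and u: "\<And>k. u k \<in> LpL2 p T"
  shows "relatively_compactin (LpL2_topology p T) (range u) \<longleftrightarrow>
    (\<forall>\<epsilon>>0. \<exists>J. finite J \<and> (\<forall>k. \<exists>j\<in>J. LpL2_norm p T (\<lambda>t x. u k t x - u j t x) < \<epsilon>))"
proof -
  let ?d = "\<lambda>f g. LpL2_norm p T (\<lambda>t x. f t x - g t x)"
  have "compactin (LpL2_topology p T) (LpL2_topology p T closure_of range u) \<longleftrightarrow>
    (\<forall>\<epsilon>>0. \<exists>K\<subseteq>range u. finite K \<and> (\<forall>f\<in>range u. \<exists>g\<in>K. ?d f g < \<epsilon>))"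
  proof (rule pseudometric_compact_closure_iff[where M = "LpL2 p T"])
    show "?d f g = ?d g f" for f g
      by (rule LpL2_norm_minus_commute)
    show "?d f h \<le> ?d f g + ?d g h"
      if "f \<in> LpL2 p T" "g \<in> LpL2 p T" "h \<in> LpL2 p T" for f g h
      using p that by (rule LpL2_norm_triangle)
    show "\<exists>l\<in>LpL2 p T. (\<lambda>n. ?d (v n) l) \<longlonglongrightarrow> 0"
      if "\<And>n::nat. v n \<in> LpL2 p T" "\<And>\<epsilon>. 0 < \<epsilon> \<Longrightarrow> \<exists>N. \<forall>m\<ge>N. \<forall>n\<ge>N. ?d (v m) (v n) < \<epsilon>" for v
      using p that by (rule LpL2_complete)
    show "?d f f = 0" for f
      by (rule LpL2_norm_self)
  qed (use u in \<open>auto simp: openin_LpL2_topology\<close>)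
  also have "\<dots> \<longleftrightarrow> (\<forall>\<epsilon>>0. \<exists>J. finite J \<and> (\<forall>k. \<exists>j\<in>J. ?d (u k) (u j) < \<epsilon>))"
  proof (intro arg_cong[where f=All] ext imp_cong refl iffI)
    fix \<epsilon> :: real
    assume "\<exists>K\<subseteq>range u. finite K \<and> (\<forall>f\<in>range u. \<exists>g\<in>K. ?d f g < \<epsilon>)"
    then obtain K where K: "K \<subseteq> range u" "finite K" "\<And>k. \<exists>g\<in>K. ?d (u k) g < \<epsilon>"
      by blast
    obtain J where J: "finite J" "K = u ` J" using finite_subset_image[OF K(2,1)] by blast
    show "\<exists>J. finite J \<and> (\<forall>k. \<exists>j\<in>J. ?d (u k) (u j) < \<epsilon>)"
      using J K(3) by (intro exI[of _ J]) auto
  next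
    fix \<epsilon> :: real
    assume "\<exists>J. finite J \<and> (\<forall>k. \<exists>j\<in>J. ?d (u k) (u j) < \<epsilon>)"
    then obtain J where J: "finite J" "\<And>k. \<exists>j\<in>J. ?d (u k) (u j) < \<epsilon>" by blast
    then show "\<exists>K\<subseteq>range u. finite K \<and> (\<forall>f\<in>range u. \<exists>g\<in>K. ?d f g < \<epsilon>)"
      by (intro exI[of _ "u ` J"]) auto
  qed
  finally show ?thesis using u by (auto simp: relatively_compactin_def)
qed

theorem proposition2p10:
  fixes p T :: real and u :: "nat \<Rightarrow> real \<Rightarrow> real^2 \<Rightarrow> real^2"
  assumes "1 \<le> p" and "0 < T"
    and "approximate_solution_sequence T u"
  shows "relatively_compactin (LpL2_topology p T) (range u) \<longleftrightarrow>
    (\<exists>\<phi>. modulus_of_continuity \<phi> \<and> (\<forall>r>0. \<forall>k. S2T T (u k) r \<le> \<phi> r))"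
proof -
  have p: "0 < p" "1 \<le> p" using assms(1) by auto
  have bounded: "bounded_Linf_L2 T u" using assms(3) by (simp add: approximate_solution_sequence_def)
  obtain L where Lip: "bounded_Lip_Hneg T L u"
    using assms(3) by (auto simp: approximate_solution_sequence_def)
  have u_meas: "(\<lambda>(t, x). u k t x) \<in> borel_measurable (restrict_space borel ({0<..<T} \<times> UNIV))" for k
    using bounded by (simp add: bounded_Linf_L2_def)
  obtain M where M: "0 \<le> M" "\<And>k. AE t in lborel. t \<in> {0<..<T} \<longrightarrow> L2x_norm (u k t) \<le> M"
  proof -
    obtain M' where M': "\<And>k. AE t in lborel. t \<in> {0<..<T} \<longrightarrow> u k t \<in> L2x \<and> L2x_norm (u k t) \<le> M'"
      using bounded unfolding bounded_Linf_L2_def by blast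
    \<comment> \<open>The maximum gives a nonnegative bound without exhibiting a time at which it is
      attained.\<close>
    have "AE t in lborel. t \<in> {0<..<T} \<longrightarrow> L2x_norm (u k t) \<le> max 0 M'" for k
      using M'[of k] by eventually_elim auto
    then show ?thesis using that[of "max 0 M'"] by simp
  qed
  have u_L2x: "u k t \<in> L2x" "in_Hs (- L) (u k t)" if "t \<in> {0<..<T}" for k t
    using Lip that by (auto simp: bounded_Lip_Hneg_def)
  obtain C where C: "\<And>k t. t \<in> {0<..<T} \<Longrightarrow> Hs_norm (- L) (u k t) \<le> C"
    "\<And>k s t. s \<in> {0<..<T} \<Longrightarrow> t \<in> {0<..<T} \<Longrightarrow> Hs_norm (- L) (\<lambda>x. u k t x - u k s x) \<le> C * \<bar>t - s\<bar>"
  proof -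
    have sub: "t \<in> {0<..<T} \<Longrightarrow> t \<in> {0..<T}" for t by simp
    show ?thesis using Lip that sub unfolding bounded_Lip_Hneg_def by blast
  qed
  have u_LpL2: "u k \<in> LpL2 p T" for k
  proof (rule LpL2I[OF u_meas])
    show "AE t in lborel. t \<in> {0<..<T} \<longrightarrow> u k t \<in> L2x" using u_L2x by simp
    show "integrable lborel (\<lambda>t. indicator {0<..<T} t *\<^sub>R M powr p)"
      using assms(2) by (intro integrable_scaleR_left integrable_real_indicator) auto
    show "AE t in lborel. slice_norm T t (u k t) powr p \<le> indicator {0<..<T} t *\<^sub>R M powr p"
      using M(2)[of k] by eventually_elim (use p in \<open>auto simp: indicator_def intro!: powr_mono2\<close>)
  qed
  \<comment> \<open>Extension by zero meets the locale assumptions at all times and changes none of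
    the integrals over (0,T).\<close>
  define U where "U k t x = indicator {0<..<T} t *\<^sub>R u k t x" for k t x
  have U_in: "U k t = u k t" if "t \<in> {0<..<T}" for k t
    using that by (simp add: U_def fun_eq_iff)
  have zero: "(\<lambda>x. 0) \<in> L2x"
    by (simp add: L2x_iff_sq_int periodic_def sq_int_def)
  interpret bounded_family T M U
  proof
    fix k
    show "0 < T" by fact
    show "(\<lambda>(t, x). U k t x) \<in> borel_measurable (borel \<Otimes>\<^sub>M borel)"
      unfolding U_def by (rule borel_measurable_slices[OF u_meas]) simp
    show "U k t \<in> L2x" for t
    proof (cases "t \<in> {0<..<T}")
      case False
      then have "U k t = (\<lambda>x. 0)" by (simp add: U_def fun_eq_iff)
      then show ?thesis using zero by simp
    qed (simp add: U_in u_L2x)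
    show "AE t in lborel. sq_int (U k t) \<le> ennreal (M\<^sup>2)"
      using M(2)[of k]
    proof eventually_elim
      case (elim t)
      show ?case
      proof (cases "t \<in> {0<..<T}")
        case True
        then show ?thesis using elim by (auto simp: U_in sq_int_L2x u_L2x intro!: ennreal_leI power_mono)
      qed (simp add: U_def sq_int_def)
    qed
  qed
  let ?a = "\<lambda>k j t. slice_norm T t (\<lambda>x. u k t x - u j t x)"
  have a_meas: "?a k j \<in> borel_measurable lborel" for k j
    using LpL2_measurable(2)[OF LpL2_diff[OF p(2) u_LpL2 u_LpL2]] by simp
  have a_bound: "AE t in lborel. 0 \<le> ?a k j t \<and> ?a k j t \<le> 2 * M" for k j
    using M(2)[of k] M(2)[of j]
  proof eventually_elim
    case (elim t)
    show ?case
    proof (cases "t \<in> {0<..<T}")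
      case True
      then have "L2x_norm (\<lambda>x. u k t x - u j t x) \<le> L2x_norm (u k t) + L2x_norm (u j t)"
        by (intro L2x_norm_diff_le u_L2x)
      then show ?thesis using True elim by simp
    qed (use M(1) in simp)
  qed
  let ?d = "\<lambda>k j. LpL2_norm p T (\<lambda>t x. u k t x - u j t x)"
  let ?e = "\<lambda>k j. energy T (\<lambda>t x. U k t x - U j t x)"
  have a_LpL2: "(\<integral>\<^sup>+t. ennreal (?a k j t powr p) \<partial>lborel) = ennreal (?d k j powr p)" for k j
    using p by (intro nn_integral_LpL2 LpL2_diff u_LpL2)
  have a_energy: "(\<integral>\<^sup>+t. ennreal (?a k j t powr 2) \<partial>lborel) = ?e k j" for k j
    unfolding energy_def
  proof (intro nn_integral_cong)
    fix t
    show "ennreal (?a k j t powr 2) = sq_int (\<lambda>x. U k t x - U j t x) * indicator {0<..<T} t"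
    proof (cases "t \<in> {0<..<T}")
      case True
      then have "sq_int (\<lambda>x. U k t x - U j t x) = ennreal ((L2x_norm (\<lambda>x. u k t x - u j t x))\<^sup>2)"
        by (simp add: U_in sq_int_L2x L2x_diff u_L2x)
      then show ?thesis using True by simp
    qed simp
  qed
  have two: "(0::real) < 2" by simp
  have interpolation: "\<exists>B\<ge>0. \<forall>k j. (\<integral>\<^sup>+t. ennreal (?a k j t powr q2) \<partial>lborel) \<le>
      ennreal (e / 2) + ennreal B * (\<integral>\<^sup>+t. ennreal (?a k j t powr q1) \<partial>lborel)"
    if q: "0 < q1" "0 < q2" and e: "0 < e" for q1 q2 e :: real
  proof -
    \<comment> \<open>The additive error is spread over an interval of length T, so e / (2 * T)
      contributes e / 2.\<close>
    have pos: "0 < e / (2 * T)" "0 \<le> 2 * M" using e assms(2) M(1) by auto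
    obtain B where "0 \<le> B" and B: "\<forall>a. a \<in> borel_measurable lborel \<longrightarrow> (AE t in lborel. 0 \<le> a t \<and> a t \<le> 2 * M) \<longrightarrow>
        (\<forall>t. t \<notin> {0<..<T} \<longrightarrow> a t = 0) \<longrightarrow>
        (\<integral>\<^sup>+t. ennreal (a t powr q2) \<partial>lborel) \<le> ennreal (e / (2 * T) * T) + ennreal B * (\<integral>\<^sup>+t. ennreal (a t powr q1) \<partial>lborel)"
      using nn_integral_powr_interpolation[OF q pos assms(2)] by blast
    have half: "e / (2 * T) * T = e / 2" using assms(2) by simp
    have "(\<integral>\<^sup>+t. ennreal (?a k j t powr q2) \<partial>lborel) \<le>
        ennreal (e / (2 * T) * T) + ennreal B * (\<integral>\<^sup>+t. ennreal (?a k j t powr q1) \<partial>lborel)" for k j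
      by (rule B[rule_format, OF a_meas a_bound]) simp
    then show ?thesis using \<open>0 \<le> B\<close> unfolding half by blast
  qed
  have S2T_U: "S2T T (U k) r = S2T T (u k) r" for k r
    unfolding S2T_def set_lebesgue_integral_def
    by (intro arg_cong[where f=sqrt] Bochner_Integration.integral_cong) (auto simp: U_in indicator_def)
  have "relatively_compactin (LpL2_topology p T) (range u) \<longleftrightarrow>
      (\<forall>\<epsilon>>0. \<exists>J. finite J \<and> (\<forall>k. \<exists>j\<in>J. ?d k j < \<epsilon>))"
    by (rule relatively_compactin_LpL2_iff[OF p(2) u_LpL2])
  also have "\<dots> \<longleftrightarrow> energy_totally_bounded T U"
  proof
    assume tb: "\<forall>\<epsilon>>0. \<exists>J. finite J \<and> (\<forall>k. \<exists>j\<in>J. ?d k j < \<epsilon>)"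
    show "energy_totally_bounded T U"
      unfolding energy_totally_bounded_def
    proof (intro allI impI)
      fix e :: real assume e: "0 < e"
      obtain B where B: "0 \<le> B" "\<And>k j. (\<integral>\<^sup>+t. ennreal (?a k j t powr 2) \<partial>lborel) \<le>
          ennreal (e / 2) + ennreal B * (\<integral>\<^sup>+t. ennreal (?a k j t powr p) \<partial>lborel)"
        using interpolation[OF p(1) two e] by blast
      \<comment> \<open>Solves \<open>\<epsilon> powr p = e / (2 * (B + 1))\<close>; the summand 1
        allows for B = 0.\<close>
      define \<epsilon> where "\<epsilon> = (e / (2 * (B + 1))) powr (1 / p)"
      have \<epsilon>: "0 < \<epsilon>" "B * \<epsilon> powr p \<le> e / 2"
        using e B(1) p by (auto simp: \<epsilon>_def powr_powr field_simps)
      obtain J where J: "finite J" "\<And>k. \<exists>j\<in>J. ?d k j < \<epsilon>"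
        using tb \<epsilon>(1) by blast
      have "\<exists>j\<in>J. ?e k j \<le> ennreal e" for k
      proof -
        obtain j where j: "j \<in> J" "?d k j < \<epsilon>" using J(2) by blast
        have "?e k j \<le>
            ennreal (e / 2) + ennreal B * ennreal (?d k j powr p)"
          using B(2)[of k j] unfolding a_energy a_LpL2 .
        also have "\<dots> = ennreal (e / 2 + B * ?d k j powr p)"
          using e B(1) assms(2) by (simp add: ennreal_plus ennreal_mult)
        also have "\<dots> \<le> ennreal e"
        proof (rule ennreal_leI)
          have "B * ?d k j powr p \<le> B * \<epsilon> powr p"
            using B(1) j(2) p by (intro mult_left_mono powr_mono2) auto
          then show "e / 2 + B * ?d k j powr p \<le> e"
            using \<epsilon>(2) by linarith
        qed
        finally show ?thesis using j(1) by blast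
      qed
      then show "\<exists>J. finite J \<and> (\<forall>k. \<exists>j\<in>J. ?e k j \<le> ennreal e)"
        using J(1) by blast
    qed
  next
    assume tb: "energy_totally_bounded T U"
    show "\<forall>\<epsilon>>0. \<exists>J. finite J \<and> (\<forall>k. \<exists>j\<in>J. ?d k j < \<epsilon>)"
    proof (intro allI impI)
      fix \<epsilon> :: real assume \<epsilon>: "0 < \<epsilon>"
      \<comment> \<open>Half of \<epsilon>, because the estimate of the norm is not strict while the
        net requires a strict inequality.\<close>
      define e where "e = (\<epsilon> / 2) powr p"
      have e: "0 < e" using \<epsilon> by (simp add: e_def)
      obtain B where B: "0 \<le> B" "\<And>k j. (\<integral>\<^sup>+t. ennreal (?a k j t powr p) \<partial>lborel) \<le>
          ennreal (e / 2) + ennreal B * (\<integral>\<^sup>+t. ennreal (?a k j t powr 2) \<partial>lborel)"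
        using interpolation[OF two p(1) e] by blast
      have "0 < e / (2 * (B + 1))" using e B(1) by simp
      then obtain J where J: "finite J" "\<And>k. \<exists>j\<in>J. ?e k j \<le> ennreal (e / (2 * (B + 1)))"
        using tb unfolding energy_totally_bounded_def by blast
      have "\<exists>j\<in>J. ?d k j < \<epsilon>" for k
      proof -
        obtain j where j: "j \<in> J" "?e k j \<le> ennreal (e / (2 * (B + 1)))" using J(2) by blast
        have "(\<integral>\<^sup>+t. ennreal (?a k j t powr p) \<partial>lborel) \<le> ennreal (e / 2) + ennreal B * ennreal (e / (2 * (B + 1)))"
          using B(2)[of k j] unfolding a_energy by (rule order_trans) (intro add_left_mono mult_left_mono j(2), simp)
        also have "\<dots> = ennreal (e / 2 + B * (e / (2 * (B + 1))))"
          using e B(1) assms(2) by (subst ennreal_mult[symmetric], simp, simp, subst ennreal_plus[symmetric]) auto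
        also have "\<dots> \<le> ennreal ((\<epsilon> / 2) powr p)"
          unfolding e_def[symmetric] using e B(1) by (intro ennreal_leI) (simp add: field_simps)
        finally have "?d k j \<le> \<epsilon> / 2"
          using \<epsilon> p by (intro LpL2_norm_le LpL2_diff u_LpL2) auto
        then show ?thesis using \<epsilon> j(1) by (intro bexI[of _ j]) auto
      qed
      then show "\<exists>J. finite J \<and> (\<forall>k. \<exists>j\<in>J. ?d k j < \<epsilon>)"
        using J(1) by blast
    qed
  qed
  also have "\<dots> \<longleftrightarrow> uniformly_shift_continuous T U"
  proof
    assume "uniformly_shift_continuous T U"
    then show "energy_totally_bounded T U"
    proof (rule totally_bounded_if_shift_continuous)
      fix n
      let ?s = "sqrt (sobolev_weight (- L) n)"
      have s: "0 < ?s" using sobolev_weight_pos by simp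
      \<comment> \<open>Any time would do: a norm below \<open>C\<close> shows that \<open>C\<close>
        is nonnegative.\<close>
      have half: "T / 2 \<in> {0<..<T}" using assms(2) by simp
      have "0 \<le> Hs_norm (- L) (u 0 (T / 2))"
        unfolding Hs_norm_def using sobolev_weight_pos by (intro real_sqrt_ge_zero infsum_nonneg mult_nonneg_nonneg) (auto simp: less_imp_le)
      then have C0: "0 \<le> C" using C(1)[OF half, of 0] by linarith
      show "\<exists>C\<ge>0. \<forall>k. \<forall>s\<in>{0<..<T}. \<forall>t\<in>{0<..<T}. norm (fourier_coeff (U k t) n) \<le> C \<and>
          norm (fourier_coeff (U k t) n - fourier_coeff (U k s) n) \<le> C * \<bar>t - s\<bar>"
      proof (intro exI[of _ "C / ?s"] conjI allI ballI)
        fix k r t assume r: "r \<in> {0<..<T}" and t: "t \<in> {0<..<T}"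
        have "norm (fourier_coeff (u k t) n) \<le> Hs_norm (- L) (u k t) / ?s"
          by (rule norm_fourier_coeff_le_Hs[OF u_L2x(2)[OF t]])
        also have "\<dots> \<le> C / ?s" using C(1)[OF t] s by (intro divide_right_mono) auto
        finally show "norm (fourier_coeff (U k t) n) \<le> C / ?s" by (simp only: U_in[OF t])
        have "norm (fourier_coeff (\<lambda>x. u k t x - u k r x) n) \<le> Hs_norm (- L) (\<lambda>x. u k t x - u k r x) / ?s"
          by (rule norm_fourier_coeff_le_Hs[OF in_Hs_diff[OF u_L2x(1)[OF t] u_L2x(1)[OF r] u_L2x(2)[OF t] u_L2x(2)[OF r]]])
        also have "\<dots> \<le> C * \<bar>t - r\<bar> / ?s" using C(2)[OF r t] s by (intro divide_right_mono) auto
        finally show "norm (fourier_coeff (U k t) n - fourier_coeff (U k r) n) \<le> C / ?s * \<bar>t - r\<bar>"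
          by (simp add: U_in[OF t] U_in[OF r] fourier_coeff_diff u_L2x(1)[OF t] u_L2x(1)[OF r])
      qed (use C0 s in simp)
    qed
  qed (rule shift_continuous_if_totally_bounded)
  also have "\<dots> \<longleftrightarrow> (\<exists>\<phi>. modulus_of_continuity \<phi> \<and> (\<forall>r>0. \<forall>k. S2T T (U k) r \<le> \<phi> r))"
    by (rule shift_continuous_iff_modulus)
  finally show ?thesis by (simp only: S2T_U)
qed

end
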